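(* Consider the $M^X/SM2/1$ queue with $N=2$ customer types (single server, batch Poisson arrivals, semi-Markovian service times, exceptional first service in each busy period) described in the context. Let $X$ denote the stationary number of customers in the system immediately after a departure. Suppose $\mathbb{E}[B^2]$ and $\hat\alpha_{ij}$ are finite for $i,j=1,2$, and that the coefficient of $s$ in the denominator below is positive. Then $$\bar F(s)=\lim_{\rho\uparrow1}\mathbb{E}\left[e^{-s(1-\rho)X}\right]=\frac{1}{1+s\left(\frac{\bar{\hat\alpha}-1}{2}+\frac{1-\bar\alpha_2}{P_{12}+P_{21}}\left(\frac{P_{12}}{P_{21}}(1-\bar\alpha_{22})-\bar\alpha_{12}\right)\right)}.$$ Additionally, when $$\frac{1-\bar\alpha_2}{P_{12}+P_{21}}\left(\frac{P_{12}}{P_{21}}(1-\bar\alpha_{22})-\bar\alpha_{12}\right)=0,$$ then $\bar F(s)$ becomes $\left(1+s\,\frac{\bar{\hat\alpha}-1}{2}\right)^{-1}$, which is the heavy-traffic limit of the scaled queue length at departure epochs (in terms of its Laplace-Stieltjes transform) of the standard $M^X/G/1$ queue without dependencies.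
   Context: **Model.** Batches of customers arrive according to a Poisson process with rate $\lambda$; the batch size is a random variable $B\ge 1$ with generating function $B(z)$, $|z|\le1$. A single server serves customers individually. There are $N=2$ customer types. $J_n\in\{1,2\}$ is the type of the $n$th customer, $G^{(n)}$ its service time, and $X_n$ the number of customers in the system immediately after the departure of the $n$th customer. The type of a customer is determined when its service begins; it depends on the type and the service duration of the preceding customer and on whether the system was empty at the departure of that preceding customer. The first customer served in a busy period may have a different service-time distribution than the other customers. The service process is described by $$\tilde G_{ij}(s)=\mathbb{E}[e^{-sG^{(n)}}1_{\{J_{n+1}=j\}}\mid J_n=i,X_{n-1}\ge1],\qquad \tilde G^*_{ij}(s)=\mathbb{E}[e^{-sG^{(n)}}1_{\{J_{n+1}=j\}}\mid J_n=i,X_{n-1}=0].$$ Given $J_n$ and $X_{n-1}\ge1$, the number $X_{n-1}$ is conditionally independent of the pair formed by $J_{n+1}$ and the number of arrivals during the $n$th service, and $(X_n,J_{n+1})$ is a Markov chain. Let $P_{ij}=\tilde G_{ij}(0)$. The matrix $P=[P_{ij}]$ is assumed to be the transition matrix of an irreducible Markov chain, with stationary distribution $\pi_1=P_{21}/(P_{12}+P_{21})$, $\pi_2=P_{12}/(P_{12}+P_{21})$. Let $A_n$ be the number of customers (counted individually) arriving during the service of the $n$th customer, so that $$\mathbb{E}[z^{A_n}1_{\{J_{n+1}=j\}}\mid J_n=i,X_{n-1}\ge1]=\tilde G_{ij}(\lambda(1-B(z))),$$ and similarly with $\tilde G^*_{ij}$ when $X_{n-1}=0$. The queue length satisfies $X_n=X_{n-1}-1+A_n$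 if $X_{n-1}\ge1$, and $X_n=A_n+B_n-1$ if $X_{n-1}=0$, where $B_n$ is the size of the batch in which the $n$th customer arrived, with generating function $B(z)$. **Notation.** For $i,j=1,2$: - $\alpha_{ij}=\mathbb{E}[A_n1_{\{J_{n+1}=j\}}\mid J_n=i,X_{n-1}\ge1]$ and $\alpha_i=\alpha_{i1}+\alpha_{i2}$; - $\hat\alpha_{ij}=\mathbb{E}[A_n^2\,1_{\{J_{n+1}=j\}}\mid J_n=i,X_{n-1}\ge1]$, $\hat\alpha_i=\hat\alpha_{i1}+\hat\alpha_{i2}$ and $\hat\alpha=\pi_1\hat\alpha_1+\pi_2\hat\alpha_2$; - $\rho=\pi_1\alpha_1+\pi_2\alpha_2$. The stability condition is $\rho<1$, under which $X$ denotes the stationary version of $X_n$. **Heavy traffic.** The limit $\rho\uparrow1$ means that the parameters of the model are modified such that $\rho\uparrow1$; the scaled queue length is $(1-\rho)X$. A bar denotes the corresponding limit: $\bar{\hat\alpha}=\lim_{\rho\uparrow1}\hat\alpha$, $\bar\alpha_2=\lim_{\rho\uparrow1}\alpha_2$, $\bar\alpha_{ij}=\lim_{\rho\uparrow1}\alpha_{ij}$. "Without dependencies" means without dependence between successive service times.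
   Formalization: The limit ρ↑1 is along models whose rate, batch law and (first) service laws converge to a limit model, with α_ij, α̂_ij and the finite mean first service times converging to its values; no service time is a.s. zero given the type. Without such conditions the limit can fail. *)

theory Defs
  imports "HOL-Probability.Probability"
begin

section \<open>Batch Poisson input\<close>

record arrival_input =
  arr_rate :: real
  batch_law :: "nat pmf"

definition valid_input :: "'a arrival_input_scheme \<Rightarrow> bool" where
  "valid_input q \<longleftrightarrow> arr_rate q > 0 \<and> (\<forall>b \<in> set_pmf (batch_law q). 1 \<le> b)"

definition batch_gf :: "'a arrival_input_scheme \<Rightarrow> real \<Rightarrow> real" where
  "batch_gf q z = measure_pmf.expectation (batch_law q) (\<lambda>b. z ^ b)"

definition finite_batch_second_moment :: "'a arrival_input_scheme \<Rightarrow> bool" where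
  "finite_batch_second_moment q \<longleftrightarrow> integrable (measure_pmf (batch_law q)) (\<lambda>b. (real b)\<^sup>2)"

text \<open>
  Number of customers (counted individually) arriving in a time interval of length \<open>t \<ge> 0\<close>:
  a compound Poisson law. The library's \<^const>\<open>poisson_pmf\<close> is only specified for
  positive means, hence the case distinction.
\<close>

definition batch_arrivals :: "'a arrival_input_scheme \<Rightarrow> real \<Rightarrow> nat pmf" where
  "batch_arrivals q t =
     bind_pmf (if arr_rate q * t > 0 then poisson_pmf (arr_rate q * t) else return_pmf 0)
       (\<lambda>k. map_pmf sum_list (replicate_pmf k (batch_law q)))"

definition input_tendsto :: "(nat \<Rightarrow> 'a arrival_input_scheme) \<Rightarrow> 'a arrival_input_scheme \<Rightarrow> bool" where
  "input_tendsto Q Qb \<longleftrightarrow>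
     (\<lambda>n. arr_rate (Q n)) \<longlonglongrightarrow> arr_rate Qb \<and>
     (\<forall>z\<in>{0..1}. (\<lambda>n. batch_gf (Q n) z) \<longlonglongrightarrow> batch_gf Qb z)"


section \<open>The semi-Markov queue with two customer types\<close>

text \<open>
  Customer types are the elements \<open>1\<close> and \<open>2\<close> of the two-element type \<^typ>\<open>2\<close>.
  \<open>service q i\<close> is the joint law of \<open>(G\<^sup>(\<^sup>n\<^sup>), J\<^sub>n\<^sub>+\<^sub>1)\<close> given \<open>J\<^sub>n = i\<close> and \<open>X\<^sub>n\<^sub>-\<^sub>1 \<ge> 1\<close>;
  \<open>first_service q i\<close> is the same law given \<open>J\<^sub>n = i\<close> and \<open>X\<^sub>n\<^sub>-\<^sub>1 = 0\<close>.
\<close>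

record smqueue = arrival_input +
  service :: "2 \<Rightarrow> (real \<times> 2) measure"
  first_service :: "2 \<Rightarrow> (real \<times> 2) measure"

text \<open>
  Service times are nonnegative and not almost surely zero. (If, say, batches are single
  customers and first services take no time, the queue is empty after every departure
  and there is no heavy-traffic limit of the stated form.)
\<close>

definition valid_service :: "(real \<times> 2) measure \<Rightarrow> bool" where
  "valid_service S \<longleftrightarrow>
     prob_space S \<and> sets S = sets (borel \<Otimes>\<^sub>M count_space UNIV) \<and>
     (AE \<omega> in S. 0 \<le> fst \<omega>) \<and> \<not> (AE \<omega> in S. fst \<omega> = 0)"

text \<open>\<open>E[exp (- s G) 1\<^bsub>J = j\<^esub>]\<close> for \<open>(G, J)\<close> distributed according to \<open>S\<close>.\<close>

definition service_lst :: "(real \<times> 2) measure \<Rightarrow> 2 \<Rightarrow> real \<Rightarrow> real" where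
  "service_lst S j s = (\<integral>\<omega>. exp (- s * fst \<omega>) * indicator {j} (snd \<omega>) \<partial>S)"

definition type_trans :: "smqueue \<Rightarrow> 2 \<Rightarrow> 2 \<Rightarrow> real" where
  "type_trans q i j = service_lst (service q i) j 0"

definition irreducible_chain :: "('s \<Rightarrow> 's \<Rightarrow> real) \<Rightarrow> bool" where
  "irreducible_chain P \<longleftrightarrow> (\<forall>i j. (i, j) \<in> {(i, j). P i j > 0}\<^sup>*)"

definition valid_smqueue :: "smqueue \<Rightarrow> bool" where
  "valid_smqueue q \<longleftrightarrow>
     valid_input q \<and>
     (\<forall>i. valid_service (service q i)) \<and> (\<forall>i. valid_service (first_service q i)) \<and>
     irreducible_chain (type_trans q)"

definition type_stat :: "smqueue \<Rightarrow> 2 \<Rightarrow> real" where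
  "type_stat q i =
     (if i = 1 then type_trans q 2 1 else type_trans q 1 2) / (type_trans q 1 2 + type_trans q 2 1)"

text \<open>
  Joint law of the number of arrivals during a service and the type of the next customer,
  when \<open>(service time, next type)\<close> has law \<open>S\<close>. Given the service time, the arrivals are
  independent of the next type. Lemmas \<open>pmf_arrivals_during\<close> and \<open>arrivals_during_gf\<close> below
  show that this is a probability mass function with the expected generating function.
\<close>

definition arrivals_during :: "'a arrival_input_scheme \<Rightarrow> (real \<times> 2) measure \<Rightarrow> (nat \<times> 2) pmf" where
  "arrivals_during q S =
     embed_pmf (\<lambda>(a, j). \<integral>\<omega>. pmf (batch_arrivals q (fst \<omega>)) a * indicator {j} (snd \<omega>) \<partial>S)"

text \<open>
  One step of the Markov chain \<open>(X\<^sub>n, J\<^sub>n\<^sub>+\<^sub>1)\<close>. In an empty system the next customer belongs to a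
  new batch, of which the other members are waiting when its service starts.
\<close>

definition queue_step :: "smqueue \<Rightarrow> nat \<times> 2 \<Rightarrow> (nat \<times> 2) pmf" where
  "queue_step q = (\<lambda>(x, i).
     if x \<ge> 1 then map_pmf (\<lambda>(a, j). (x - 1 + a, j)) (arrivals_during q (service q i))
     else map_pmf (\<lambda>((a, j), b). (a + b - 1, j))
            (pair_pmf (arrivals_during q (first_service q i)) (batch_law q)))"

definition stationary_pmf :: "('s \<Rightarrow> 's pmf) \<Rightarrow> 's pmf \<Rightarrow> bool" where
  "stationary_pmf K \<mu> \<longleftrightarrow> bind_pmf \<mu> K = \<mu>"

definition alpha :: "smqueue \<Rightarrow> 2 \<Rightarrow> 2 \<Rightarrow> real" where
  "alpha q i j = measure_pmf.expectation (arrivals_during q (service q i))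
                   (\<lambda>(a, j'). real a * indicator {j} j')"

definition alpha_row :: "smqueue \<Rightarrow> 2 \<Rightarrow> real" where
  "alpha_row q i = alpha q i 1 + alpha q i 2"

definition alpha_hat :: "smqueue \<Rightarrow> 2 \<Rightarrow> 2 \<Rightarrow> real" where
  "alpha_hat q i j = measure_pmf.expectation (arrivals_during q (service q i))
                       (\<lambda>(a, j'). (real a)\<^sup>2 * indicator {j} j')"

definition finite_alpha_hat :: "smqueue \<Rightarrow> 2 \<Rightarrow> 2 \<Rightarrow> bool" where
  "finite_alpha_hat q i j \<longleftrightarrow>
     integrable (measure_pmf (arrivals_during q (service q i)))
       (\<lambda>(a, j'). (real a)\<^sup>2 * indicator {j} j')"

definition alpha_hat_row :: "smqueue \<Rightarrow> 2 \<Rightarrow> real" where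
  "alpha_hat_row q i = alpha_hat q i 1 + alpha_hat q i 2"

definition alpha_hat_total :: "smqueue \<Rightarrow> real" where
  "alpha_hat_total q = type_stat q 1 * alpha_hat_row q 1 + type_stat q 2 * alpha_hat_row q 2"

definition rho :: "smqueue \<Rightarrow> real" where
  "rho q = type_stat q 1 * alpha_row q 1 + type_stat q 2 * alpha_row q 2"

text \<open>
  Heavy traffic. The limit \<open>\<rho> \<up> 1\<close> is taken along an arbitrary sequence of stable models \<open>Q n\<close>
  whose parameters (arrival rate, batch size law, service laws) converge to those of a limiting
  model \<open>Qb\<close>; laws converge weakly, expressed by their transforms. The limits of \<open>\<alpha>\<^sub>i\<^sub>j\<close> and
  \<open>\<alpha>-hat\<^sub>i\<^sub>j\<close>, written with a bar on paper, are the corresponding quantities of \<open>Qb\<close>, so no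
  mass of \<open>A\<^sub>n\<^sup>2\<close> escapes to infinity; the mean first service times converge likewise.
  Without such a requirement the limit law of \<open>(1 - \<rho>) X\<close> is not determined by the limits
  of \<open>\<alpha>\<^sub>i\<^sub>j\<close> and \<open>\<alpha>-hat\<^sub>i\<^sub>j\<close>.
  The special case in which only the arrival rate varies satisfies all of these conditions
  whenever the moments are finite.
\<close>

definition smqueue_tendsto :: "(nat \<Rightarrow> smqueue) \<Rightarrow> smqueue \<Rightarrow> bool" where
  "smqueue_tendsto Q Qb \<longleftrightarrow>
     input_tendsto Q Qb \<and>
     (\<forall>i j. \<forall>s\<ge>0. (\<lambda>n. service_lst (service (Q n) i) j s) \<longlonglongrightarrow> service_lst (service Qb i) j s) \<and>
     (\<forall>i j. \<forall>s\<ge>0. (\<lambda>n. service_lst (first_service (Q n) i) j s)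
                     \<longlonglongrightarrow> service_lst (first_service Qb i) j s)"

definition heavy_traffic :: "(nat \<Rightarrow> smqueue) \<Rightarrow> smqueue \<Rightarrow> bool" where
  "heavy_traffic Q Qb \<longleftrightarrow>
     smqueue_tendsto Q Qb \<and>
     (\<forall>i j. (\<lambda>n. alpha (Q n) i j) \<longlonglongrightarrow> alpha Qb i j) \<and>
     (\<forall>i j. (\<lambda>n. alpha_hat (Q n) i j) \<longlonglongrightarrow> alpha_hat Qb i j) \<and>
     (\<forall>n i. integrable (first_service (Q n) i) fst) \<and>
     (\<forall>i. integrable (first_service Qb i) fst) \<and>
     (\<forall>i. (\<lambda>n. \<integral>\<omega>. fst \<omega> \<partial>first_service (Q n) i) \<longlonglongrightarrow> (\<integral>\<omega>. fst \<omega> \<partial>first_service Qb i)) \<and>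
     (\<forall>n. rho (Q n) < 1) \<and> (\<lambda>n. rho (Q n)) \<longlonglongrightarrow> 1"

definition dependence_term :: "smqueue \<Rightarrow> real" where
  "dependence_term q =
     (1 - alpha_row q 2) / (type_trans q 1 2 + type_trans q 2 1) *
     (type_trans q 1 2 / type_trans q 2 1 * (1 - alpha q 2 2) - alpha q 1 2)"


section \<open>The standard batch-arrival queue with independent services\<close>

record mxg1 = arrival_input +
  service_law :: "real measure"

definition valid_mxg1 :: "mxg1 \<Rightarrow> bool" where
  "valid_mxg1 q \<longleftrightarrow>
     valid_input q \<and> prob_space (service_law q) \<and> sets (service_law q) = sets borel \<and>
     (AE g in service_law q. 0 \<le> g) \<and> \<not> (AE g in service_law q. g = 0)"

definition mxg1_arrivals :: "mxg1 \<Rightarrow> nat pmf" where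
  "mxg1_arrivals q = embed_pmf (\<lambda>a. \<integral>g. pmf (batch_arrivals q g) a \<partial>service_law q)"

definition mxg1_step :: "mxg1 \<Rightarrow> nat \<Rightarrow> nat pmf" where
  "mxg1_step q x =
     (if x \<ge> 1 then map_pmf (\<lambda>a. x - 1 + a) (mxg1_arrivals q)
      else map_pmf (\<lambda>(a, b). a + b - 1) (pair_pmf (mxg1_arrivals q) (batch_law q)))"

definition mxg1_rho :: "mxg1 \<Rightarrow> real" where
  "mxg1_rho q = measure_pmf.expectation (mxg1_arrivals q) real"

definition mxg1_second_moment :: "mxg1 \<Rightarrow> real" where
  "mxg1_second_moment q = measure_pmf.expectation (mxg1_arrivals q) (\<lambda>a. (real a)\<^sup>2)"

definition mxg1_finite_moments :: "mxg1 \<Rightarrow> bool" where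
  "mxg1_finite_moments q \<longleftrightarrow>
     finite_batch_second_moment q \<and>
     integrable (measure_pmf (mxg1_arrivals q)) (\<lambda>a. (real a)\<^sup>2)"

definition mxg1_heavy_traffic :: "(nat \<Rightarrow> mxg1) \<Rightarrow> mxg1 \<Rightarrow> bool" where
  "mxg1_heavy_traffic Q Qb \<longleftrightarrow>
     input_tendsto Q Qb \<and>
     (\<forall>s\<ge>0. (\<lambda>n. \<integral>g. exp (- s * g) \<partial>service_law (Q n)) \<longlonglongrightarrow> (\<integral>g. exp (- s * g) \<partial>service_law Qb)) \<and>
     (\<lambda>n. mxg1_second_moment (Q n)) \<longlonglongrightarrow> mxg1_second_moment Qb \<and>
     (\<forall>n. mxg1_rho (Q n) < 1) \<and> (\<lambda>n. mxg1_rho (Q n)) \<longlonglongrightarrow> 1"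


section \<open>Consistency of the arrival laws\<close>

lemma pmf_batch_arrivals:
  assumes "arr_rate q * t > 0"
  shows "ennreal (pmf (batch_arrivals q t) a) =
    (\<Sum>k. ennreal ((arr_rate q * t) ^ k / fact k * exp (- (arr_rate q * t))) *
         ennreal (pmf (map_pmf sum_list (replicate_pmf k (batch_law q))) a))"
  using assms unfolding batch_arrivals_def
  by (simp add: ennreal_pmf_bind nn_integral_measure_pmf nn_integral_count_space_nat)

lemma batch_arrivals_measurable [measurable]:
  "(\<lambda>t. pmf (batch_arrivals q t) a) \<in> borel_measurable borel"
proof -
  have eq: "(\<lambda>t. pmf (batch_arrivals q t) a) = (\<lambda>t. if arr_rate q * t > 0 then
      enn2real (\<Sum>k. ennreal ((arr_rate q * t) ^ k / fact k * exp (- (arr_rate q * t))) *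
         ennreal (pmf (map_pmf sum_list (replicate_pmf k (batch_law q))) a))
      else pmf (return_pmf 0) a)" (is "_ = ?f")
  proof
    fix t
    show "pmf (batch_arrivals q t) a = ?f t"
    proof (cases "arr_rate q * t > 0")
      case True
      then show ?thesis by (simp only: if_True pmf_batch_arrivals[OF True, symmetric]) simp
    next
      case False
      then show ?thesis by (simp add: batch_arrivals_def bind_return_pmf)
    qed
  qed
  show ?thesis unfolding eq by measurable
qed

lemma pmf_arrivals_during:
  assumes "valid_service S"
  shows "pmf (arrivals_during q S) (a, j) =
    (\<integral>\<omega>. pmf (batch_arrivals q (fst \<omega>)) a * indicator {j} (snd \<omega>) \<partial>S)"
proof -
  interpret prob_space S using assms by (simp add: valid_service_def)
  have [measurable_cong]: "sets S = sets (borel \<Otimes>\<^sub>M count_space UNIV)"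
    using assms by (simp add: valid_service_def)
  define f where "f = (\<lambda>(a, j). \<integral>\<omega>. pmf (batch_arrivals q (fst \<omega>)) a * indicator {j} (snd \<omega>) \<partial>S)"
  have f: "ennreal (f (a, j)) =
      (\<integral>\<^sup>+\<omega>. ennreal (pmf (batch_arrivals q (fst \<omega>)) a * indicator {j} (snd \<omega>)) \<partial>S)" for a j
    unfolding f_def split
    by (subst nn_integral_eq_integral)
       (auto intro!: integrable_const_bound[where B = 1] AE_I2 simp: pmf_le_1 indicator_def)
  have "(\<integral>\<^sup>+x. ennreal (f x) \<partial>count_space UNIV) =
      (\<integral>\<^sup>+x. (\<integral>\<^sup>+\<omega>. ennreal (pmf (batch_arrivals q (fst \<omega>)) (fst x) * indicator {snd x} (snd \<omega>)) \<partial>S)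
        \<partial>count_space UNIV)"
    by (intro nn_integral_cong) (metis f prod.collapse)
  also have "\<dots> = (\<integral>\<^sup>+\<omega>. (\<integral>\<^sup>+x. ennreal (pmf (batch_arrivals q (fst \<omega>)) (fst x) * indicator {snd x} (snd \<omega>))
        \<partial>count_space UNIV) \<partial>S)"
    by (rule nn_integral_count_space_nn_integral[symmetric]) auto
  also have "\<dots> = (\<integral>\<^sup>+\<omega>. 1 \<partial>S)"
  proof (rule nn_integral_cong)
    fix \<omega>
    have "(\<integral>\<^sup>+x. ennreal (pmf (batch_arrivals q (fst \<omega>)) (fst x) * indicator {snd x} (snd \<omega>))
        \<partial>count_space UNIV) =
      (\<integral>\<^sup>+x. ennreal (pmf (pair_pmf (batch_arrivals q (fst \<omega>)) (return_pmf (snd \<omega>))) x) \<partial>count_space UNIV)"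
      by (intro nn_integral_cong) (auto simp: pmf_pair indicator_def split: prod.splits)
    also have "\<dots> = 1" by (simp add: nn_integral_pmf)
    finally show "(\<integral>\<^sup>+x. ennreal (pmf (batch_arrivals q (fst \<omega>)) (fst x) * indicator {snd x} (snd \<omega>))
        \<partial>count_space UNIV) = 1" .
  qed
  also have "\<dots> = 1" by (simp add: emeasure_space_1)
  finally have one: "(\<integral>\<^sup>+x. ennreal (f x) \<partial>count_space UNIV) = 1" .
  have nonneg: "0 \<le> f x" for x
    by (cases x) (auto simp: f_def intro!: integral_nonneg_AE)
  show ?thesis
    using pmf_embed_pmf[of f, OF nonneg one, of "(a, j)"] by (simp add: arrivals_during_def f_def)
qed

lemma replicate_gf:
  assumes "0 \<le> z"
  shows "(\<integral>\<^sup>+xs. ennreal (z ^ sum_list xs) \<partial>replicate_pmf k (p :: nat pmf)) =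
    (\<integral>\<^sup>+b. ennreal (z ^ b) \<partial>p) ^ k"
proof (induction k)
  case (Suc k)
  show ?case using assms
    by (simp add: nn_integral_bind_pmf power_add ennreal_mult nn_integral_cmult nn_integral_multc Suc)
qed simp

lemma batch_gf_bounds:
  assumes "0 \<le> z" "z \<le> 1"
  shows "0 \<le> batch_gf q z" "batch_gf q z \<le> 1"
    "(\<integral>\<^sup>+b. ennreal (z ^ b) \<partial>batch_law q) = ennreal (batch_gf q z)"
proof -
  have int: "integrable (measure_pmf (batch_law q)) (\<lambda>b. z ^ b)"
    using assms by (intro measure_pmf.integrable_const_bound[where B = 1]) (auto simp: power_le_one)
  show "0 \<le> batch_gf q z" using assms by (auto simp: batch_gf_def)
  show "batch_gf q z \<le> 1"
    unfolding batch_gf_def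
    using int assms by (intro measure_pmf.integral_le_const) (auto simp: power_le_one)
  show "(\<integral>\<^sup>+b. ennreal (z ^ b) \<partial>batch_law q) = ennreal (batch_gf q z)"
    unfolding batch_gf_def using int assms by (intro nn_integral_eq_integral) auto
qed

lemma batch_arrivals_gf:
  assumes q: "valid_input q" and t: "0 \<le> t" and z: "0 \<le> z" "z \<le> 1"
  shows "(\<integral>\<^sup>+a. ennreal (z ^ a) \<partial>batch_arrivals q t) =
    ennreal (exp (- (arr_rate q * (1 - batch_gf q z)) * t))"
proof -
  have r: "arr_rate q > 0" using q by (simp add: valid_input_def)
  let ?b = "batch_gf q z" and ?m = "arr_rate q * t"
  note b = batch_gf_bounds[OF z, of q]
  have *: "(\<integral>\<^sup>+a. ennreal (z ^ a) \<partial>batch_arrivals q t) =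
      (\<integral>\<^sup>+k. ennreal (?b ^ k) \<partial>(if ?m > 0 then poisson_pmf ?m else return_pmf 0))"
    unfolding batch_arrivals_def using z b
    by (simp add: nn_integral_bind_pmf replicate_gf ennreal_power)
  show ?thesis
  proof (cases "t = 0")
    case True
    then show ?thesis using * by simp
  next
    case False
    then have m: "?m > 0" using r t by simp
    have eq: "ennreal (?m ^ k / fact k * exp (- ?m)) * ennreal (?b ^ k) =
        ennreal (exp (- ?m) * ((?m * ?b) ^ k /\<^sub>R fact k))" for k
      using r t b(1) by (subst ennreal_mult[symmetric]) (simp_all add: power_mult_distrib field_simps)
    have "(\<integral>\<^sup>+k. ennreal (?b ^ k) \<partial>poisson_pmf ?m) =
        (\<Sum>k. ennreal (exp (- ?m) * ((?m * ?b) ^ k /\<^sub>R fact k)))"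
      by (simp only: nn_integral_measure_pmf nn_integral_count_space_nat pmf_poisson[OF m] eq)
    also have "\<dots> = ennreal (exp (- ?m) * exp (?m * ?b))"
      using r t b(1) by (intro suminf_ennreal_eq sums_mult exp_converges) simp
    also have "exp (- ?m) * exp (?m * ?b) = exp (- (arr_rate q * (1 - ?b)) * t)"
      by (simp add: exp_add[symmetric] algebra_simps)
    finally show ?thesis using * m by simp
  qed
qed

lemma arrivals_during_gf:
  assumes q: "valid_input q" and S: "valid_service S" and z: "0 \<le> z" "z \<le> 1"
  shows "measure_pmf.expectation (arrivals_during q S) (\<lambda>(a, j'). z ^ a * indicator {j} j') =
    service_lst S j (arr_rate q * (1 - batch_gf q z))"
proof -
  interpret prob_space S using S by (simp add: valid_service_def)
  have [measurable_cong]: "sets S = sets (borel \<Otimes>\<^sub>M count_space UNIV)"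
    using S by (simp add: valid_service_def)
  have ae: "AE \<omega> in S. 0 \<le> fst \<omega>" using S by (simp add: valid_service_def)
  define s where "s = arr_rate q * (1 - batch_gf q z)"
  have s: "0 \<le> s" using q batch_gf_bounds[OF z, of q] by (simp add: s_def valid_input_def)
  have pm: "ennreal (pmf (arrivals_during q S) x) =
      (\<integral>\<^sup>+\<omega>. ennreal (pmf (batch_arrivals q (fst \<omega>)) (fst x) * indicator {snd x} (snd \<omega>)) \<partial>S)" for x
    by (cases x, simp add: pmf_arrivals_during[OF S], subst nn_integral_eq_integral)
       (auto intro!: integrable_const_bound[where B = 1] AE_I2 simp: pmf_le_1 indicator_def)
  have "(\<integral>\<^sup>+x. ennreal (z ^ fst x * indicator {j} (snd x)) \<partial>arrivals_during q S) =
      (\<integral>\<^sup>+x. (\<integral>\<^sup>+\<omega>. ennreal (pmf (batch_arrivals q (fst \<omega>)) (fst x) * indicator {snd x} (snd \<omega>)) *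
          ennreal (z ^ fst x * indicator {j} (snd x)) \<partial>S) \<partial>count_space UNIV)"
    by (simp add: nn_integral_measure_pmf pm nn_integral_multc)
  also have "\<dots> = (\<integral>\<^sup>+\<omega>. (\<integral>\<^sup>+x. ennreal (pmf (batch_arrivals q (fst \<omega>)) (fst x) * indicator {snd x} (snd \<omega>)) *
          ennreal (z ^ fst x * indicator {j} (snd x)) \<partial>count_space UNIV) \<partial>S)"
    by (rule nn_integral_count_space_nn_integral[symmetric]) auto
  also have "\<dots> = (\<integral>\<^sup>+\<omega>. ennreal (exp (- s * fst \<omega>) * indicator {j} (snd \<omega>)) \<partial>S)"
  proof (rule nn_integral_cong_AE, use ae in eventually_elim)
    fix \<omega> :: "real \<times> 2" assume \<omega>: "0 \<le> fst \<omega>"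
    have "(\<integral>\<^sup>+x. ennreal (pmf (batch_arrivals q (fst \<omega>)) (fst x) * indicator {snd x} (snd \<omega>)) *
          ennreal (z ^ fst x * indicator {j} (snd x)) \<partial>count_space UNIV) =
        (\<integral>\<^sup>+x. ennreal (z ^ fst x * indicator {j} (snd x))
          \<partial>pair_pmf (batch_arrivals q (fst \<omega>)) (return_pmf (snd \<omega>)))"
      unfolding nn_integral_measure_pmf
      by (intro nn_integral_cong) (auto simp: pmf_pair indicator_def split: prod.splits)
    also have "\<dots> = (\<integral>\<^sup>+a. ennreal (z ^ a) \<partial>batch_arrivals q (fst \<omega>)) * indicator {j} (snd \<omega>)"
      by (auto simp: nn_integral_pair_pmf' indicator_def)
    also have "\<dots> = ennreal (exp (- s * fst \<omega>) * indicator {j} (snd \<omega>))"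
      by (simp add: batch_arrivals_gf[OF q \<omega> z] s_def indicator_def)
    finally show "(\<integral>\<^sup>+x. ennreal (pmf (batch_arrivals q (fst \<omega>)) (fst x) * indicator {snd x} (snd \<omega>)) *
          ennreal (z ^ fst x * indicator {j} (snd x)) \<partial>count_space UNIV) =
        ennreal (exp (- s * fst \<omega>) * indicator {j} (snd \<omega>))" .
  qed
  finally have nn: "(\<integral>\<^sup>+x. ennreal (z ^ fst x * indicator {j} (snd x)) \<partial>arrivals_during q S) =
    (\<integral>\<^sup>+\<omega>. ennreal (exp (- s * fst \<omega>) * indicator {j} (snd \<omega>)) \<partial>S)" .
  have "measure_pmf.expectation (arrivals_during q S) (\<lambda>(a, j'). z ^ a * indicator {j} j') =
      enn2real (\<integral>\<^sup>+x. ennreal (z ^ fst x * indicator {j} (snd x)) \<partial>arrivals_during q S)"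
    using z by (subst integral_eq_nn_integral) (auto simp: case_prod_beta)
  also have "\<dots> = service_lst S j s"
    unfolding nn service_lst_def by (subst integral_eq_nn_integral) auto
  finally show ?thesis by (simp add: s_def)
qed

lemma pmf_mxg1_arrivals:
  assumes "valid_mxg1 q"
  shows "pmf (mxg1_arrivals q) a = (\<integral>g. pmf (batch_arrivals q g) a \<partial>service_law q)"
proof -
  interpret prob_space "service_law q" using assms by (simp add: valid_mxg1_def)
  have [measurable_cong]: "sets (service_law q) = sets borel"
    using assms by (simp add: valid_mxg1_def)
  define f where "f = (\<lambda>a. \<integral>g. pmf (batch_arrivals q g) a \<partial>service_law q)"
  have f: "ennreal (f a) = (\<integral>\<^sup>+g. ennreal (pmf (batch_arrivals q g) a) \<partial>service_law q)" for a
    unfolding f_def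
    by (subst nn_integral_eq_integral)
       (auto intro!: integrable_const_bound[where B = 1] AE_I2 simp: pmf_le_1)
  have "(\<integral>\<^sup>+a. ennreal (f a) \<partial>count_space UNIV) =
      (\<integral>\<^sup>+g. (\<integral>\<^sup>+a. ennreal (pmf (batch_arrivals q g) a) \<partial>count_space UNIV) \<partial>service_law q)"
    unfolding f by (rule nn_integral_count_space_nn_integral[symmetric]) auto
  also have "\<dots> = 1" by (simp add: nn_integral_pmf emeasure_space_1)
  finally have one: "(\<integral>\<^sup>+a. ennreal (f a) \<partial>count_space UNIV) = 1" .
  have nonneg: "0 \<le> f a" for a by (auto simp: f_def intro!: integral_nonneg_AE)
  show ?thesis
    using pmf_embed_pmf[of f, OF nonneg one, of a] by (simp add: mxg1_arrivals_def f_def)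
qed

end

(*
  No zeros of det (z I - K(z)) are needed: everything follows from E[h(X', J')] = E[h(X, J)] in
  stationarity, for three test functions h. Write eps = 1 - rho, and let c solve the Poisson equation
  that makes the drift of x - c_j equal to -eps whenever x >= 1.
  The positive part of a shift of x - c_j vanishes at x = 0, decreases at rate at most eps above 0
  and increases by a fixed amount on leaving 0; hence P(X = 0) = O(eps).
  The function x - c_j itself determines, exactly, the mean drift out of level 0.
  Finally h = z^x (1 + (1 - z) c_j + (1 - z)^2 d_j) with z = exp(- s eps) and a second Poisson
  solution d has drift z^(x - 1) ((1 - z) eps + (1 - z)^2 (kappa + o(1))) above 0, and to leading order
  its drift at 0 is given by the previous identity; dividing by eps^2 yields E z^X --> 1 / (1 + s kappa).
  The o(1) terms are uniform along the sequence because (1 - z^a) / (1 - z) and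
  (z^a - 1 + a (1 - z)) / (1 - z)^2 are increasing in z.
*)

theory Submission
  imports Defs
begin

text \<open>Three obstacles shape the argument. \<open>X - c_J\<close> need not be integrable under
  the stationary law, since first services are only assumed to have a mean; stationarity is
  therefore applied to truncations, and only the one-step drift has to be integrable. For the same
  reason the drift of the exponential function at level 0 is known only up to
  \<open>(1 - z) * o(1)\<close>. This error is negligible at order \<open>eps^2\<close> because it
  is weighted by \<open>P(X = 0) = O(eps)\<close>, a bound that rests on first services being
  nondegenerate: from level 0, high levels are reached with a probability bounded away from 0.
  Finally, the mean jump out of level 0 contains \<open>E[B]\<close>, whose convergence is not part
  of the heavy-traffic condition. It is recovered from
  \<open>alpha_i = lambda * E[B] * E[G_i]\<close>: both means are lower semicontinuous under
  convergence of transforms, so neither can overshoot when the product converges. The dependence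
  term is the part of \<open>kappa\<close> contributed by \<open>c\<close>; in a standard queue,
  embedded with types drawn by fair coin tosses, \<open>c\<close> vanishes.\<close>

section \<open>Convergence from one-sided bounds and monotonicity\<close>

text \<open>Lower semicontinuity of a supremum: each \<open>t\<close> gives a lower bound of
  \<open>x n\<close> whose limit in \<open>n\<close> is known, and these limits exceed every number
  below \<open>L\<close>. Means are treated this way, as suprema of difference quotients of
  transforms.\<close>

lemma eventually_gt_of_lower_approx:
  fixes f :: "nat \<Rightarrow> 'a \<Rightarrow> real"
  assumes conv: "\<And>t. t \<in> T \<Longrightarrow> (\<lambda>n. f n t) \<longlonglongrightarrow> g t"
    and le: "\<And>t. t \<in> T \<Longrightarrow> eventually (\<lambda>n. f n t \<le> x n) sequentially"
    and approx: "\<And>c. c < L \<Longrightarrow> \<exists>t\<in>T. c < g t"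
    and c: "c < L"
  shows "eventually (\<lambda>n. c < x n) sequentially"
proof -
  obtain t where t: "t \<in> T" "c < g t" using approx[OF c] by blast
  have "eventually (\<lambda>n. c < f n t) sequentially"
    using conv[OF t(1)] t(2) by (rule order_tendstoD)
  with le[OF t(1)] show ?thesis by eventually_elim simp
qed

lemma tendsto_of_lower_approx:
  fixes f :: "nat \<Rightarrow> 'a \<Rightarrow> real"
  assumes conv: "\<And>t. t \<in> T \<Longrightarrow> (\<lambda>n. f n t) \<longlonglongrightarrow> g t"
    and le: "\<And>t. t \<in> T \<Longrightarrow> eventually (\<lambda>n. f n t \<le> x n) sequentially"
    and approx: "\<And>c. c < L \<Longrightarrow> \<exists>t\<in>T. c < g t"
    and y: "y \<longlonglongrightarrow> L" "\<And>n. x n \<le> y n"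
  shows "x \<longlonglongrightarrow> L"
proof (rule order_tendstoI)
  fix c assume "c < L"
  then show "eventually (\<lambda>n. c < x n) sequentially"
    using eventually_gt_of_lower_approx[of T f g x L c] conv le approx by blast
next
  fix c assume "L < c"
  with y(1) have "eventually (\<lambda>n. y n < c) sequentially" by (rule order_tendstoD)
  then show "eventually (\<lambda>n. x n < c) sequentially"
    by eventually_elim (use y(2) in \<open>blast intro: le_less_trans\<close>)
qed

text \<open>If \<open>x n\<close> exceeded some \<open>c > a\<close>, then choosing
  \<open>d < b\<close> with \<open>a * b < c * d\<close> as a lower bound of \<open>y n\<close>
  would push the product above \<open>c * d\<close>. Lower bounds for both factors together with the
  limit of the product thus leave no room above.\<close>

lemma tendsto_factor:
  fixes x y :: "nat \<Rightarrow> real"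
  assumes prod: "(\<lambda>n. x n * y n) \<longlonglongrightarrow> a * b" and pos: "0 < a" "0 < b"
    and x: "\<And>c. c < a \<Longrightarrow> eventually (\<lambda>n. c < x n) sequentially"
    and y: "\<And>c. c < b \<Longrightarrow> eventually (\<lambda>n. c < y n) sequentially"
  shows "x \<longlonglongrightarrow> a"
proof (rule order_tendstoI)
  fix c assume "c < a" then show "eventually (\<lambda>n. c < x n) sequentially" by (rule x)
next
  fix c assume c: "a < c"
  then have c0: "0 < c" using pos by simp
  have "a * b / c < b" using c pos by (simp add: field_simps)
  then obtain d where d: "a * b / c < d" "d < b" using dense by blast
  have d0: "0 < d" using d(1) c0 pos by (smt (verit) divide_pos_pos mult_pos_pos)
  have "a * b < c * d" using d(1) c0 by (simp add: field_simps)
  with prod have "eventually (\<lambda>n. x n * y n < c * d) sequentially" by (rule order_tendstoD)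
  with y[OF d(2)] show "eventually (\<lambda>n. x n < c) sequentially"
  proof eventually_elim
    case (elim n)
    show ?case
    proof (rule ccontr)
      assume "\<not> x n < c"
      then have "c * d \<le> x n * y n" using elim(1) c0 d0 by (intro mult_mono) auto
      with elim(2) show False by simp
    qed
  qed
qed

text \<open>Monotonicity stands in for uniform convergence: \<open>S n\<close> is eventually on one
  side of a fixed \<open>t\<close> near \<open>s\<close>, where pointwise convergence applies, and
  continuity of \<open>g\<close> supplies such a \<open>t\<close>. The moving point will be the
  argument \<open>lambda (1 - B(z))\<close>, in which both the rate and the batch law vary with
  \<open>n\<close>.\<close>

lemma antimono_tendsto_at_moving_point:
  fixes f :: "nat \<Rightarrow> real \<Rightarrow> real"
  assumes anti: "\<And>n s t. 0 \<le> s \<Longrightarrow> s \<le> t \<Longrightarrow> f n t \<le> f n s"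
    and conv: "\<And>s. 0 \<le> s \<Longrightarrow> (\<lambda>n. f n s) \<longlonglongrightarrow> g s"
    and cont: "isCont g s" and s: "0 < s" "S \<longlonglongrightarrow> s"
  shows "(\<lambda>n. f n (S n)) \<longlonglongrightarrow> g s"
proof (rule order_tendstoI)
  fix c assume c: "c < g s"
  have "eventually (\<lambda>t. c < g t) (at s)"
    using cont c by (auto simp: isCont_def intro: order_tendstoD)
  then have "eventually (\<lambda>t. c < g t) (at_right s)" by (rule filter_leD[OF at_le, rotated]) simp
  moreover have "eventually (\<lambda>t. s < t) (at_right s)" by (simp add: eventually_at_right_less)
  ultimately have "eventually (\<lambda>t. c < g t \<and> s < t) (at_right s)" by eventually_elim simp
  then obtain t where t: "c < g t" "s < t"
    using eventually_happens'[OF trivial_limit_at_right_real] by blast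
  have "eventually (\<lambda>n. c < f n t) sequentially"
    by (rule order_tendstoD(1)[OF conv t(1)]) (use s t in simp)
  moreover have "eventually (\<lambda>n. S n < t) sequentially" using s(2) t(2) by (rule order_tendstoD)
  moreover have "eventually (\<lambda>n. 0 < S n) sequentially" using s(2,1) by (rule order_tendstoD)
  ultimately show "eventually (\<lambda>n. c < f n (S n)) sequentially"
    by eventually_elim (meson anti less_imp_le less_le_trans)
next
  fix c assume c: "g s < c"
  have "eventually (\<lambda>t. g t < c) (at s)"
    using cont c by (auto simp: isCont_def intro: order_tendstoD)
  then have "eventually (\<lambda>t. g t < c) (at_left s)" by (rule filter_leD[OF at_le, rotated]) simp
  moreover have "eventually (\<lambda>t. t \<in> {0<..<s}) (at_left s)"
    using s(1) by (rule eventually_at_left_real)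
  ultimately have "eventually (\<lambda>t. g t < c \<and> t \<in> {0<..<s}) (at_left s)" by eventually_elim simp
  then obtain t where t: "g t < c" "0 < t" "t < s"
    using eventually_happens'[OF trivial_limit_at_left_real] by fastforce
  have "eventually (\<lambda>n. f n t < c) sequentially"
    by (rule order_tendstoD(2)[OF conv t(1)]) (use t in simp)
  moreover have "eventually (\<lambda>n. t < S n) sequentially" using s(2) t(3) by (rule order_tendstoD)
  ultimately show "eventually (\<lambda>n. f n (S n) < c) sequentially"
    by eventually_elim (meson anti t(2) less_imp_le le_less_trans)
qed

subsection \<open>Stationary laws\<close>

lemma expectation_bind_pmf_bounded:
  fixes f :: "'s \<Rightarrow> real"
  assumes "\<And>y. \<bar>f y\<bar> \<le> C"
  shows "measure_pmf.expectation (bind_pmf p K) f =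
    measure_pmf.expectation p (\<lambda>x. measure_pmf.expectation (K x) f)"
  unfolding measure_pmf_bind
proof (rule integral_bind[where B' = 1 and B = C and K = "count_space UNIV"])
  show "(\<lambda>x. measure_pmf (K x)) \<in> measurable (measure_pmf p) (subprob_algebra (count_space UNIV))"
    using measurable_measure_pmf[of K] by simp
qed (use assms in \<open>auto intro: measure_pmf.finite_measure_axioms\<close>)

definition truncate :: "real \<Rightarrow> real \<Rightarrow> real" where
  "truncate L x = max (- L) (min L x)"

text \<open>\<open>h\<close> itself may have no expectation under \<open>\<mu>\<close>. Its
  truncations are bounded, so stationarity gives them mean drift zero; truncation is 1-Lipschitz, so
  their drifts are dominated by the absolute drift of \<open>h\<close>, and dominated convergence
  applies first under each step law and then under \<open>\<mu>\<close>.\<close>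

lemma stationary_drift:
  fixes h :: "'s \<Rightarrow> real"
  assumes stat: "stationary_pmf K \<mu>"
    and int: "\<And>x. integrable (measure_pmf (K x)) (\<lambda>y. h y - h x)"
    and bd: "\<And>x. measure_pmf.expectation (K x) (\<lambda>y. \<bar>h y - h x\<bar>) \<le> C"
  shows "measure_pmf.expectation \<mu> (\<lambda>x. measure_pmf.expectation (K x) (\<lambda>y. h y - h x)) = 0"
proof -
  define t where "t L x = truncate (real L) (h x)" for L x
  have tb: "\<bar>t L x\<bar> \<le> real L" for L x by (auto simp: t_def truncate_def)
  have tint: "integrable (measure_pmf p) (t L)" for p L
    by (rule measure_pmf.integrable_const_bound[where B = "real L"]) (auto simp: tb)
  have td: "\<bar>t L y - t L x\<bar> \<le> \<bar>h y - h x\<bar>" for L x y by (auto simp: t_def truncate_def)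
  have tl: "(\<lambda>L. t L x) \<longlonglongrightarrow> h x" for x
  proof (rule tendsto_eventually)
    obtain N where "\<bar>h x\<bar> \<le> real N" using real_arch_simple by blast
    then show "eventually (\<lambda>L. t L x = h x) sequentially"
      unfolding eventually_sequentially by (intro exI[of _ N]) (auto simp: t_def truncate_def)
  qed
  define D where "D L x = measure_pmf.expectation (K x) (\<lambda>y. t L y - t L x)" for L x
  have D: "measure_pmf.expectation \<mu> (D L) = 0" for L
  proof -
    have "measure_pmf.expectation \<mu> (D L) =
        measure_pmf.expectation \<mu> (\<lambda>x. measure_pmf.expectation (K x) (t L) - t L x)"
      unfolding D_def by (intro arg_cong[where f = "measure_pmf.expectation \<mu>"] ext) (simp add: tint)
    also have "\<dots> = measure_pmf.expectation \<mu> (\<lambda>x. measure_pmf.expectation (K x) (t L)) -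
        measure_pmf.expectation \<mu> (t L)"
    proof (rule Bochner_Integration.integral_diff[OF _ tint])
      have "\<bar>measure_pmf.expectation (K x) (t L)\<bar> \<le> real L" for x
        using tb by (intro order_trans[OF integral_abs_bound] measure_pmf.integral_le_const integrable_abs tint) auto
      then show "integrable (measure_pmf \<mu>) (\<lambda>x. measure_pmf.expectation (K x) (t L))"
        by (intro measure_pmf.integrable_const_bound[where B = "real L"]) auto
    qed
    also have "\<dots> = 0"
      using expectation_bind_pmf_bounded[of "t L" "real L" \<mu> K] tb stat
      by (simp add: stationary_pmf_def)
    finally show ?thesis .
  qed
  have Dl: "(\<lambda>L. D L x) \<longlonglongrightarrow> measure_pmf.expectation (K x) (\<lambda>y. h y - h x)" for x
    unfolding D_def
    by (rule integral_dominated_convergence[where w = "\<lambda>y. \<bar>h y - h x\<bar>"])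
       (auto intro!: integrable_abs int tendsto_diff tl simp: td)
  have Db: "\<bar>D L x\<bar> \<le> C" for L x
  proof -
    have "\<bar>D L x\<bar> \<le> measure_pmf.expectation (K x) (\<lambda>y. \<bar>t L y - t L x\<bar>)"
      unfolding D_def by (rule integral_abs_bound)
    also have "\<dots> \<le> measure_pmf.expectation (K x) (\<lambda>y. \<bar>h y - h x\<bar>)"
      by (intro integral_mono integrable_abs int Bochner_Integration.integrable_diff tint td) auto
    finally show ?thesis using bd[of x] by simp
  qed
  have "(\<lambda>L. measure_pmf.expectation \<mu> (D L)) \<longlonglongrightarrow>
      measure_pmf.expectation \<mu> (\<lambda>x. measure_pmf.expectation (K x) (\<lambda>y. h y - h x))"
    by (rule integral_dominated_convergence[where w = "\<lambda>_. C"]) (auto simp: Dl Db)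
  then show ?thesis by (simp add: D LIMSEQ_const_iff)
qed

text \<open>Once the masses below \<open>k\<close> are known to converge, subtract them from the
  generating function and divide by \<open>z ^ k\<close>: the quotient differs from the mass at
  \<open>k\<close> by at most \<open>z\<close>, for every law at once. A small fixed
  \<open>z\<close> then settles the claim.\<close>

lemma pmf_tendsto_of_gf_tendsto:
  fixes p :: "nat \<Rightarrow> nat pmf"
  assumes gf: "\<And>z::real. 0 < z \<Longrightarrow> z < 1 \<Longrightarrow>
      (\<lambda>n. measure_pmf.expectation (p n) (\<lambda>x. z ^ x)) \<longlonglongrightarrow> measure_pmf.expectation pb (\<lambda>x. z ^ x)"
  shows "(\<lambda>n. pmf (p n) k) \<longlonglongrightarrow> pmf pb k"
proof (induction k rule: less_induct)
  case (less k)
  define g where "g q z = (measure_pmf.expectation q (\<lambda>x. z ^ x) - (\<Sum>i<k. pmf q i * z ^ i)) / z ^ k"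
    for q :: "nat pmf" and z :: real
  have g: "pmf q k \<le> g q z \<and> g q z \<le> pmf q k + z" if z: "0 < z" "z < 1" for q z
  proof -
    have sb: "z ^ x \<le> 1" for x using z by (simp add: power_le_one)
    have int: "integrable (measure_pmf q) (\<lambda>x. z ^ x)"
      using z sb by (intro measure_pmf.integrable_const_bound[where B = 1]) auto
    have fin: "integrable (measure_pmf q) (\<lambda>x. indicator {i} x * c)" for i and c :: real
      by (intro measure_pmf.integrable_const_bound[where B = "\<bar>c\<bar>"]) (auto simp: indicator_def)
    have fe: "measure_pmf.expectation q (\<lambda>x. indicator {i} x * c) = pmf q i * c" for i and c :: real
      by (simp add: measure_pmf_single)
    define r where "r x = z ^ x - (\<Sum>i<k. indicator {i} x * z ^ i)" for x :: nat
    have r: "r x = (if x < k then 0 else z ^ x)" for x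
    proof (cases "x < k")
      case True
      have "(\<Sum>i<k. indicator {i} x * z ^ i) = (\<Sum>i<k. if i = x then z ^ i else 0)"
        by (intro sum.cong) (auto simp: indicator_def)
      then show ?thesis using True by (simp add: r_def)
    next
      case False
      then have "(\<Sum>i<k. indicator {i} x * z ^ i) = 0"
        by (intro sum.neutral) (auto simp: indicator_def)
      then show ?thesis using False by (simp add: r_def)
    qed
    have rint: "integrable (measure_pmf q) r"
      unfolding r_def by (intro Bochner_Integration.integrable_diff int Bochner_Integration.integrable_sum fin)
    have es: "measure_pmf.expectation q (\<lambda>x. \<Sum>i<k. indicator {i} x * z ^ i) = (\<Sum>i<k. pmf q i * z ^ i)"
      by (subst Bochner_Integration.integral_sum, rule fin, simp only: fe)
    have er: "measure_pmf.expectation q r = g q z * z ^ k"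
      unfolding r_def g_def using z
      by (subst Bochner_Integration.integral_diff[OF int Bochner_Integration.integrable_sum[OF fin]], subst es)
         simp
    have "measure_pmf.expectation q (\<lambda>x. indicator {k} x * z ^ k) \<le> measure_pmf.expectation q r"
      by (intro integral_mono fin rint) (use z in \<open>auto simp: r indicator_def\<close>)
    then have lower: "pmf q k * z ^ k \<le> g q z * z ^ k" by (simp only: fe er)
    have "measure_pmf.expectation q r \<le>
        measure_pmf.expectation q (\<lambda>x. indicator {k} x * z ^ k + z ^ Suc k)"
      using z by (intro integral_mono rint Bochner_Integration.integrable_add fin)
        (auto simp: r indicator_def simp del: power_Suc intro!: power_decreasing)
    moreover have "measure_pmf.expectation q (\<lambda>x. indicator {k} x * z ^ k + z ^ Suc k) =
        pmf q k * z ^ k + z ^ Suc k"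
      by (subst Bochner_Integration.integral_add[OF fin], simp, subst fe, simp)
    ultimately have "g q z * z ^ k \<le> pmf q k * z ^ k + z ^ Suc k" by (simp only: er)
    then have "g q z * z ^ k \<le> (pmf q k + z) * z ^ k" by (simp add: algebra_simps)
    with lower show ?thesis using z by simp
  qed
  have gl: "(\<lambda>n. g (p n) z) \<longlonglongrightarrow> g pb z" if "0 < z" "z < 1" for z
    unfolding g_def
    by (intro tendsto_divide tendsto_diff gf that tendsto_sum tendsto_mult tendsto_const less.IH)
       (use that in auto)
  show ?case
  proof (rule LIMSEQ_I)
    fix e :: real assume e: "0 < e"
    define z where "z = min (1/2) (e / 2)"
    have z: "0 < z" "z < 1" "z \<le> e / 2" using e by (auto simp: z_def)
    obtain N where N: "\<And>n. n \<ge> N \<Longrightarrow> \<bar>g (p n) z - g pb z\<bar> < e / 2"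
      using LIMSEQ_D[OF gl[OF z(1,2)], of "e / 2"] e by auto
    show "\<exists>no. \<forall>n\<ge>no. norm (pmf (p n) k - pmf pb k) < e"
      using N g[OF z(1,2)] z(3) by (intro exI[of _ N]) (smt (verit) real_norm_def field_sum_of_halves)
  qed
qed

subsection \<open>Expansion of generating functions at 1\<close>

text \<open>Polynomial form of \<open>(1 - z ^ a) / (1 - z)\<close>: nonnegative coefficients give
  monotonicity for \<open>z >= 0\<close> at once, and the endpoint \<open>z = 1\<close> is covered
  by the same formula.\<close>

definition geo :: "nat \<Rightarrow> real \<Rightarrow> real" where
  "geo a z = (\<Sum>m<a. z ^ m)"

text \<open>Polynomial form of \<open>(a - geo a z) / (1 - z)\<close>; its value
  \<open>a (a - 1) / 2\<close> at \<open>z = 1\<close> is what brings second moments into the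
  limit.\<close>

definition geo2 :: "nat \<Rightarrow> real \<Rightarrow> real" where
  "geo2 a z = (\<Sum>m<a. geo m z)"

lemma geo_eq: "(1 - z) * geo a z = 1 - z ^ a"
  by (simp add: geo_def one_diff_power_eq)

lemma geo2_eq: "(1 - z) * geo2 a z = real a - geo a z"
proof (induction a)
  case (Suc a)
  have "(1 - z) * geo2 (Suc a) z = (1 - z) * geo2 a z + (1 - z) * geo a z"
    by (simp add: geo2_def algebra_simps)
  then show ?case by (simp add: Suc geo_eq) (simp add: geo_def)
qed (simp add: geo_def geo2_def)

lemma geo_nonneg: "0 \<le> z \<Longrightarrow> 0 \<le> geo a z" and geo2_nonneg: "0 \<le> z \<Longrightarrow> 0 \<le> geo2 a z"
  by (auto simp: geo2_def geo_def intro!: sum_nonneg)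

lemma geo_mono: "0 \<le> s \<Longrightarrow> s \<le> t \<Longrightarrow> geo a s \<le> geo a t"
  and geo2_mono: "0 \<le> s \<Longrightarrow> s \<le> t \<Longrightarrow> geo2 a s \<le> geo2 a t"
  by (auto simp: geo2_def geo_def intro!: sum_mono power_mono)

lemma geo_1: "geo a 1 = real a" by (simp add: geo_def)

lemma geo2_1: "geo2 a 1 = ((real a)\<^sup>2 - real a) / 2"
  by (induction a) (auto simp: geo2_def geo_1 power2_eq_square field_simps)

lemma geo_le: "0 \<le> z \<Longrightarrow> z \<le> 1 \<Longrightarrow> geo a z \<le> real a"
  using geo_mono[of z 1 a] by (simp add: geo_1)

lemma geo2_le_square:
  assumes "0 \<le> z" "z \<le> 1"
  shows "geo2 a z \<le> (real a)\<^sup>2"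
proof -
  have "geo2 a z \<le> ((real a)\<^sup>2 - real a) / 2" using geo2_mono[OF assms] by (simp add: geo2_1)
  then have "2 * geo2 a z \<le> (real a)\<^sup>2 - real a" by simp
  moreover have "0 \<le> (real a)\<^sup>2" "0 \<le> real a" by simp_all
  ultimately show ?thesis by linarith
qed

lemma isCont_geo: "isCont (geo a) z" and isCont_geo2: "isCont (geo2 a) z"
  unfolding geo2_def[abs_def] geo_def[abs_def] by (intro continuous_intros)+

lemma power_eq_geo: "z ^ a = 1 - (1 - z) * geo a z" by (simp add: geo_eq)

lemma geo_eq_geo2: "geo a z = real a - (1 - z) * geo2 a z" by (simp add: geo2_eq)

text \<open>The upper bound is the value at the endpoint 1, where convergence of the expectations is
  assumed. For the lower bound, a fixed \<open>t < 1\<close> is eventually below \<open>z n\<close>,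
  and under \<open>pb\<close> the expectation at \<open>t\<close> tends to the one at 1 by dominated
  convergence. Convergence at 1 plays the part of uniform integrability.\<close>

lemma expectation_tendsto_at_moving_point:
  fixes p :: "nat \<Rightarrow> 'b pmf" and \<phi> :: "real \<Rightarrow> 'b \<Rightarrow> real"
  assumes nonneg: "\<And>z x. 0 < z \<Longrightarrow> 0 \<le> \<phi> z x"
    and mono: "\<And>s t x. 0 < s \<Longrightarrow> s \<le> t \<Longrightarrow> \<phi> s x \<le> \<phi> t x"
    and cont: "\<And>x. isCont (\<lambda>z. \<phi> z x) 1"
    and int: "\<And>n. integrable (measure_pmf (p n)) (\<phi> 1)" "integrable (measure_pmf pb) (\<phi> 1)"
    and conv: "\<And>z. 0 < z \<Longrightarrow> z \<le> 1 \<Longrightarrow>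
      (\<lambda>n. measure_pmf.expectation (p n) (\<phi> z)) \<longlonglongrightarrow> measure_pmf.expectation pb (\<phi> z)"
    and z: "\<And>n. 0 < z n" "\<And>n. z n < 1" "z \<longlonglongrightarrow> 1"
  shows "(\<lambda>n. measure_pmf.expectation (p n) (\<phi> (z n))) \<longlonglongrightarrow> measure_pmf.expectation pb (\<phi> 1)"
proof -
  have ii: "integrable (measure_pmf q) (\<phi> t)"
    if "integrable (measure_pmf q) (\<phi> 1)" "0 < t" "t \<le> 1" for q t
  proof (rule Bochner_Integration.integrable_bound[OF that(1)])
    have "norm (\<phi> t x) \<le> norm (\<phi> 1 x)" for x
      using mono[OF that(2,3), of x] nonneg[OF that(2), of x] by simp
    then show "AE x in measure_pmf q. norm (\<phi> t x) \<le> norm (\<phi> 1 x)" by simp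
  qed simp
  have em: "measure_pmf.expectation q (\<phi> s) \<le> measure_pmf.expectation q (\<phi> t)"
    if "integrable (measure_pmf q) (\<phi> 1)" "0 < s" "s \<le> t" "t \<le> 1" for q s t
    by (rule integral_mono[OF ii[OF that(1)] ii[OF that(1)] mono]) (use that in auto)
  show ?thesis
  proof (rule tendsto_of_lower_approx[where T = "{0<..<1}" and
        f = "\<lambda>n t. measure_pmf.expectation (p n) (\<phi> t)" and
        g = "\<lambda>t. measure_pmf.expectation pb (\<phi> t)" and
        y = "\<lambda>n. measure_pmf.expectation (p n) (\<phi> 1)"])
    fix t :: real assume t: "t \<in> {0<..<1}"
    then show "(\<lambda>n. measure_pmf.expectation (p n) (\<phi> t)) \<longlonglongrightarrow> measure_pmf.expectation pb (\<phi> t)"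
      by (intro conv) auto
    have "eventually (\<lambda>n. t < z n) sequentially"
      using z(3) t by (intro order_tendstoD) auto
    then show "eventually (\<lambda>n. measure_pmf.expectation (p n) (\<phi> t) \<le>
        measure_pmf.expectation (p n) (\<phi> (z n))) sequentially"
      by eventually_elim (rule em[OF int(1)], use t z(2) in \<open>auto simp: less_imp_le\<close>)
  next
    fix c assume c: "c < measure_pmf.expectation pb (\<phi> 1)"
    \<comment> \<open>\<open>Suc (Suc k)\<close> rather than \<open>Suc k\<close> keeps
      \<open>t k\<close> strictly positive.\<close>
    define t where "t k = 1 - inverse (real (Suc (Suc k)))" for k
    have t: "0 < t k" "t k < 1" for k by (auto simp: t_def field_simps)
    have tl: "t \<longlonglongrightarrow> 1" unfolding t_def
    using tendsto_diff[OF tendsto_const[of 1] LIMSEQ_Suc[OF LIMSEQ_inverse_real_of_nat]] by simp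
    have "(\<lambda>k. measure_pmf.expectation pb (\<phi> (t k))) \<longlonglongrightarrow> measure_pmf.expectation pb (\<phi> 1)"
    proof (rule integral_dominated_convergence[where w = "\<phi> 1"])
      show "AE x in measure_pmf pb. (\<lambda>k. \<phi> (t k) x) \<longlonglongrightarrow> \<phi> 1 x"
        using isCont_tendsto_compose[OF cont tl] by (intro AE_I2)
      show "AE x in measure_pmf pb. norm (\<phi> (t k) x) \<le> \<phi> 1 x" for k
        using t[of k] by (auto intro!: AE_I2 mono simp: nonneg less_imp_le)
    qed (use int in auto)
    then have "eventually (\<lambda>k. c < measure_pmf.expectation pb (\<phi> (t k))) sequentially"
      using c by (rule order_tendstoD)
    then show "\<exists>t\<in>{0<..<1}. c < measure_pmf.expectation pb (\<phi> t)"
      using t unfolding eventually_sequentially by (meson greaterThanLessThan_iff order_refl)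
  next
    show "(\<lambda>n. measure_pmf.expectation (p n) (\<phi> 1)) \<longlonglongrightarrow> measure_pmf.expectation pb (\<phi> 1)"
      by (intro conv) auto
    show "measure_pmf.expectation (p n) (\<phi> (z n)) \<le> measure_pmf.expectation (p n) (\<phi> 1)" for n
      using z(1)[of n] z(2)[of n] by (intro em int) auto
  qed
qed

subsection \<open>Expectations restricted to one type\<close>

definition part_mean :: "(nat \<times> 2) pmf \<Rightarrow> (nat \<Rightarrow> real) \<Rightarrow> 2 \<Rightarrow> real" where
  "part_mean p g j = measure_pmf.expectation p (\<lambda>(a, j'). g a * indicator {j} j')"

lemma integrable_part:
  fixes g :: "nat \<Rightarrow> real" and p :: "(nat \<times> 2) pmf"
  assumes "integrable (measure_pmf p) (\<lambda>(a, j'). g a)"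
  shows "integrable (measure_pmf p) (\<lambda>(a, j'). g a * w j')"
proof -
  have "integrable (measure_pmf p) (\<lambda>x. (case x of (a, j') \<Rightarrow> g a) * (max \<bar>w 1\<bar> \<bar>w 2\<bar>))"
    by (intro integrable_mult_left assms)
  then show ?thesis
  proof (rule Bochner_Integration.integrable_bound)
    have "\<bar>w j\<bar> \<le> max \<bar>w 1\<bar> \<bar>w 2\<bar>" for j using exhaust_2[of j] by auto
    then show "AE x in measure_pmf p. norm (case x of (a, j') \<Rightarrow> g a * w j') \<le>
        norm ((case x of (a, j') \<Rightarrow> g a) * (max \<bar>w 1\<bar> \<bar>w 2\<bar>))"
      by (intro AE_I2) (auto simp: abs_mult intro!: mult_left_mono split: prod.splits)
  qed auto
qed

lemma expectation_part_sum:
  assumes int: "integrable (measure_pmf p) (\<lambda>(a, j'). g a)"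
  shows "measure_pmf.expectation p (\<lambda>(a, j'). g a * v j') =
    part_mean p g 1 * v 1 + part_mean p g 2 * v 2"
proof -
  have *: "integrable (measure_pmf p) (\<lambda>x. (case x of (a, j') \<Rightarrow> g a * indicator {j} j') * c)"
    for j and c :: real by (intro integrable_mult_left integrable_part int)
  have "(\<lambda>(a, j'). g a * v j') = (\<lambda>x. (case x of (a, j') \<Rightarrow> g a * indicator {1} j') * v 1 +
      (case x of (a, j') \<Rightarrow> g a * indicator {2} j') * v 2)"
  proof
    fix x :: "nat \<times> 2"
    show "(case x of (a, j') \<Rightarrow> g a * v j') = (case x of (a, j') \<Rightarrow> g a * indicator {1} j') * v 1 +
      (case x of (a, j') \<Rightarrow> g a * indicator {2} j') * v 2"
      using exhaust_2[of "snd x"] by (cases x) auto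
  qed
  then show ?thesis
    by (simp only:) (subst Bochner_Integration.integral_add[OF * *], simp add: part_mean_def)
qed

lemma part_mean_add:
  assumes "integrable (measure_pmf p) (\<lambda>(a, j'). g a)"
  shows "part_mean p g 1 + part_mean p g 2 = measure_pmf.expectation p (\<lambda>(a, j'). g a)"
  using expectation_part_sum[OF assms, of "\<lambda>_. 1"] by simp

lemma part_mean_linear:
  assumes "integrable (measure_pmf p) (\<lambda>(a, j'). g a)" "integrable (measure_pmf p) (\<lambda>(a, j'). h a)"
  shows "part_mean p (\<lambda>a. g a - c * h a) j = part_mean p g j - c * part_mean p h j"
proof -
  have "(\<lambda>(a, j'). (g a - c * h a) * indicator {j} j') =
    (\<lambda>x. (case x of (a, j') \<Rightarrow> g a * indicator {j} j') - c * (case x of (a, j') \<Rightarrow> h a * indicator {j} j'))"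
    by (auto simp: fun_eq_iff algebra_simps)
  then show ?thesis
    unfolding part_mean_def
    by (simp only:) (subst Bochner_Integration.integral_diff,
        auto intro!: integrable_part integrable_mult_right assms)
qed

lemma integrable_bounded_part:
  fixes g :: "nat \<Rightarrow> real"
  assumes "\<And>a. \<bar>g a\<bar> \<le> C"
  shows "integrable (measure_pmf p) (\<lambda>(a, j'). g a)"
  by (rule measure_pmf.integrable_const_bound[where B = C]) (use assms in auto)

lemma integrable_power_part:
  fixes z :: real
  assumes "0 \<le> z" "z \<le> 1"
  shows "integrable (measure_pmf p) (\<lambda>(a, j'). z ^ a)"
  using assms by (intro integrable_bounded_part[where C = 1]) (auto simp: power_le_one)

lemma part_mean_tendsto_at_moving_point:
  fixes p :: "nat \<Rightarrow> (nat \<times> 2) pmf" and \<phi> :: "nat \<Rightarrow> real \<Rightarrow> real"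
  assumes nonneg: "\<And>z a. 0 < z \<Longrightarrow> 0 \<le> \<phi> a z"
    and mono: "\<And>s t a. 0 < s \<Longrightarrow> s \<le> t \<Longrightarrow> \<phi> a s \<le> \<phi> a t"
    and cont: "\<And>a. isCont (\<phi> a) 1"
    and int: "\<And>n. integrable (measure_pmf (p n)) (\<lambda>(a, j). \<phi> a 1)"
      "integrable (measure_pmf pb) (\<lambda>(a, j). \<phi> a 1)"
    and conv: "\<And>z. 0 < z \<Longrightarrow> z \<le> 1 \<Longrightarrow>
      (\<lambda>n. part_mean (p n) (\<lambda>a. \<phi> a z) j) \<longlonglongrightarrow> part_mean pb (\<lambda>a. \<phi> a z) j"
    and z: "\<And>n. 0 < z n" "\<And>n. z n < 1" "z \<longlonglongrightarrow> 1"
  shows "(\<lambda>n. part_mean (p n) (\<lambda>a. \<phi> a (z n)) j) \<longlonglongrightarrow> part_mean pb (\<lambda>a. \<phi> a 1) j"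
  unfolding part_mean_def
  by (rule expectation_tendsto_at_moving_point[where \<phi> = "\<lambda>z (a, j'). \<phi> a z * indicator {j} j'"])
     (use assms in \<open>auto simp: part_mean_def split: prod.splits
        intro!: mult_right_mono integrable_part isCont_mult\<close>)

subsection \<open>Drift identities for a skip-free chain\<close>

text \<open>The step out of level 0 is left as an arbitrary law \<open>Y i\<close> of the next
  state, so that exceptional first services and the opening batch are felt only through its mean,
  its generating function and its tail.\<close>

definition level_step :: "(2 \<Rightarrow> (nat \<times> 2) pmf) \<Rightarrow> (2 \<Rightarrow> (nat \<times> 2) pmf) \<Rightarrow> nat \<times> 2 \<Rightarrow> (nat \<times> 2) pmf" where
  "level_step A Y = (\<lambda>(x, i). if x \<ge> 1 then map_pmf (\<lambda>(a, j). (x - 1 + a, j)) (A i) else Y i)"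

section \<open>Moments and Poisson equations of the two-type chain\<close>

definition type_prob :: "(2 \<Rightarrow> (nat \<times> 2) pmf) \<Rightarrow> 2 \<Rightarrow> 2 \<Rightarrow> real" where
  "type_prob A i j = part_mean (A i) (\<lambda>_. 1) j"

definition arr_mean :: "(2 \<Rightarrow> (nat \<times> 2) pmf) \<Rightarrow> 2 \<Rightarrow> 2 \<Rightarrow> real" where
  "arr_mean A i j = part_mean (A i) real j"

definition arr_second :: "(2 \<Rightarrow> (nat \<times> 2) pmf) \<Rightarrow> 2 \<Rightarrow> 2 \<Rightarrow> real" where
  "arr_second A i j = part_mean (A i) (\<lambda>a. (real a)\<^sup>2) j"

definition type_weight :: "(2 \<Rightarrow> (nat \<times> 2) pmf) \<Rightarrow> 2 \<Rightarrow> real" where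
  "type_weight A i = (if i = 1 then type_prob A 2 1 else type_prob A 1 2) / (type_prob A 1 2 + type_prob A 2 1)"

text \<open>Minus the drift of the level above 0, averaged over stationary types; in the queue this
  is \<open>1 - rho\<close>.\<close>

definition slack :: "(2 \<Rightarrow> (nat \<times> 2) pmf) \<Rightarrow> real" where
  "slack A = 1 - (type_weight A 1 * (arr_mean A 1 1 + arr_mean A 1 2) + type_weight A 2 * (arr_mean A 2 1 + arr_mean A 2 2))"

text \<open>
  Type-dependent corrections making the drift of \<open>X - cor1\<close> constant above level \<open>0\<close>, and, at
  the next order, the same for \<open>z ^ X\<close>: both solve a Poisson equation of the type chain,
  normalised to vanish at type \<open>1\<close>.
\<close>

definition cor1 :: "(2 \<Rightarrow> (nat \<times> 2) pmf) \<Rightarrow> 2 \<Rightarrow> real" where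
  "cor1 A i = (if i = 1 then 0 else (1 - (arr_mean A 2 1 + arr_mean A 2 2) - slack A) / type_prob A 2 1)"

text \<open>Coefficient of \<open>(1 - z)^2\<close> in the expansion at \<open>z = 1\<close> of the
  drift of \<open>z ^ x * (1 + (1 - z) * cor1 A j)\<close> from level 1 and type \<open>i\<close>.
  Only type 2 occurs in the mixed term because \<open>cor1 A 1 = 0\<close>.\<close>

definition rate2 :: "(2 \<Rightarrow> (nat \<times> 2) pmf) \<Rightarrow> 2 \<Rightarrow> real" where
  "rate2 A i = cor1 A i - arr_mean A i 2 * cor1 A 2 + (arr_second A i 1 + arr_second A i 2 - arr_mean A i 1 - arr_mean A i 2) / 2"

text \<open>The constant \<open>kappa\<close> of the limit. Averaging over stationary types is the
  solvability condition of the Poisson equation behind \<open>cor2\<close>.\<close>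

definition limit_coeff :: "(2 \<Rightarrow> (nat \<times> 2) pmf) \<Rightarrow> real" where
  "limit_coeff A = type_weight A 1 * rate2 A 1 + type_weight A 2 * rate2 A 2"

definition cor2 :: "(2 \<Rightarrow> (nat \<times> 2) pmf) \<Rightarrow> 2 \<Rightarrow> real" where
  "cor2 A i = (if i = 1 then 0 else (rate2 A 2 - limit_coeff A) / type_prob A 2 1)"

definition weight :: "(2 \<Rightarrow> (nat \<times> 2) pmf) \<Rightarrow> real \<Rightarrow> 2 \<Rightarrow> real" where
  "weight A z i = 1 + (1 - z) * cor1 A i + (1 - z)\<^sup>2 * cor2 A i"

text \<open>The coefficient of \<open>(1 - z)^2\<close> at a fixed \<open>z\<close>, exact rather
  than asymptotic: \<open>geo\<close> and \<open>geo2\<close> keep the whole remainder, so control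
  along the sequence reduces to the convergence of a few partial expectations.\<close>

definition second_order :: "(2 \<Rightarrow> (nat \<times> 2) pmf) \<Rightarrow> real \<Rightarrow> 2 \<Rightarrow> real" where
  "second_order A z i = part_mean (A i) (\<lambda>a. geo2 a z) 1 + part_mean (A i) (\<lambda>a. geo2 a z) 2
     - part_mean (A i) (\<lambda>a. geo a z) 2 * cor1 A 2 + part_mean (A i) (\<lambda>a. z ^ a) 2 * cor2 A 2
     + cor1 A i - cor2 A i + (1 - z) * cor2 A i"

text \<open>The two-state equation \<open>y + (P - I) (0, d) = m\<close>, with \<open>p\<close> the
  probability of leaving state 1 and \<open>q\<close> that of leaving state 2. Two equations for one
  unknown are compatible because \<open>m\<close> is the stationary average of \<open>y\<close>,
  which amounts to the balance \<open>q (m - y1) = p (y2 - m)\<close>.\<close>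

lemma poisson_solution:
  fixes p q y1 y2 :: real
  assumes "0 < p" "0 < q"
    and m: "m = q / (p + q) * y1 + p / (p + q) * y2" and d: "d = (y2 - m) / q"
  shows "p * d = m - y1" "q * d = y2 - m"
proof -
  show "q * d = y2 - m" using assms(2) by (simp add: d)
  have "m = (q * y1 + p * y2) / (p + q)" by (simp add: m add_divide_distrib)
  then have "m * (p + q) = q * y1 + p * y2" using assms(1,2) by (simp add: nonzero_eq_divide_eq)
  then have "q * (m - y1) = p * (y2 - m)" by (simp add: algebra_simps)
  also have "\<dots> = q * (p * d)" using assms(2) by (simp add: d)
  finally show "p * d = m - y1" using assms(2) by simp
qed

locale arrival_laws =
  fixes A :: "2 \<Rightarrow> (nat \<times> 2) pmf"
  assumes int2: "\<And>i. integrable (measure_pmf (A i)) (\<lambda>(a, j). (real a)\<^sup>2)"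
    and tr_pos: "0 < type_prob A 1 2" "0 < type_prob A 2 1"
begin

lemma int1: "integrable (measure_pmf (A i)) (\<lambda>(a, j). real a)"
proof (rule Bochner_Integration.integrable_bound[OF int2[of i]])
  have "real a \<le> (real a)\<^sup>2" for a by (cases a) (auto simp: power2_eq_square)
  then show "AE x in measure_pmf (A i). norm (case x of (a, j) \<Rightarrow> real a) \<le> norm (case x of (a, j) \<Rightarrow> (real a)\<^sup>2)"
    by (intro AE_I2) auto
qed simp

lemma tr_sum: "type_prob A i 1 + type_prob A i 2 = 1"
  unfolding type_prob_def by (subst part_mean_add) (simp_all add: case_prod_unfold)

lemma cor1_eq: "type_prob A 1 2 * cor1 A 2 = slack A + arr_mean A 1 1 + arr_mean A 1 2 - 1"
  "type_prob A 2 1 * cor1 A 2 = 1 - arr_mean A 2 1 - arr_mean A 2 2 - slack A"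
proof -
  \<comment> \<open>The slack is itself a stationary average, namely of \<open>1 - alpha_i\<close>;
    this is the form in which the two-state Poisson equation applies.\<close>
  have s: "slack A = type_prob A 2 1 / (type_prob A 1 2 + type_prob A 2 1) * (1 - (arr_mean A 1 1 + arr_mean A 1 2)) +
      type_prob A 1 2 / (type_prob A 1 2 + type_prob A 2 1) * (1 - (arr_mean A 2 1 + arr_mean A 2 2))"
  proof -
    have "type_weight A 1 + type_weight A 2 = 1"
      using tr_pos by (simp add: type_weight_def add_divide_distrib[symmetric])
    then have "slack A = type_weight A 1 * (1 - (arr_mean A 1 1 + arr_mean A 1 2)) + type_weight A 2 * (1 - (arr_mean A 2 1 + arr_mean A 2 2))"
      unfolding slack_def by algebra
    then show ?thesis by (simp add: type_weight_def)
  qed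
  note * = poisson_solution[OF tr_pos s, of "cor1 A 2"]
  show "type_prob A 1 2 * cor1 A 2 = slack A + arr_mean A 1 1 + arr_mean A 1 2 - 1"
    "type_prob A 2 1 * cor1 A 2 = 1 - arr_mean A 2 1 - arr_mean A 2 2 - slack A"
    using * by (simp_all add: cor1_def)
qed

lemma cor2_eq: "type_prob A 1 2 * cor2 A 2 = limit_coeff A - rate2 A 1" "type_prob A 2 1 * cor2 A 2 = rate2 A 2 - limit_coeff A"
proof -
  have k: "limit_coeff A = type_prob A 2 1 / (type_prob A 1 2 + type_prob A 2 1) * rate2 A 1 + type_prob A 1 2 / (type_prob A 1 2 + type_prob A 2 1) * rate2 A 2"
    by (simp add: limit_coeff_def type_weight_def)
  note * = poisson_solution[OF tr_pos k, of "cor2 A 2"]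
  show "type_prob A 1 2 * cor2 A 2 = limit_coeff A - rate2 A 1" "type_prob A 2 1 * cor2 A 2 = rate2 A 2 - limit_coeff A"
    using * by (simp_all add: cor2_def)
qed

lemma interior_poisson:
  "arr_mean A i 1 + arr_mean A i 2 - type_prob A i 2 * cor1 A 2 = 1 - slack A - cor1 A i"
  using exhaust_2[of i]
proof
  assume "i = 2"
  have t: "type_prob A 2 2 = 1 - type_prob A 2 1" using tr_sum[of 2] by simp
  show ?thesis using cor1_eq(2) unfolding \<open>i = 2\<close> t by (simp add: algebra_simps)
qed (use cor1_eq(1) in \<open>simp add: cor1_def algebra_simps\<close>)

lemma power_expansion:
  assumes "0 \<le> z" "z \<le> 1"
  shows "part_mean (A i) (\<lambda>a. z ^ a) j = type_prob A i j - (1 - z) * part_mean (A i) (\<lambda>a. geo a z) j"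
    and "part_mean (A i) (\<lambda>a. geo a z) j = arr_mean A i j - (1 - z) * part_mean (A i) (\<lambda>a. geo2 a z) j"
proof -
  have g1: "integrable (measure_pmf (A i)) (\<lambda>(a, j). geo a z)"
    by (rule Bochner_Integration.integrable_bound[OF int1[of i]])
       (use assms in \<open>auto intro!: AE_I2 simp: geo_nonneg geo_le\<close>)
  have "\<bar>geo2 a z\<bar> \<le> (real a)\<^sup>2" for a
    using geo2_le_square[OF assms, of a] geo2_nonneg[OF assms(1), of a] by simp
  then have g2: "integrable (measure_pmf (A i)) (\<lambda>(a, j). geo2 a z)"
    by (intro Bochner_Integration.integrable_bound[OF int2[of i]]) (auto intro!: AE_I2)
  show "part_mean (A i) (\<lambda>a. z ^ a) j = type_prob A i j - (1 - z) * part_mean (A i) (\<lambda>a. geo a z) j"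
    unfolding type_prob_def by (subst power_eq_geo, rule part_mean_linear) (use g1 in \<open>auto simp: case_prod_unfold\<close>)
  show "part_mean (A i) (\<lambda>a. geo a z) j = arr_mean A i j - (1 - z) * part_mean (A i) (\<lambda>a. geo2 a z) j"
    unfolding arr_mean_def by (subst geo_eq_geo2, rule part_mean_linear) (use int1 g2 in auto)
qed

text \<open>This is the drift of \<open>z ^ x * weight A z j\<close> above level 0 with the common
  factor \<open>z ^ (x - 1)\<close> removed, hence the bare \<open>z\<close> in front of
  \<open>weight A z i\<close>. The type-dependent terms of first order cancel by
  \<open>interior_poisson\<close> and leave \<open>slack A\<close>; \<open>cor2\<close> enters at
  second order only.\<close>

lemma interior_weight_drift:
  assumes "0 \<le> z" "z \<le> 1"
  shows "part_mean (A i) (\<lambda>a. z ^ a) 1 * weight A z 1 + part_mean (A i) (\<lambda>a. z ^ a) 2 * weight A z 2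
    - z * weight A z i = (1 - z) * slack A + (1 - z)\<^sup>2 * second_order A z i"
proof -
  define d where "d = 1 - z"
  define g where "g j = part_mean (A i) (\<lambda>a. geo a z) j" for j
  define g2 where "g2 j = part_mean (A i) (\<lambda>a. geo2 a z) j" for j
  define k where "k j = part_mean (A i) (\<lambda>a. z ^ a) j" for j
  have k: "k j = type_prob A i j - d * g j" and g: "g j = arr_mean A i j - d * g2 j" for j
    unfolding k_def g_def g2_def d_def using power_expansion[OF assms] by auto
  have z: "z = 1 - d" by (simp add: d_def)
  have w: "weight A z 1 = 1" "weight A z 2 = 1 + d * cor1 A 2 + d\<^sup>2 * cor2 A 2"
    "weight A z i = 1 + d * cor1 A i + d\<^sup>2 * cor2 A i"
    by (simp_all add: weight_def d_def cor1_def cor2_def)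
  have r: "second_order A z i = g2 1 + g2 2 - g 2 * cor1 A 2 + k 2 * cor2 A 2 + cor1 A i - cor2 A i + d * cor2 A i"
    by (simp add: second_order_def g_def g2_def k_def d_def)
  have "k 1 * weight A z 1 + k 2 * weight A z 2 - z * weight A z i =
      (k 1 + k 2 - 1 + d) + d * k 2 * cor1 A 2 - (1 - d) * d * cor1 A i
      + d\<^sup>2 * (k 2 * cor2 A 2 - cor2 A i + d * cor2 A i)"
    unfolding w unfolding z by (simp add: algebra_simps power2_eq_square)
  also have "k 1 + k 2 - 1 + d = d - d * (arr_mean A i 1 + arr_mean A i 2) + d\<^sup>2 * (g2 1 + g2 2)"
    unfolding k g using tr_sum[of i] by (simp add: algebra_simps power2_eq_square)
  also have "d * k 2 * cor1 A 2 = d * (type_prob A i 2 * cor1 A 2) - d\<^sup>2 * (g 2 * cor1 A 2)"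
    unfolding k by (simp add: algebra_simps power2_eq_square)
  also have "type_prob A i 2 * cor1 A 2 = arr_mean A i 1 + arr_mean A i 2 - (1 - slack A - cor1 A i)"
    using interior_poisson[of i] by simp
  finally show ?thesis
    unfolding r k_def[symmetric] d_def[symmetric] by (simp add: algebra_simps power2_eq_square)
qed

text \<open>Thanks to \<open>cor2\<close> the limit of \<open>second_order\<close> is the same for
  both types, so that to leading order the balance equation involves only the total over both
  types.\<close>

lemma rate2_poisson: "rate2 A i + type_prob A i 2 * cor2 A 2 - cor2 A i = limit_coeff A"
  using exhaust_2[of i]
proof
  assume "i = 2"
  have t: "type_prob A 2 2 = 1 - type_prob A 2 1" using tr_sum[of 2] by simp
  show ?thesis using cor2_eq(2) unfolding \<open>i = 2\<close> t by (simp add: algebra_simps)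
qed (use cor2_eq(1) in \<open>simp add: cor2_def algebra_simps\<close>)

end

section \<open>Stationary balance identities with a boundary level\<close>

locale level_chain = arrival_laws +
  fixes Y :: "2 \<Rightarrow> (nat \<times> 2) pmf" and \<mu> :: "(nat \<times> 2) pmf"
  assumes intY: "\<And>i. integrable (measure_pmf (Y i)) (\<lambda>(x, j). real x)"
    and stat_\<mu>: "stationary_pmf (level_step A Y) \<mu>"
begin

lemma split_boundary:
  fixes f :: "nat \<times> 2 \<Rightarrow> real"
  assumes "\<And>s. \<bar>f s\<bar> \<le> C"
  shows "measure_pmf.expectation \<mu> f =
    measure_pmf.expectation \<mu> (\<lambda>(x, i). if x \<ge> 1 then f (x, i) else 0) +
    pmf \<mu> (0, 1) * f (0, 1) + pmf \<mu> (0, 2) * f (0, 2)"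
proof -
  have C: "0 \<le> C" using assms[of undefined] by linarith
  have i1: "integrable (measure_pmf \<mu>) (\<lambda>(x, i). if x \<ge> 1 then f (x, i) else 0)"
    by (rule measure_pmf.integrable_const_bound[where B = C]) (use assms C in auto)
  have i2: "integrable (measure_pmf \<mu>) (\<lambda>s. indicator {t} s * c)" for t and c :: real
    by (intro measure_pmf.integrable_const_bound[where B = "\<bar>c\<bar>"]) (auto simp: indicator_def)
  have e2: "measure_pmf.expectation \<mu> (\<lambda>s. indicator {t} s * c) = pmf \<mu> t * c" for t and c :: real
    by (simp add: measure_pmf_single)
  have "f = (\<lambda>s. (case s of (x, i) \<Rightarrow> if x \<ge> 1 then f (x, i) else 0) +
      indicator {(0, 1)} s * f (0, 1) + indicator {(0, 2)} s * f (0, 2))"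
  proof
    fix s :: "nat \<times> 2"
    show "f s = (case s of (x, i) \<Rightarrow> if x \<ge> 1 then f (x, i) else 0) +
        indicator {(0, 1)} s * f (0, 1) + indicator {(0, 2)} s * f (0, 2)"
      using exhaust_2[of "snd s"] by (cases s) (auto simp: indicator_def Suc_le_eq)
  qed
  then have "measure_pmf.expectation \<mu> f = measure_pmf.expectation \<mu>
      (\<lambda>s. (case s of (x, i) \<Rightarrow> if x \<ge> 1 then f (x, i) else 0) +
      indicator {(0, 1)} s * f (0, 1) + indicator {(0, 2)} s * f (0, 2))" by (rule arg_cong)
  also have "\<dots> = measure_pmf.expectation \<mu> (\<lambda>(x, i). if x \<ge> 1 then f (x, i) else 0) +
    pmf \<mu> (0, 1) * f (0, 1) + pmf \<mu> (0, 2) * f (0, 2)"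
    by (simp only: Bochner_Integration.integral_add[OF Bochner_Integration.integrable_add[OF i1 i2] i2]
      Bochner_Integration.integral_add[OF i1 i2] e2)
  finally show ?thesis .
qed

lemma expectation_level_step:
  fixes f :: "nat \<times> 2 \<Rightarrow> real"
  shows "measure_pmf.expectation (level_step A Y (x, i)) f =
    (if x \<ge> 1 then measure_pmf.expectation (A i) (\<lambda>(a, j). f (x - 1 + a, j))
     else measure_pmf.expectation (Y i) f)"
  by (simp add: level_step_def case_prod_unfold)

lemma integrable_level_step:
  fixes f :: "nat \<times> 2 \<Rightarrow> real"
  shows "integrable (measure_pmf (level_step A Y (x, i))) f \<longleftrightarrow>
    (if x \<ge> 1 then integrable (measure_pmf (A i)) (\<lambda>(a, j). f (x - 1 + a, j))
     else integrable (measure_pmf (Y i)) f)"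
  by (simp add: level_step_def case_prod_unfold)

text \<open>One step moves the level by at most \<open>a + 1\<close> above 0, and at level 0 by the
  value drawn from \<open>Y i\<close>. A function that is Lipschitz in the level up to a constant
  therefore has uniformly bounded mean absolute drift, which is all that
  \<open>stationary_drift\<close> asks for.\<close>

lemma lipschitz_balance:
  fixes h :: "nat \<times> 2 \<Rightarrow> real"
  assumes lip: "\<And>x i y j. \<bar>h (y, j) - h (x, i)\<bar> \<le> \<bar>real y - real x\<bar> + C"
  defines "D \<equiv> \<lambda>s. measure_pmf.expectation (level_step A Y s) (\<lambda>s'. h s' - h s)"
  shows "measure_pmf.expectation \<mu> D = 0"
    and "\<exists>B. \<forall>s. \<bar>D s\<bar> \<le> B"
    and "integrable (measure_pmf (level_step A Y s)) (\<lambda>s'. h s' - h s)"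
proof -
  have C: "0 \<le> C" using lip[of 0 1 0 1] by simp
  have gA: "integrable (measure_pmf (A i)) (\<lambda>(a, j). real a + (1 + C))" for i
    using Bochner_Integration.integrable_add[OF int1[of i], of "\<lambda>_. 1 + C"] by (simp add: case_prod_unfold)
  have gY: "integrable (measure_pmf (Y i)) (\<lambda>(a, j). real a + (1 + C))" for i
    using Bochner_Integration.integrable_add[OF intY[of i], of "\<lambda>_. 1 + C"] by (simp add: case_prod_unfold)
  have lA: "\<bar>h (x - 1 + a, j) - h (x, i)\<bar> \<le> real a + (1 + C)" if "x \<ge> 1" for x a i j
  proof -
    have "\<bar>real (x - 1 + a) - real x\<bar> \<le> real a + 1" using that by (simp add: of_nat_diff)
    then show ?thesis using lip[of "x - 1 + a" j x i] by linarith
  qed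
  have lY: "\<bar>h (a, j) - h (0, i)\<bar> \<le> real a + (1 + C)" for a i j
    using lip[of a j 0 i] by simp
  define B where "B = (\<Sum>i\<in>UNIV. measure_pmf.expectation (A i) (\<lambda>(a, j). real a + (1 + C))) +
     (\<Sum>i\<in>UNIV. measure_pmf.expectation (Y i) (\<lambda>(a, j). real a + (1 + C)))"
  have posA: "0 \<le> measure_pmf.expectation (A i) (\<lambda>(a, j). real a + (1 + C))"
    and posY: "0 \<le> measure_pmf.expectation (Y i) (\<lambda>(a, j). real a + (1 + C))" for i
    using C by (auto intro!: integral_nonneg_AE AE_I2)
  have leA: "measure_pmf.expectation (A i) (\<lambda>(a, j). real a + (1 + C)) \<le> B"
    and leY: "measure_pmf.expectation (Y i) (\<lambda>(a, j). real a + (1 + C)) \<le> B" for i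
    using exhaust_2[of i] posA[of 1] posA[of 2] posY[of 1] posY[of 2] by (auto simp: B_def UNIV_2)
  show int: "integrable (measure_pmf (level_step A Y s)) (\<lambda>s'. h s' - h s)" for s
  proof (cases s)
    case [simp]: (Pair x i)
    show ?thesis
    proof (cases "x \<ge> 1")
      case True
      have "integrable (measure_pmf (A i)) (\<lambda>(a, j). h (x - 1 + a, j) - h (x, i))"
        by (rule Bochner_Integration.integrable_bound[OF gA[of i]])
           (use lA[OF True] C in \<open>auto intro!: AE_I2\<close>)
      then show ?thesis using True by (simp add: integrable_level_step)
    next
      case False
      then have [simp]: "x = 0" by simp
      have "integrable (measure_pmf (Y i)) (\<lambda>s'. h s' - h (0, i))"
        by (rule Bochner_Integration.integrable_bound[OF gY[of i]])
           (use lY C in \<open>auto intro!: AE_I2\<close>)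
      then show ?thesis by (simp add: integrable_level_step)
    qed
  qed
  have bd: "measure_pmf.expectation (level_step A Y s) (\<lambda>s'. \<bar>h s' - h s\<bar>) \<le> B" for s
  proof (cases s)
    case [simp]: (Pair x i)
    have ia: "integrable (measure_pmf (level_step A Y s)) (\<lambda>s'. \<bar>h s' - h s\<bar>)"
      by (intro integrable_abs int)
    show ?thesis
    proof (cases "x \<ge> 1")
      case True
      then have "measure_pmf.expectation (level_step A Y s) (\<lambda>s'. \<bar>h s' - h s\<bar>) =
          measure_pmf.expectation (A i) (\<lambda>(a, j). \<bar>h (x - 1 + a, j) - h (x, i)\<bar>)"
        by (simp add: expectation_level_step)
      also have "\<dots> \<le> measure_pmf.expectation (A i) (\<lambda>(a, j). real a + (1 + C))"
        by (intro integral_mono gA) (use lA[OF True] ia True in \<open>auto simp: integrable_level_step\<close>)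
      finally show ?thesis using leA[of i] by simp
    next
      case False
      then have [simp]: "x = 0" by simp
      have "measure_pmf.expectation (level_step A Y s) (\<lambda>s'. \<bar>h s' - h s\<bar>) =
          measure_pmf.expectation (Y i) (\<lambda>s'. \<bar>h s' - h (0, i)\<bar>)"
        by (simp add: expectation_level_step)
      also have "\<dots> \<le> measure_pmf.expectation (Y i) (\<lambda>(a, j). real a + (1 + C))"
        by (intro integral_mono gY) (use lY ia in \<open>auto simp: integrable_level_step\<close>)
      finally show ?thesis using leY[of i] by simp
    qed
  qed
  show "measure_pmf.expectation \<mu> D = 0"
    unfolding D_def by (rule stationary_drift[OF stat_\<mu> int bd])
  show "\<exists>B. \<forall>s. \<bar>D s\<bar> \<le> B"
    unfolding D_def by (intro exI[of _ B] allI order_trans[OF integral_abs_bound bd])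
qed

lemma split_constant_interior:
  fixes D :: "nat \<times> 2 \<Rightarrow> real"
  assumes "\<exists>B. \<forall>s. \<bar>D s\<bar> \<le> B" and "\<And>x i. x \<ge> 1 \<Longrightarrow> D (x, i) = c"
  shows "measure_pmf.expectation \<mu> D = c * (1 - pmf \<mu> (0, 1) - pmf \<mu> (0, 2)) +
    pmf \<mu> (0, 1) * D (0, 1) + pmf \<mu> (0, 2) * D (0, 2)"
proof -
  obtain B where B: "\<And>s. \<bar>D s\<bar> \<le> B" using assms(1) by blast
  have "measure_pmf.expectation \<mu> (\<lambda>(x, i). if x \<ge> 1 then D (x, i) else 0) =
      measure_pmf.expectation \<mu> (\<lambda>(x, i). if x \<ge> 1 then c else 0)"
    by (intro Bochner_Integration.integral_cong) (auto simp: assms(2))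
  moreover have "c = measure_pmf.expectation \<mu> (\<lambda>(x, i). if x \<ge> 1 then c else 0) +
      pmf \<mu> (0, 1) * c + pmf \<mu> (0, 2) * c"
    using split_boundary[of "\<lambda>_. c" "\<bar>c\<bar>"] by simp
  ultimately show ?thesis
    unfolding split_boundary[OF B] by (simp add: algebra_simps)
qed

definition boundary_drift :: "2 \<Rightarrow> real" where
  "boundary_drift i = measure_pmf.expectation (Y i) (\<lambda>(x, j). (real x - cor1 A j) - (0 - cor1 A i))"

lemma cor1_diff: "\<bar>cor1 A i - cor1 A j\<bar> \<le> \<bar>cor1 A 2\<bar>"
  using exhaust_2[of i] exhaust_2[of j] by (auto simp: cor1_def)

lemma interior_linear_drift:
  "integrable (measure_pmf (A i)) (\<lambda>(a, j). real a - cor1 A j)"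
  "measure_pmf.expectation (A i) (\<lambda>(a, j). real a - cor1 A j) = 1 - slack A - cor1 A i"
proof -
  have one: "integrable (measure_pmf (A i)) (\<lambda>(a, j). 1)" by (simp add: case_prod_unfold)
  have ic: "integrable (measure_pmf (A i)) (\<lambda>(a, j). 1 * cor1 A j)"
    by (rule integrable_part[OF one])
  have ec: "measure_pmf.expectation (A i) (\<lambda>(a, j). 1 * cor1 A j) = type_prob A i 2 * cor1 A 2"
    by (subst expectation_part_sum[OF one]) (simp add: type_prob_def cor1_def)
  have eq: "(\<lambda>(a, j). real a - cor1 A j) =
      (\<lambda>s :: nat \<times> 2. (case s of (a, j) \<Rightarrow> real a) - (case s of (a, j) \<Rightarrow> 1 * cor1 A j))"
    by auto
  show "integrable (measure_pmf (A i)) (\<lambda>(a, j). real a - cor1 A j)"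
    unfolding eq by (intro Bochner_Integration.integrable_diff int1 ic)
  have "measure_pmf.expectation (A i) (\<lambda>(a, j). real a - cor1 A j) = arr_mean A i 1 + arr_mean A i 2 - type_prob A i 2 * cor1 A 2"
    unfolding eq by (subst Bochner_Integration.integral_diff[OF int1 ic])
      (simp only: ec arr_mean_def part_mean_add[OF int1])
  then show "measure_pmf.expectation (A i) (\<lambda>(a, j). real a - cor1 A j) = 1 - slack A - cor1 A i"
    using interior_poisson[of i] by simp
qed

text \<open>The mean drift out of level 0 compensates the constant loss \<open>slack A\<close> above
  it. No boundary probability is computed on its own: this weighted sum is the combination that
  appears at first order in \<open>1 - z\<close> in the boundary part of
  \<open>exponential_balance\<close>.\<close>

lemma linear_balance:
  "pmf \<mu> (0, 1) * boundary_drift 1 + pmf \<mu> (0, 2) * boundary_drift 2 =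
    slack A * (1 - pmf \<mu> (0, 1) - pmf \<mu> (0, 2))"
proof -
  define h where "h = (\<lambda>(x :: nat, i). real x - cor1 A i)"
  define D where "D s = measure_pmf.expectation (level_step A Y s) (\<lambda>s'. h s' - h s)" for s
  have lip: "\<bar>h (y, j) - h (x, i)\<bar> \<le> \<bar>real y - real x\<bar> + \<bar>cor1 A 2\<bar>" for x i y j
    using cor1_diff[of i j] by (auto simp: h_def)
  note bal = lipschitz_balance[of h, OF lip, folded D_def]
  have int: "D (x, i) = - slack A" if "x \<ge> 1" for x i
  proof -
    have "D (x, i) = measure_pmf.expectation (A i) (\<lambda>s. (case s of (a, j) \<Rightarrow> real a - cor1 A j) - (1 - cor1 A i))"
      unfolding D_def expectation_level_step using that
      by (auto simp: h_def of_nat_diff case_prod_unfold intro!: Bochner_Integration.integral_cong)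
    also have "\<dots> = - slack A"
      by (subst Bochner_Integration.integral_diff[OF interior_linear_drift(1)])
         (simp_all add: interior_linear_drift(2))
    finally show ?thesis .
  qed
  have b: "D (0, i) = boundary_drift i" for i
    by (simp add: D_def expectation_level_step boundary_drift_def h_def case_prod_unfold)
  show ?thesis
    using split_constant_interior[OF bal(2) int] bal(1) by (simp add: b)
qed

text \<open>
  The positive part of a shift of \<open>X - cor1\<close> vanishes at level \<open>0\<close> and, being a convex function of
  a process of drift \<open>- slack\<close>, decreases at most at that rate above level \<open>0\<close>. This bounds the
  time spent at level \<open>0\<close>.
\<close>

lemma boundary_probability_bound:
  assumes sl: "0 \<le> slack A" and M: "\<bar>cor1 A 2\<bar> + 1 \<le> real M"
  shows "pmf \<mu> (0, 1) * measure_pmf.prob (Y 1) {(x, j). M \<le> x} +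
    pmf \<mu> (0, 2) * measure_pmf.prob (Y 2) {(x, j). M \<le> x} \<le> slack A"
proof -
  \<comment> \<open>The smallest shift for which the positive part vanishes at level 0 for both
    types. Since \<open>cor1 A j + m\<close> is at most the absolute value of
    \<open>cor1 A 2\<close>, the function is at least 1 from level \<open>M\<close> on.\<close>
  define m where "m = max 0 (- cor1 A 2)"
  define h where "h = (\<lambda>(x :: nat, i). max 0 (real x - cor1 A i - m))"
  define D where "D s = measure_pmf.expectation (level_step A Y s) (\<lambda>s'. h s' - h s)" for s
  have lip: "\<bar>h (y, j) - h (x, i)\<bar> \<le> \<bar>real y - real x\<bar> + \<bar>cor1 A 2\<bar>" for x i y j
    using cor1_diff[of i j] by (auto simp: h_def)
  note bal = lipschitz_balance[of h, OF lip, folded D_def]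
  have h0: "h (0, i) = 0" for i using exhaust_2[of i] by (auto simp: h_def m_def cor1_def)
  have hM: "1 \<le> h (x, j)" if "M \<le> x" for x j
  proof -
    have "cor1 A 1 = 0" by (simp add: cor1_def)
    moreover have "real M \<le> real x" using that by simp
    ultimately show ?thesis using exhaust_2[of j] M by (auto simp: h_def m_def max_def)
  qed
  have hn: "0 \<le> h s" for s by (simp add: h_def split: prod.splits)
  have int: "- slack A \<le> D (x, i)" if x: "x \<ge> 1" for x i
  proof -
    have i1: "integrable (measure_pmf (A i)) (\<lambda>(a, j). h (x - 1 + a, j) - h (x, i))"
      using bal(3)[of "(x, i)"] x by (simp add: integrable_level_step)
    have "- slack A = measure_pmf.expectation (A i)
        (\<lambda>s. (case s of (a, j) \<Rightarrow> real a - cor1 A j) - (1 - cor1 A i))"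
      by (subst Bochner_Integration.integral_diff[OF interior_linear_drift(1)])
         (simp_all add: interior_linear_drift(2))
    \<comment> \<open>Convexity by hand: where \<open>h\<close> vanishes it can only grow; elsewhere
      it equals the shifted linear function now and dominates it after the step.\<close>
    have "0 \<le> D (x, i)" if "h (x, i) = 0"
      using hn that by (auto simp: D_def intro!: integral_nonneg_AE)
    moreover have "- slack A \<le> D (x, i)" if "h (x, i) \<noteq> 0"
    proof -
      have hx: "h (x, i) = real x - cor1 A i - m" using that by (auto simp: h_def max_def split: if_splits)
      have "measure_pmf.expectation (A i) (\<lambda>s. (case s of (a, j) \<Rightarrow> real a - cor1 A j) - (1 - cor1 A i))
        \<le> measure_pmf.expectation (A i) (\<lambda>(a, j). h (x - 1 + a, j) - h (x, i))"
      proof (intro integral_mono i1)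
        show "integrable (measure_pmf (A i)) (\<lambda>s. (case s of (a, j) \<Rightarrow> real a - cor1 A j) - (1 - cor1 A i))"
          by (rule Bochner_Integration.integrable_diff[OF interior_linear_drift(1)]) simp
        fix s :: "nat \<times> 2"
        have "real (x - 1 + a) - cor1 A j - m \<le> h (x - 1 + a, j)" for a j by (simp add: h_def)
        then show "(case s of (a, j) \<Rightarrow> real a - cor1 A j) - (1 - cor1 A i) \<le>
            (case s of (a, j) \<Rightarrow> h (x - 1 + a, j) - h (x, i))"
          using x unfolding hx by (cases s) (simp add: of_nat_diff algebra_simps)
      qed
      also have "\<dots> = D (x, i)" using x by (simp add: D_def expectation_level_step)
      finally show ?thesis using \<open>- slack A = _\<close> by simp
    qed
    ultimately show ?thesis using sl by fastforce
  qed
  have b: "measure_pmf.prob (Y i) {(x, j). M \<le> x} \<le> D (0, i)" for i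
  proof -
    have "integrable (measure_pmf (Y i)) (indicator {(x, j). M \<le> x} :: _ \<Rightarrow> real)"
      by (rule measure_pmf.integrable_const_bound[where B = 1]) (auto simp: indicator_def)
    note [simp] = this
    have "measure_pmf.prob (Y i) {(x, j). M \<le> x} = measure_pmf.expectation (Y i) (indicator {(x, j). M \<le> x})"
      by simp
    also have "\<dots> \<le> measure_pmf.expectation (Y i) (\<lambda>s'. h s' - h (0, i))"
      using bal(3)[of "(0, i)"]
      by (intro integral_mono) (use hM hn in \<open>auto simp: integrable_level_step h0 indicator_def\<close>)
    finally show ?thesis by (simp add: D_def expectation_level_step)
  qed
  obtain B where B: "\<And>s. \<bar>D s\<bar> \<le> B" using bal(2) by blast
  have "0 = measure_pmf.expectation \<mu> (\<lambda>(x, i). if x \<ge> 1 then D (x, i) else 0) +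
    pmf \<mu> (0, 1) * D (0, 1) + pmf \<mu> (0, 2) * D (0, 2)"
    using split_boundary[OF B] bal(1) by simp
  moreover have "- slack A \<le> measure_pmf.expectation \<mu> (\<lambda>(x, i). if x \<ge> 1 then D (x, i) else 0)"
  proof (rule measure_pmf.integral_ge_const)
    have "0 \<le> B" using B[of undefined] by linarith
    then show "integrable (measure_pmf \<mu>) (\<lambda>(x, i). if x \<ge> 1 then D (x, i) else 0)"
      by (intro measure_pmf.integrable_const_bound[where B = B]) (use B in auto)
    show "AE s in measure_pmf \<mu>. - slack A \<le> (case s of (x, i) \<Rightarrow> if x \<ge> 1 then D (x, i) else 0)"
      using int sl by (simp add: AE_measure_pmf_iff split: prod.splits)
  qed
  moreover have "pmf \<mu> (0, 1) * measure_pmf.prob (Y 1) {(x, j). M \<le> x} \<le> pmf \<mu> (0, 1) * D (0, 1)"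
    by (intro mult_left_mono b) simp
  moreover have "pmf \<mu> (0, 2) * measure_pmf.prob (Y 2) {(x, j). M \<le> x} \<le> pmf \<mu> (0, 2) * D (0, 2)"
    by (intro mult_left_mono b) simp
  ultimately show ?thesis by linarith
qed

definition boundary_exp_drift :: "real \<Rightarrow> 2 \<Rightarrow> real" where
  "boundary_exp_drift z i = measure_pmf.expectation (Y i) (\<lambda>(x, j). z ^ x * weight A z j) - weight A z i"

text \<open>The exponent is \<open>x - 1\<close> because a step from a level \<open>x >= 1\<close>
  removes one customer, which makes \<open>z ^ (x - 1)\<close> the common factor of the interior
  drift.\<close>

definition above :: "real \<Rightarrow> 2 \<Rightarrow> real" where
  "above z i = part_mean \<mu> (\<lambda>x. if x \<ge> 1 then z ^ (x - 1) else 0) i"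

lemma integrable_above:
  fixes z :: real
  assumes "0 \<le> z" "z \<le> 1"
  shows "integrable (measure_pmf \<mu>) (\<lambda>(x, j). if x \<ge> 1 then z ^ (x - 1) else 0)"
  using assms by (intro integrable_bounded_part[where C = 1]) (auto simp: power_le_one)

lemma power_weight_bounded:
  assumes "0 \<le> z" "z \<le> 1"
  shows "\<bar>case s of (x, j) \<Rightarrow> z ^ x * weight A z j\<bar> \<le> \<bar>weight A z 1\<bar> + \<bar>weight A z 2\<bar>"
proof (cases s)
  case (Pair x j)
  have "\<bar>z ^ x * weight A z j\<bar> \<le> 1 * \<bar>weight A z j\<bar>"
    unfolding abs_mult using assms by (intro mult_right_mono) (auto simp: power_le_one)
  also have "\<dots> \<le> \<bar>weight A z 1\<bar> + \<bar>weight A z 2\<bar>" using exhaust_2[of j] by auto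
  finally show ?thesis by (simp add: Pair)
qed

text \<open>The test function is bounded, so stationarity applies without truncation. Above level 0
  its drift is \<open>z ^ (x - 1)\<close> times a constant depending on the type, and the two states
  at level 0 are split off.\<close>

lemma exponential_balance:
  assumes z: "0 \<le> z" "z \<le> 1"
  shows "above z 1 * ((1 - z) * slack A + (1 - z)\<^sup>2 * second_order A z 1) +
    above z 2 * ((1 - z) * slack A + (1 - z)\<^sup>2 * second_order A z 2) +
    pmf \<mu> (0, 1) * boundary_exp_drift z 1 + pmf \<mu> (0, 2) * boundary_exp_drift z 2 = 0"
proof -
  define f where "f = (\<lambda>(x :: nat, j). z ^ x * weight A z j)"
  define C where "C = \<bar>weight A z 1\<bar> + \<bar>weight A z 2\<bar>"
  have fb: "\<bar>f s\<bar> \<le> C" for s unfolding f_def C_def by (rule power_weight_bounded[OF z])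
  have fi: "integrable (measure_pmf p) f" for p
    by (rule measure_pmf.integrable_const_bound[where B = C]) (auto simp: fb)
  define D where "D s = measure_pmf.expectation (level_step A Y s) f - f s" for s
  define r where "r i = (1 - z) * slack A + (1 - z)\<^sup>2 * second_order A z i" for i
  have eb: "\<bar>measure_pmf.expectation (level_step A Y s) f\<bar> \<le> C" for s
    using fb by (intro order_trans[OF integral_abs_bound] measure_pmf.integral_le_const integrable_abs fi) auto
  have Db: "\<bar>D s\<bar> \<le> C + C" for s
    using eb[of s] fb[of s] by (simp add: D_def)
  have "measure_pmf.expectation \<mu> f = measure_pmf.expectation \<mu> (\<lambda>s. measure_pmf.expectation (level_step A Y s) f)"
    using expectation_bind_pmf_bounded[of f C \<mu> "level_step A Y", OF fb] stat_\<mu> by (simp add: stationary_pmf_def)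
  moreover have "integrable (measure_pmf \<mu>) (\<lambda>s. measure_pmf.expectation (level_step A Y s) f)"
    by (rule measure_pmf.integrable_const_bound[where B = C]) (auto simp: eb)
  ultimately have "measure_pmf.expectation \<mu> D = 0"
    unfolding D_def using fi by simp
  moreover have "D (0, i) = boundary_exp_drift z i" for i
    by (simp add: D_def expectation_level_step boundary_exp_drift_def f_def)
  moreover have "D (x, i) = z ^ (x - 1) * r i" if x: "x \<ge> 1" for x i
  proof -
    obtain y where [simp]: "x = Suc y" using x by (cases x) auto
    have "D (x, i) = measure_pmf.expectation (A i) (\<lambda>s. z ^ (x - 1) * (case s of (a, j) \<Rightarrow> z ^ a * weight A z j)) - z ^ x * weight A z i"
      by (simp add: D_def expectation_level_step f_def power_add case_prod_unfold mult.assoc)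
    also have "\<dots> = z ^ (x - 1) * (part_mean (A i) (\<lambda>a. z ^ a) 1 * weight A z 1 +
        part_mean (A i) (\<lambda>a. z ^ a) 2 * weight A z 2) - z ^ x * weight A z i"
      by (simp add: expectation_part_sum[OF integrable_power_part[OF z]])
    also have "z ^ x = z ^ (x - 1) * z" by simp
    also have "z ^ (x - 1) * (part_mean (A i) (\<lambda>a. z ^ a) 1 * weight A z 1 +
        part_mean (A i) (\<lambda>a. z ^ a) 2 * weight A z 2) - z ^ (x - 1) * z * weight A z i =
        z ^ (x - 1) * (part_mean (A i) (\<lambda>a. z ^ a) 1 * weight A z 1 +
        part_mean (A i) (\<lambda>a. z ^ a) 2 * weight A z 2 - z * weight A z i)"
      by (simp only: right_diff_distrib mult.assoc)
    finally show ?thesis unfolding r_def interior_weight_drift[OF z] .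
  qed
  then have "measure_pmf.expectation \<mu> (\<lambda>(x, i). if x \<ge> 1 then D (x, i) else 0) =
      measure_pmf.expectation \<mu> (\<lambda>(x, i). (if x \<ge> 1 then z ^ (x - 1) else 0) * r i)"
    by (intro Bochner_Integration.integral_cong) auto
  moreover have "\<dots> = above z 1 * r 1 + above z 2 * r 2"
    unfolding above_def by (rule expectation_part_sum[OF integrable_above[OF z]])
  ultimately show ?thesis
    using split_boundary[OF Db] by (simp add: r_def)
qed

lemma above_bounds:
  assumes z: "0 \<le> z" "z \<le> 1"
  shows "0 \<le> above z i" "above z 1 + above z 2 \<le> 1"
    "measure_pmf.expectation \<mu> (\<lambda>(x, j). z ^ x) =
      z * (above z 1 + above z 2) + pmf \<mu> (0, 1) + pmf \<mu> (0, 2)"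
proof -
  show "0 \<le> above z i"
    unfolding above_def part_mean_def using z by (auto intro!: integral_nonneg_AE AE_I2)
  have s: "above z 1 + above z 2 = measure_pmf.expectation \<mu> (\<lambda>(x, j). if x \<ge> 1 then z ^ (x - 1) else 0)"
    unfolding above_def by (rule part_mean_add[OF integrable_above[OF z]])
  also have "\<dots> \<le> 1"
    using z by (intro measure_pmf.integral_le_const integrable_above) (auto simp: power_le_one)
  finally show "above z 1 + above z 2 \<le> 1" .
  have "measure_pmf.expectation \<mu> (\<lambda>(x, j). z ^ x) =
      measure_pmf.expectation \<mu> (\<lambda>(x, i). if x \<ge> 1 then z ^ x else 0) + pmf \<mu> (0, 1) + pmf \<mu> (0, 2)"
    by (subst split_boundary[where C = 1]) (use z in \<open>auto simp: power_le_one\<close>)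
  also have "(\<lambda>(x, i :: 2). if x \<ge> 1 then z ^ x else 0) =
      (\<lambda>s. z * (case s of (x, i) \<Rightarrow> if x \<ge> 1 then z ^ (x - 1) else 0))"
    by (auto simp: fun_eq_iff power_eq_if)
  finally show "measure_pmf.expectation \<mu> (\<lambda>(x, j). z ^ x) =
      z * (above z 1 + above z 2) + pmf \<mu> (0, 1) + pmf \<mu> (0, 2)"
    by (simp add: s)
qed

text \<open>\<open>Y i\<close> is only known to have a first moment, so in general no error of order
  \<open>(1 - z)^2\<close> is available. The gap between the mean and the expectation of
  \<open>geo\<close> takes the place of a second-order term; it tends to 0 along a sequence whose
  means converge.\<close>

lemma bexp_expansion:
  assumes z: "0 \<le> z" "z \<le> 1"
  shows "\<bar>boundary_exp_drift z i + (1 - z) * boundary_drift i\<bar> \<le> (1 - z) *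
    (measure_pmf.expectation (Y i) (\<lambda>(x, j). real x) - measure_pmf.expectation (Y i) (\<lambda>(x, j). geo x z) +
     (1 - z) * (\<bar>cor1 A 2\<bar> * measure_pmf.expectation (Y i) (\<lambda>(x, j). real x) + 2 * \<bar>cor2 A 2\<bar>))"
proof -
  define d where "d = 1 - z"
  have d: "0 \<le> d" "z = 1 - d" using z by (auto simp: d_def)
  define E :: "(nat \<times> 2 \<Rightarrow> real) \<Rightarrow> real" where "E = measure_pmf.expectation (Y i)"
  note [simp] = intY[of i, unfolded case_prod_unfold]
  have ig [simp]: "integrable (measure_pmf (Y i)) (\<lambda>s. geo (fst s) z)"
    by (rule Bochner_Integration.integrable_bound[OF intY[of i]])
       (use z in \<open>auto intro!: AE_I2 simp: geo_nonneg geo_le\<close>)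
  have c1b: "\<bar>cor1 A j\<bar> \<le> \<bar>cor1 A 2\<bar>" "\<bar>cor2 A j\<bar> \<le> \<bar>cor2 A 2\<bar>" for j
    using exhaust_2[of j] by (auto simp: cor1_def cor2_def)
  have ic [simp]: "integrable (measure_pmf (Y i)) (\<lambda>s. cor1 A (snd s))"
    by (rule measure_pmf.integrable_const_bound[where B = "\<bar>cor1 A 2\<bar>"]) (auto simp: c1b)
  have iw: "integrable (measure_pmf (Y i)) (\<lambda>s. z ^ fst s * weight A z (snd s))"
    using power_weight_bounded[OF z]
    by (intro measure_pmf.integrable_const_bound[where B = "\<bar>weight A z 1\<bar> + \<bar>weight A z 2\<bar>"])
       (auto simp: case_prod_unfold)
  have bd: "boundary_drift i = E (\<lambda>s. real (fst s) - cor1 A (snd s) + cor1 A i)"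
    by (simp add: boundary_drift_def E_def case_prod_unfold)
  have be: "boundary_exp_drift z i = E (\<lambda>s. z ^ fst s * weight A z (snd s) - weight A z i)"
    unfolding boundary_exp_drift_def E_def using iw by (simp add: case_prod_unfold)
  have ig2: "integrable (measure_pmf (Y i)) (\<lambda>s. real (fst s) - cor1 A (snd s) + cor1 A i)"
    by simp
  have sum: "boundary_exp_drift z i + d * boundary_drift i = E (\<lambda>s. (z ^ fst s * weight A z (snd s) - weight A z i) +
      d * (real (fst s) - cor1 A (snd s) + cor1 A i))"
    unfolding bd be E_def using iw ig2
    by (subst Bochner_Integration.integral_add) (auto simp: case_prod_unfold)
  have int: "integrable (measure_pmf (Y i)) (\<lambda>s. (z ^ fst s * weight A z (snd s) - weight A z i) +
      d * (real (fst s) - cor1 A (snd s) + cor1 A i))"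
    using iw ig2 by (intro Bochner_Integration.integrable_add Bochner_Integration.integrable_diff integrable_mult_right) auto
  have ptw: "\<bar>(z ^ fst s * weight A z (snd s) - weight A z i) +
      d * (real (fst s) - cor1 A (snd s) + cor1 A i)\<bar> \<le>
      d * (real (fst s) - geo (fst s) z + d * (\<bar>cor1 A 2\<bar> * real (fst s) + 2 * \<bar>cor2 A 2\<bar>))" for s :: "nat \<times> 2"
  proof -
    define x j where "x = fst s" and "j = snd s"
    have zp: "z ^ x = 1 - d * geo x z" by (simp add: d_def geo_eq)
    have g: "0 \<le> geo x z" "geo x z \<le> real x" using z by (auto simp: geo_nonneg geo_le)
    have zb: "0 \<le> z ^ x" "z ^ x \<le> 1" using z by (auto simp: power_le_one)
    have w: "weight A z k = 1 + d * cor1 A k + d\<^sup>2 * cor2 A k" for k by (simp add: weight_def d_def)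
    have "z ^ x * weight A z j = z ^ x + d * cor1 A j * z ^ x + d\<^sup>2 * cor2 A j * z ^ x"
      unfolding w by (simp add: algebra_simps)
    also have "\<dots> = 1 - d * geo x z + d * cor1 A j - d\<^sup>2 * cor1 A j * geo x z + d\<^sup>2 * cor2 A j * z ^ x"
      by (subst (1 2) zp) (simp add: algebra_simps power2_eq_square)
    finally have "(z ^ x * weight A z j - weight A z i) + d * (real x - cor1 A j + cor1 A i) =
        d * (real x - geo x z) - d\<^sup>2 * (cor1 A j * geo x z) + d\<^sup>2 * (cor2 A j * z ^ x) - d\<^sup>2 * cor2 A i"
      unfolding w by (simp add: algebra_simps)
    moreover have "\<bar>d * (real x - geo x z)\<bar> = d * (real x - geo x z)" using d g by simp
    moreover have "\<bar>d\<^sup>2 * (cor1 A j * geo x z)\<bar> \<le> d\<^sup>2 * (\<bar>cor1 A 2\<bar> * real x)"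
      unfolding abs_mult using g c1b[of j] by (intro mult_mono) auto
    moreover have "\<bar>d\<^sup>2 * (cor2 A j * z ^ x)\<bar> \<le> d\<^sup>2 * (\<bar>cor2 A 2\<bar> * 1)"
      unfolding abs_mult using zb c1b[of j] by (intro mult_mono) auto
    moreover have "\<bar>d\<^sup>2 * cor2 A i\<bar> \<le> d\<^sup>2 * \<bar>cor2 A 2\<bar>"
      unfolding abs_mult using c1b[of i] by (intro mult_mono) auto
    moreover have "d * (real x - geo x z + d * (\<bar>cor1 A 2\<bar> * real x + 2 * \<bar>cor2 A 2\<bar>)) =
        d * (real x - geo x z) + d\<^sup>2 * (\<bar>cor1 A 2\<bar> * real x) + d\<^sup>2 * (\<bar>cor2 A 2\<bar> * 1) + d\<^sup>2 * \<bar>cor2 A 2\<bar>"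
      by (simp add: algebra_simps power2_eq_square)
    ultimately show ?thesis unfolding x_def[symmetric] j_def[symmetric] by linarith
  qed
  have "\<bar>boundary_exp_drift z i + d * boundary_drift i\<bar> \<le> E (\<lambda>s. \<bar>(z ^ fst s * weight A z (snd s) - weight A z i) +
      d * (real (fst s) - cor1 A (snd s) + cor1 A i)\<bar>)"
    unfolding sum E_def by (rule integral_abs_bound)
  also have "\<dots> \<le> E (\<lambda>s. d * (real (fst s) - geo (fst s) z + d * (\<bar>cor1 A 2\<bar> * real (fst s) + 2 * \<bar>cor2 A 2\<bar>)))"
    unfolding E_def by (rule integral_mono[OF integrable_abs[OF int] _ ptw]) simp
  also have "\<dots> = d * (E (\<lambda>s. real (fst s)) - E (\<lambda>s. geo (fst s) z) +
      d * (\<bar>cor1 A 2\<bar> * E (\<lambda>s. real (fst s)) + 2 * \<bar>cor2 A 2\<bar>))"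
    by (simp add: E_def)
  finally show ?thesis unfolding d_def E_def by (simp add: case_prod_unfold)
qed

end

subsection \<open>The heavy-traffic limit\<close>

lemma expectation_power_eq_geo:
  assumes int: "integrable (measure_pmf p) (\<lambda>(x, j). real x)" and z: "0 \<le> z" "z \<le> 1"
  shows "measure_pmf.expectation p (\<lambda>(x, j). z ^ x) = 1 - (1 - z) * measure_pmf.expectation p (\<lambda>(x, j). geo x z)"
proof -
  have "integrable (measure_pmf p) (\<lambda>(x, j). geo x z)"
    by (rule Bochner_Integration.integrable_bound[OF int])
       (use z in \<open>auto intro!: AE_I2 simp: geo_nonneg geo_le\<close>)
  then show ?thesis by (subst power_eq_geo) (simp add: case_prod_unfold)
qed

text \<open>In this abstract form \<open>unbounded\<close> and \<open>gfY\<close> keep the exit from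
  level 0 effective along the sequence, \<open>meanY\<close> prevents mass of the exit jump from
  escaping to infinity, and \<open>m1_lim\<close> and \<open>m2_lim\<close> do the same for the
  interior steps.\<close>

lemma heavy_traffic_limit:
  fixes A Y :: "nat \<Rightarrow> 2 \<Rightarrow> (nat \<times> 2) pmf" and Yb :: "2 \<Rightarrow> (nat \<times> 2) pmf" and \<mu> :: "nat \<Rightarrow> (nat \<times> 2) pmf"
  assumes chain: "\<And>n. level_chain (A n) (Y n) (\<mu> n)"
    and laws: "arrival_laws Ab"
    and intYb: "\<And>i. integrable (measure_pmf (Yb i)) (\<lambda>(x, j). real x)"
    and gfA: "\<And>z i j. 0 < z \<Longrightarrow> z \<le> 1 \<Longrightarrow>
      (\<lambda>n. part_mean (A n i) (\<lambda>a. z ^ a) j) \<longlonglongrightarrow> part_mean (Ab i) (\<lambda>a. z ^ a) j"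
    and m1_lim: "\<And>i j. (\<lambda>n. arr_mean (A n) i j) \<longlonglongrightarrow> arr_mean Ab i j"
    and m2_lim: "\<And>i j. (\<lambda>n. arr_second (A n) i j) \<longlonglongrightarrow> arr_second Ab i j"
    and gfY: "\<And>(z :: real) i. 0 < z \<Longrightarrow> z < 1 \<Longrightarrow>
      (\<lambda>n. measure_pmf.expectation (Y n i) (\<lambda>(x, j). z ^ x)) \<longlonglongrightarrow> measure_pmf.expectation (Yb i) (\<lambda>(x, j). z ^ x)"
    and meanY: "\<And>i. (\<lambda>n. measure_pmf.expectation (Y n i) (\<lambda>(x, j). real x))
      \<longlonglongrightarrow> measure_pmf.expectation (Yb i) (\<lambda>(x, j). real x)"
    and unbounded: "\<And>M i. \<exists>x\<ge>M. x \<in> set_pmf (map_pmf fst (Yb i))"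
    and slack_pos: "\<And>n. 0 < slack (A n)" and slack_lim: "(\<lambda>n. slack (A n)) \<longlonglongrightarrow> 0"
    and kap_pos: "0 < limit_coeff Ab" and s: "0 \<le> s"
  shows "(\<lambda>n. measure_pmf.expectation (\<mu> n) (\<lambda>(x, j). exp (- s * slack (A n) * real x))) \<longlonglongrightarrow> 1 / (1 + s * limit_coeff Ab)"
proof (cases "s = 0")
  case True
  then show ?thesis by (simp add: case_prod_unfold)
next
  case False
  \<comment> \<open>From here on \<open>1 - z n\<close> is positive and of exact order
    \<open>e n\<close>; for \<open>s = 0\<close> it would vanish, and with it the denominator in the
    final division.\<close>
  with s have s: "0 < s" by simp
  interpret b: arrival_laws Ab by (rule laws)
  interpret c: level_chain "A n" "Y n" "\<mu> n" for n by (rule chain)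
  define e where "e n = slack (A n)" for n
  define z where "z n = exp (- s * e n)" for n
  define d where "d n = 1 - z n" for n
  \<comment> \<open>Ratio of the two small parameters \<open>1 - z n\<close> and \<open>e n\<close>;
    its limit \<open>s\<close> is the derivative of \<open>1 - exp (- s * h)\<close> at 0.\<close>
  define th where "th n = d n / e n" for n
  have e: "0 < e n" for n by (simp add: e_def slack_pos)
  have el: "e \<longlonglongrightarrow> 0" unfolding e_def by (rule slack_lim)
  have z: "0 < z n" "z n < 1" for n using e[of n] s by (auto simp: z_def mult_pos_pos)
  have z': "0 \<le> z n" "z n \<le> 1" for n using z[of n] by auto
  have zl: "z \<longlonglongrightarrow> 1"
    unfolding z_def using tendsto_exp[OF tendsto_mult[OF tendsto_const[of "- s"] el]] by simp
  have d: "0 < d n" for n using z[of n] by (simp add: d_def)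
  have dl: "d \<longlonglongrightarrow> 0" unfolding d_def using tendsto_diff[OF tendsto_const[of 1] zl] by simp
  have thl: "th \<longlonglongrightarrow> s"
  proof -
    have "DERIV (\<lambda>h. exp (- s * h)) 0 :> - s" by (auto intro!: derivative_eq_intros)
    then have "((\<lambda>h. (exp (- s * h) - 1) / h) \<longlongrightarrow> - s) (at 0)" by (auto dest: DERIV_D)
    moreover have "filterlim e (at 0) sequentially"
      using el e by (simp add: filterlim_at less_imp_neq[symmetric])
    ultimately have "(\<lambda>n. (exp (- s * e n) - 1) / e n) \<longlonglongrightarrow> - s" by (rule filterlim_compose)
    from tendsto_minus[OF this] show ?thesis
      by (simp add: th_def[abs_def] d_def z_def minus_divide_left)
  qed
  have tr_lim: "(\<lambda>n. type_prob (A n) i j) \<longlonglongrightarrow> type_prob Ab i j" for i j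
    using gfA[of 1 i j] by (simp add: type_prob_def)
  have den: "type_prob Ab 1 2 + type_prob Ab 2 1 \<noteq> 0" "type_prob Ab 2 1 \<noteq> 0" using b.tr_pos by auto
  have stat_lim: "(\<lambda>n. type_weight (A n) i) \<longlonglongrightarrow> type_weight Ab i" for i
    unfolding type_weight_def by (cases "i = 1") (auto intro!: tendsto_intros tr_lim den)
  have "(\<lambda>n. slack (A n)) \<longlonglongrightarrow> slack Ab"
    unfolding slack_def by (intro tendsto_intros stat_lim m1_lim)
  then have cor1_lim: "(\<lambda>n. cor1 (A n) i) \<longlonglongrightarrow> cor1 Ab i" for i
    unfolding cor1_def by (cases "i = 1") (auto intro!: tendsto_intros tr_lim m1_lim den)
  have rate2_lim: "(\<lambda>n. rate2 (A n) i) \<longlonglongrightarrow> rate2 Ab i" for i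
    unfolding rate2_def by (intro tendsto_intros cor1_lim m1_lim m2_lim) simp
  have kap_lim: "(\<lambda>n. limit_coeff (A n)) \<longlonglongrightarrow> limit_coeff Ab"
    unfolding limit_coeff_def by (intro tendsto_intros stat_lim rate2_lim)
  have cor2_lim: "(\<lambda>n. cor2 (A n) i) \<longlonglongrightarrow> cor2 Ab i" for i
    unfolding cor2_def by (cases "i = 1") (auto intro!: tendsto_intros tr_lim rate2_lim kap_lim den)

  \<comment> \<open>For \<open>t < 1\<close> the generating functions determine \<open>geo\<close>
    through division by \<open>1 - t\<close>; the endpoint \<open>t = 1\<close> is the assumption on
    means. The same split serves \<open>geo2\<close>, with second moments at the endpoint.\<close>
  have pgeo: "(\<lambda>n. part_mean (A n i) (\<lambda>a. geo a t) j) \<longlonglongrightarrow> part_mean (Ab i) (\<lambda>a. geo a t) j"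
    if t: "0 < t" "t \<le> 1" for i j t
  proof (cases "t = 1")
    case True
    then show ?thesis using m1_lim by (simp add: geo_1 arr_mean_def)
  next
    case False
    then have eq: "1 - t \<noteq> 0" by simp
    have g: "part_mean (B i) (\<lambda>a. geo a t) j = (type_prob B i j - part_mean (B i) (\<lambda>a. t ^ a) j) / (1 - t)"
      if "arrival_laws B" for B
      using arrival_laws.power_expansion(1)[OF that, of t i j] t eq by simp
    show ?thesis
      unfolding g[OF laws] g[OF c.arrival_laws_axioms] by (intro tendsto_intros tr_lim gfA t eq)
  qed
  have pgeo2: "(\<lambda>n. part_mean (A n i) (\<lambda>a. geo2 a t) j) \<longlonglongrightarrow> part_mean (Ab i) (\<lambda>a. geo2 a t) j"
    if t: "0 < t" "t \<le> 1" for i j t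
  proof (cases "t = 1")
    case True
    have g: "part_mean (B i) (\<lambda>a. geo2 a 1) j = (arr_second B i j - arr_mean B i j) / 2" if "arrival_laws B" for B
    proof -
      interpret B: arrival_laws B by (rule that)
      have "part_mean (B i) (\<lambda>a. (real a)\<^sup>2 - 1 * real a) j = arr_second B i j - 1 * arr_mean B i j"
        unfolding arr_second_def arr_mean_def by (rule part_mean_linear[OF B.int2 B.int1])
      moreover have "part_mean (B i) (\<lambda>a. geo2 a 1) j = part_mean (B i) (\<lambda>a. (real a)\<^sup>2 - 1 * real a) j / 2"
        unfolding part_mean_def Bochner_Integration.integral_divide_zero[symmetric]
        by (intro Bochner_Integration.integral_cong) (auto simp: geo2_1)
      ultimately show ?thesis by simp
    qed
    show ?thesis unfolding True g[OF laws] g[OF c.arrival_laws_axioms]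
      by (intro tendsto_intros m1_lim m2_lim) simp
  next
    case False
    then have eq: "1 - t \<noteq> 0" by simp
    have g: "part_mean (B i) (\<lambda>a. geo2 a t) j = (arr_mean B i j - part_mean (B i) (\<lambda>a. geo a t) j) / (1 - t)"
      if "arrival_laws B" for B
      using arrival_laws.power_expansion(2)[OF that, of t i j] t eq by simp
    show ?thesis
      unfolding g[OF laws] g[OF c.arrival_laws_axioms] by (intro tendsto_intros m1_lim pgeo t eq)
  qed
  have igeo: "integrable (measure_pmf (B i)) (\<lambda>(a, j). geo a 1)"
    and igeo2: "integrable (measure_pmf (B i)) (\<lambda>(a, j). geo2 a 1)" if "arrival_laws B" for B i
    using arrival_laws.int1[OF that, of i] arrival_laws.int2[OF that, of i]
    by (simp_all add: geo_1 geo2_1 case_prod_unfold)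
  have geo_lim: "(\<lambda>n. part_mean (A n i) (\<lambda>a. geo a (z n)) j) \<longlonglongrightarrow> arr_mean Ab i j" for i j
    using part_mean_tendsto_at_moving_point[of geo "\<lambda>n. A n i" "Ab i" j z,
        OF geo_nonneg geo_mono isCont_geo igeo[OF c.arrival_laws_axioms] igeo[OF laws] pgeo z zl]
    by (simp add: geo_1 arr_mean_def)
  have geo2_lim: "(\<lambda>n. part_mean (A n i) (\<lambda>a. geo2 a (z n)) j) \<longlonglongrightarrow> part_mean (Ab i) (\<lambda>a. geo2 a 1) j" for i j
    using part_mean_tendsto_at_moving_point[of geo2 "\<lambda>n. A n i" "Ab i" j z,
        OF geo2_nonneg geo2_mono isCont_geo2 igeo2[OF c.arrival_laws_axioms] igeo2[OF laws] pgeo2 z zl]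
    by simp
  have pow_lim: "(\<lambda>n. part_mean (A n i) (\<lambda>a. z n ^ a) j) \<longlonglongrightarrow> type_prob Ab i j" for i j
  proof -
    have "(\<lambda>n. type_prob (A n) i j - d n * part_mean (A n i) (\<lambda>a. geo a (z n)) j) \<longlonglongrightarrow> type_prob Ab i j - 0 * arr_mean Ab i j"
      by (intro tendsto_intros tr_lim dl geo_lim)
    then show ?thesis by (simp add: c.power_expansion(1)[OF z'] d_def)
  qed
  have geo2_row: "part_mean (Ab i) (\<lambda>a. geo2 a 1) 1 + part_mean (Ab i) (\<lambda>a. geo2 a 1) 2 =
      (arr_second Ab i 1 + arr_second Ab i 2 - arr_mean Ab i 1 - arr_mean Ab i 2) / 2" for i
  proof -
    have "part_mean (Ab i) (\<lambda>a. geo2 a 1) 1 + part_mean (Ab i) (\<lambda>a. geo2 a 1) 2 =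
        measure_pmf.expectation (Ab i) (\<lambda>(a, j). geo2 a 1)"
      by (rule part_mean_add[OF igeo2[OF laws]])
    also have "\<dots> = (measure_pmf.expectation (Ab i) (\<lambda>(a, j). (real a)\<^sup>2) -
        measure_pmf.expectation (Ab i) (\<lambda>(a, j). real a)) / 2"
      using b.int1[of i] b.int2[of i] by (simp add: geo2_1 case_prod_unfold)
    finally show ?thesis
      by (simp add: arr_mean_def arr_second_def part_mean_add[OF b.int2, symmetric] part_mean_add[OF b.int1, symmetric])
  qed
  have rem_lim: "(\<lambda>n. second_order (A n) (z n) i) \<longlonglongrightarrow> limit_coeff Ab" for i
  proof -
    have "(\<lambda>n. second_order (A n) (z n) i) \<longlonglongrightarrow>
        part_mean (Ab i) (\<lambda>a. geo2 a 1) 1 + part_mean (Ab i) (\<lambda>a. geo2 a 1) 2 - arr_mean Ab i 2 * cor1 Ab 2 +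
        type_prob Ab i 2 * cor2 Ab 2 + cor1 Ab i - cor2 Ab i + 0 * cor2 Ab i" (is "_ \<longlonglongrightarrow> ?L")
      unfolding second_order_def d_def[symmetric]
      by (intro tendsto_intros geo2_lim geo_lim pow_lim cor1_lim cor2_lim dl)
    moreover have "?L = limit_coeff Ab"
      unfolding geo2_row using b.rate2_poisson[of i] by (simp add: rate2_def)
    ultimately show ?thesis by simp
  qed

  define EY where "EY n i = measure_pmf.expectation (Y n i) (\<lambda>(x, j). real x)" for n i
  define EG where "EG n i = measure_pmf.expectation (Y n i) (\<lambda>(x, j). geo x (z n))" for n i
  have EG_lim: "(\<lambda>n. EG n i) \<longlonglongrightarrow> measure_pmf.expectation (Yb i) (\<lambda>(x, j). real x)" for i
  proof -
    have "(\<lambda>n. measure_pmf.expectation (Y n i) (\<lambda>(x, j). geo x (z n))) \<longlonglongrightarrow>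
        measure_pmf.expectation (Yb i) (\<lambda>(x, j). geo x 1)"
    proof (rule expectation_tendsto_at_moving_point[where \<phi> = "\<lambda>z (x, j). geo x z" and z = z])
      fix t :: real assume t: "0 < t" "t \<le> 1"
      show "(\<lambda>n. measure_pmf.expectation (Y n i) (\<lambda>(x, j). geo x t)) \<longlonglongrightarrow>
          measure_pmf.expectation (Yb i) (\<lambda>(x, j). geo x t)"
      proof (cases "t = 1")
        case True
        then show ?thesis using meanY by (simp add: geo_1)
      next
        case False
        then have eq: "1 - t \<noteq> 0" "t < 1" using t by auto
        have g: "measure_pmf.expectation p (\<lambda>(x, j). geo x t) =
            (1 - measure_pmf.expectation p (\<lambda>(x, j). t ^ x)) / (1 - t)"
          if "integrable (measure_pmf p) (\<lambda>(x, j). real x)" for p :: "(nat \<times> 2) pmf"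
          using expectation_power_eq_geo[OF that, of t] t eq by simp
        show ?thesis
          unfolding g[OF intYb] g[OF c.intY] by (intro tendsto_intros gfY t eq)
      qed
    qed (use c.intY intYb z zl in \<open>auto simp: geo_nonneg geo_mono isCont_geo geo_1\<close>)
    then show ?thesis by (simp add: EG_def geo_1)
  qed
  \<comment> \<open>Relative error of the boundary drift: \<open>EY\<close> and \<open>EG\<close>
    have the same limit, and the remaining terms carry the factor \<open>d n\<close>.\<close>
  define er where "er n i = EY n i - EG n i + d n * (\<bar>cor1 (A n) 2\<bar> * EY n i + 2 * \<bar>cor2 (A n) 2\<bar>)" for n i
  have er_lim: "(\<lambda>n. er n i) \<longlonglongrightarrow> 0" for i
  proof -
    have "(\<lambda>n. er n i) \<longlonglongrightarrow> measure_pmf.expectation (Yb i) (\<lambda>(x, j). real x) -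
        measure_pmf.expectation (Yb i) (\<lambda>(x, j). real x) +
        0 * (\<bar>cor1 Ab 2\<bar> * measure_pmf.expectation (Yb i) (\<lambda>(x, j). real x) + 2 * \<bar>cor2 Ab 2\<bar>)"
      unfolding er_def by (intro tendsto_intros EG_lim dl cor1_lim cor2_lim) (simp_all add: EY_def meanY)
    then show ?thesis by simp
  qed
  have boundary_exp_drift: "\<bar>c.boundary_exp_drift n (z n) i + d n * c.boundary_drift n i\<bar> \<le> d n * er n i" for n i
    unfolding d_def er_def EY_def EG_def by (rule c.bexp_expansion[OF z'])

  define u where "u n i = pmf (\<mu> n) (0, i)" for n i
  have u0: "0 \<le> u n i" for n i by (simp add: u_def)
  \<comment> \<open>\<open>M\<close> is fixed from the limit model with a strict inequality, so that
    it serves for all large \<open>n\<close>.\<close>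
  obtain M :: nat where M: "\<bar>cor1 Ab 2\<bar> + 1 < real M" using reals_Archimedean2 by blast
  have evM: "eventually (\<lambda>n. \<bar>cor1 (A n) 2\<bar> + 1 < real M) sequentially"
    by (rule order_tendstoD(2)[OF _ M]) (intro tendsto_intros cor1_lim)
  \<comment> \<open>An atom at some \<open>x >= M\<close> of the limiting exit law eventually keeps
    at least half its mass along the sequence.\<close>
  have ev_tail: "\<exists>\<eta>>0. eventually (\<lambda>n. \<eta> \<le> measure_pmf.prob (Y n i) {(x, j). M \<le> x}) sequentially" for i
  proof -
    obtain x where x: "M \<le> x" "x \<in> set_pmf (map_pmf fst (Yb i))" using unbounded by blast
    define \<eta> where "\<eta> = pmf (map_pmf fst (Yb i)) x / 2"
    have \<eta>: "0 < \<eta>" "\<eta> < pmf (map_pmf fst (Yb i)) x"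
      using pmf_positive[OF x(2)] by (simp_all add: \<eta>_def)
    have "(\<lambda>n. pmf (map_pmf fst (Y n i)) x) \<longlonglongrightarrow> pmf (map_pmf fst (Yb i)) x"
      by (rule pmf_tendsto_of_gf_tendsto) (use gfY in \<open>simp add: case_prod_unfold\<close>)
    then have "eventually (\<lambda>n. \<eta> < pmf (map_pmf fst (Y n i)) x) sequentially"
      using \<eta>(2) by (rule order_tendstoD)
    moreover have "pmf (map_pmf fst (Y n i)) x \<le> measure_pmf.prob (Y n i) {(x, j). M \<le> x}" for n
      unfolding pmf_map by (rule measure_pmf.finite_measure_mono) (use x in auto)
    ultimately have "eventually (\<lambda>n. \<eta> \<le> measure_pmf.prob (Y n i) {(x, j). M \<le> x}) sequentially"
      by (auto elim!: eventually_mono intro: order_trans less_imp_le)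
    then show ?thesis using \<eta>(1) by blast
  qed
  obtain \<eta>1 \<eta>2 where \<eta>12: "0 < \<eta>1" "eventually (\<lambda>n. \<eta>1 \<le> measure_pmf.prob (Y n 1) {(x, j). M \<le> x}) sequentially"
    "0 < \<eta>2" "eventually (\<lambda>n. \<eta>2 \<le> measure_pmf.prob (Y n 2) {(x, j). M \<le> x}) sequentially"
    using ev_tail[of 1] ev_tail[of 2] by auto
  define \<eta> where "\<eta> = min \<eta>1 \<eta>2"
  have \<eta>: "0 < \<eta>" using \<eta>12 by (simp add: \<eta>_def)
  have U: "eventually (\<lambda>n. u n 1 + u n 2 \<le> e n / \<eta>) sequentially"
    using evM \<eta>12(2,4)
  proof eventually_elim
    case (elim n)
    have "u n 1 * \<eta> + u n 2 * \<eta> \<le> u n 1 * measure_pmf.prob (Y n 1) {(x, j). M \<le> x} +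
        u n 2 * measure_pmf.prob (Y n 2) {(x, j). M \<le> x}"
      using elim u0 by (intro add_mono mult_left_mono) (auto simp: \<eta>_def)
    also have "\<dots> \<le> e n"
      unfolding u_def e_def using elim(1) by (intro c.boundary_probability_bound less_imp_le[OF slack_pos]) simp
    finally show ?case using \<eta> by (simp add: field_simps)
  qed
  define UU where "UU n = u n 1 + u n 2" for n
  have UUl: "UU \<longlonglongrightarrow> 0"
  proof (rule tendsto_sandwich[OF _ _ tendsto_const])
    show "eventually (\<lambda>n. 0 \<le> UU n) sequentially" by (simp add: UU_def u0)
    show "eventually (\<lambda>n. UU n \<le> e n / \<eta>) sequentially" using U by (simp add: UU_def)
    show "(\<lambda>n. e n / \<eta>) \<longlonglongrightarrow> 0" using tendsto_divide[OF el tendsto_const[of \<eta>]] \<eta> by simp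
  qed

  define F where "F n i = c.above n (z n) i" for n i
  define FF where "FF n = F n 1 + F n 2" for n
  have F0: "0 \<le> F n i" and FF1: "FF n \<le> 1" for n i
    using c.above_bounds[OF z'] by (auto simp: F_def FF_def)
  have F1: "F n i \<le> 1" for n i using F0[of n 1] F0[of n 2] FF1[of n] exhaust_2[of i] by (auto simp: FF_def)
  \<comment> \<open>Collects the deviation of \<open>second_order\<close> from its common limit; it
    vanishes because \<open>F n i\<close> lies between 0 and 1.\<close>
  define w where "w n = F n 1 * (second_order (A n) (z n) 1 - limit_coeff Ab) + F n 2 * (second_order (A n) (z n) 2 - limit_coeff Ab)" for n
  have Fr: "(\<lambda>n. F n i * (second_order (A n) (z n) i - limit_coeff Ab)) \<longlonglongrightarrow> 0" for i
  proof (rule Lim_null_comparison)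
    show "eventually (\<lambda>n. norm (F n i * (second_order (A n) (z n) i - limit_coeff Ab)) \<le> \<bar>second_order (A n) (z n) i - limit_coeff Ab\<bar>) sequentially"
      using F0 F1 by (intro always_eventually allI) (simp add: abs_mult mult_left_le_one_le)
    show "(\<lambda>n. \<bar>second_order (A n) (z n) i - limit_coeff Ab\<bar>) \<longlonglongrightarrow> 0"
      using tendsto_rabs[OF tendsto_diff[OF rem_lim tendsto_const[of "limit_coeff Ab"]]] by simp
  qed
  have wl: "w \<longlonglongrightarrow> 0" unfolding w_def using tendsto_add[OF Fr Fr] by simp
  \<comment> \<open>The exponential balance divided by the square of \<open>e n\<close>, with the
    first-order boundary term replaced through the linear balance. Left over is the boundary error,
    at most \<open>UU n * d n\<close> times the relative errors; as \<open>UU n\<close> is of order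
    \<open>e n\<close>, it vanishes after the division.\<close>
  define v where "v n = th n * FF n + (th n)\<^sup>2 * (limit_coeff Ab * FF n + w n) - th n * (1 - UU n)" for n
  have vb: "eventually (\<lambda>n. \<bar>v n\<bar> \<le> th n / \<eta> * (er n 1 + er n 2)) sequentially"
    using U
  proof eventually_elim
    case (elim n)
    have er0: "0 \<le> er n i" for i
      using boundary_exp_drift[of n i] d[of n] by (meson abs_ge_zero order_trans zero_le_mult_iff not_le)
    define q where "q i = c.boundary_exp_drift n (z n) i + d n * c.boundary_drift n i" for i
    have bal: "F n 1 * (d n * e n + (d n)\<^sup>2 * second_order (A n) (z n) 1) + F n 2 * (d n * e n + (d n)\<^sup>2 * second_order (A n) (z n) 2) +
        u n 1 * c.boundary_exp_drift n (z n) 1 + u n 2 * c.boundary_exp_drift n (z n) 2 = 0"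
      using c.exponential_balance[OF z', of n n] by (simp add: F_def d_def e_def u_def)
    have lin: "u n 1 * c.boundary_drift n 1 + u n 2 * c.boundary_drift n 2 = e n * (1 - UU n)"
      using c.linear_balance[of n] by (simp add: u_def e_def UU_def algebra_simps)
    have "(e n)\<^sup>2 * v n = d n * e n * FF n + (d n)\<^sup>2 * (limit_coeff Ab * FF n + w n) - d n * (e n * (1 - UU n))"
      using e[of n] by (simp add: v_def th_def power2_eq_square field_simps)
    also have "\<dots> = - (u n 1 * q 1 + u n 2 * q 2)"
      using bal unfolding lin[symmetric] q_def FF_def w_def by (simp add: algebra_simps)
    finally have "(e n)\<^sup>2 * \<bar>v n\<bar> = \<bar>u n 1 * q 1 + u n 2 * q 2\<bar>"
      by (metis abs_minus_cancel abs_mult abs_power2)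
    also have "\<dots> \<le> u n 1 * (d n * er n 1) + u n 2 * (d n * er n 2)"
      using u0[of n] boundary_exp_drift[of n] unfolding q_def
      by (intro order_trans[OF abs_triangle_ineq] add_mono) (auto simp: abs_mult intro!: mult_left_mono)
    also have "\<dots> \<le> (u n 1 + u n 2) * (d n * (er n 1 + er n 2))"
      using u0[of n] er0 d[of n] by (simp add: algebra_simps)
    also have "\<dots> \<le> e n / \<eta> * (d n * (er n 1 + er n 2))"
      using elim er0 d[of n] by (intro mult_right_mono) auto
    also have "\<dots> = (e n)\<^sup>2 * (th n / \<eta> * (er n 1 + er n 2))"
      using e[of n] \<eta> by (simp add: th_def power2_eq_square field_simps)
    finally show ?case
      using e[of n] mult_le_cancel_left_pos[of "(e n)\<^sup>2"] by (simp only: zero_less_power)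
  qed
  have vl: "v \<longlonglongrightarrow> 0"
  proof (rule Lim_null_comparison)
    show "eventually (\<lambda>n. norm (v n) \<le> th n / \<eta> * (er n 1 + er n 2)) sequentially" using vb by simp
    have "(\<lambda>n. th n / \<eta> * (er n 1 + er n 2)) \<longlonglongrightarrow> s / \<eta> * (0 + 0)"
      using \<eta> by (intro tendsto_intros thl er_lim) simp
    then show "(\<lambda>n. th n / \<eta> * (er n 1 + er n 2)) \<longlonglongrightarrow> 0" by simp
  qed
  \<comment> \<open>Positivity of \<open>limit_coeff Ab\<close> lets the balance be solved for
    \<open>FF n\<close> at every \<open>n\<close>; it also keeps the limiting denominator
    positive.\<close>
  have pos: "0 < th n + (th n)\<^sup>2 * limit_coeff Ab" for n
    using d[of n] e[of n] kap_pos by (intro add_pos_pos) (auto simp: th_def)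
  have FFeq: "FF n = (v n - (th n)\<^sup>2 * w n + th n * (1 - UU n)) / (th n + (th n)\<^sup>2 * limit_coeff Ab)" for n
  proof -
    have "FF n * (th n + (th n)\<^sup>2 * limit_coeff Ab) = v n - (th n)\<^sup>2 * w n + th n * (1 - UU n)"
      by (simp add: v_def algebra_simps)
    then show ?thesis using pos[of n] by (simp add: nonzero_eq_divide_eq)
  qed
  have lim_pos: "0 < s + s\<^sup>2 * limit_coeff Ab" using s kap_pos by (intro add_pos_pos) auto
  have "FF \<longlonglongrightarrow> (0 - s\<^sup>2 * 0 + s * (1 - 0)) / (s + s\<^sup>2 * limit_coeff Ab)"
    unfolding FFeq[abs_def] using lim_pos by (intro tendsto_intros vl wl thl UUl) simp
  moreover have "(0 - s\<^sup>2 * 0 + s * (1 - 0)) / (s + s\<^sup>2 * limit_coeff Ab) = 1 / (1 + s * limit_coeff Ab)"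
    using s lim_pos kap_pos
    by (simp add: frac_eq_eq add_pos_pos less_imp_neq[symmetric] power2_eq_square algebra_simps)
  ultimately have FFl: "FF \<longlonglongrightarrow> 1 / (1 + s * limit_coeff Ab)" by simp
  have "(\<lambda>n. z n * FF n + UU n) \<longlonglongrightarrow> 1 * (1 / (1 + s * limit_coeff Ab)) + 0"
    by (intro tendsto_intros zl FFl UUl)
  moreover have "measure_pmf.expectation (\<mu> n) (\<lambda>(x, j). exp (- s * slack (A n) * real x)) = z n * FF n + UU n" for n
  proof -
    have "exp (- s * slack (A n) * real x) = z n ^ x" for x
      by (simp add: z_def e_def exp_of_nat_mult[symmetric] mult.commute mult.left_commute)
    then show ?thesis
      using c.above_bounds(3)[OF z', of n n] by (simp add: FF_def F_def UU_def u_def)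
  qed
  ultimately show ?thesis by simp
qed

subsection \<open>Arrivals during a service\<close>

text \<open>Conditioning on the service time and the next type: the count then has law
  \<open>batch_arrivals\<close> and the type is fixed. An arbitrary nonnegative \<open>F\<close>
  serves both the mean and the tail of the count.\<close>

lemma nn_integral_arrivals_during:
  fixes F :: "nat \<times> 2 \<Rightarrow> ennreal"
  assumes S: "valid_service S"
  shows "(\<integral>\<^sup>+x. F x \<partial>arrivals_during q S) =
    (\<integral>\<^sup>+\<omega>. (\<integral>\<^sup>+a. F (a, snd \<omega>) \<partial>batch_arrivals q (fst \<omega>)) \<partial>S)"
proof -
  interpret prob_space S using S by (simp add: valid_service_def)
  have [measurable_cong]: "sets S = sets (borel \<Otimes>\<^sub>M count_space UNIV)"
    using S by (simp add: valid_service_def)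
  have pm: "ennreal (pmf (arrivals_during q S) x) =
      (\<integral>\<^sup>+\<omega>. ennreal (pmf (batch_arrivals q (fst \<omega>)) (fst x) * indicator {snd x} (snd \<omega>)) \<partial>S)" for x
    by (cases x, simp add: pmf_arrivals_during[OF S], subst nn_integral_eq_integral)
       (auto intro!: integrable_const_bound[where B = 1] AE_I2 simp: pmf_le_1 indicator_def)
  have "(\<integral>\<^sup>+x. F x \<partial>arrivals_during q S) =
      (\<integral>\<^sup>+x. (\<integral>\<^sup>+\<omega>. ennreal (pmf (batch_arrivals q (fst \<omega>)) (fst x) * indicator {snd x} (snd \<omega>)) * F x \<partial>S)
        \<partial>count_space UNIV)"
    by (simp add: nn_integral_measure_pmf pm nn_integral_multc)
  also have "\<dots> = (\<integral>\<^sup>+\<omega>. (\<integral>\<^sup>+x. ennreal (pmf (batch_arrivals q (fst \<omega>)) (fst x) * indicator {snd x} (snd \<omega>)) * F x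
        \<partial>count_space UNIV) \<partial>S)"
    by (rule nn_integral_count_space_nn_integral[symmetric]) auto
  also have "\<dots> = (\<integral>\<^sup>+\<omega>. (\<integral>\<^sup>+a. F (a, snd \<omega>) \<partial>batch_arrivals q (fst \<omega>)) \<partial>S)"
  proof (rule nn_integral_cong)
    fix \<omega> :: "real \<times> 2"
    have "(\<integral>\<^sup>+x. ennreal (pmf (batch_arrivals q (fst \<omega>)) (fst x) * indicator {snd x} (snd \<omega>)) * F x
        \<partial>count_space UNIV) = (\<integral>\<^sup>+x. F x \<partial>pair_pmf (batch_arrivals q (fst \<omega>)) (return_pmf (snd \<omega>)))"
      unfolding nn_integral_measure_pmf
      by (intro nn_integral_cong) (auto simp: pmf_pair indicator_def split: prod.splits)
    then show "(\<integral>\<^sup>+x. ennreal (pmf (batch_arrivals q (fst \<omega>)) (fst x) * indicator {snd x} (snd \<omega>)) * F x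
        \<partial>count_space UNIV) = (\<integral>\<^sup>+a. F (a, snd \<omega>) \<partial>batch_arrivals q (fst \<omega>))"
      by (simp add: nn_integral_pair_pmf')
  qed
  finally show ?thesis .
qed

section \<open>Mean and support of compound Poisson counts\<close>

lemma nn_integral_sum_list_replicate_pmf:
  "(\<integral>\<^sup>+xs. ennreal (real (sum_list xs)) \<partial>replicate_pmf k p) = of_nat k * (\<integral>\<^sup>+b. ennreal (real b) \<partial>p)"
proof (induction k)
  case (Suc k)
  have "(\<integral>\<^sup>+xs. ennreal (real (sum_list xs)) \<partial>replicate_pmf (Suc k) p) =
      (\<integral>\<^sup>+b. (\<integral>\<^sup>+xs. (ennreal (real b) + ennreal (real (sum_list xs))) \<partial>replicate_pmf k p) \<partial>p)"
    by (simp flip: ennreal_plus)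
  also have "\<dots> = (\<integral>\<^sup>+b. ennreal (real b) + of_nat k * (\<integral>\<^sup>+b. ennreal (real b) \<partial>p) \<partial>p)"
    by (simp add: nn_integral_add Suc measure_pmf.emeasure_space_1)
  also have "\<dots> = of_nat (Suc k) * (\<integral>\<^sup>+b. ennreal (real b) \<partial>p)"
    by (simp add: nn_integral_add distrib_right)
  finally show ?case .
qed simp

lemma nn_integral_poisson_pmf:
  assumes m: "0 < m"
  shows "(\<integral>\<^sup>+k. of_nat k \<partial>poisson_pmf m) = ennreal m"
proof -
  have "(\<lambda>n. m ^ n /\<^sub>R fact n * (m * exp (- m))) sums (exp m * (m * exp (- m)))"
    by (intro sums_mult2 exp_converges)
  then have "(\<lambda>n. (m ^ Suc n / fact (Suc n) * exp (- m)) * real (Suc n)) sums (exp m * (m * exp (- m)))"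
    by (rule arg_cong2[where f = "(sums)", THEN iffD1, rotated -1]) (auto simp: field_simps simp del: of_nat_Suc)
  then have "(\<lambda>n. (m ^ n / fact n * exp (- m)) * real n) sums (exp m * (m * exp (- m)) + (m ^ 0 / fact 0 * exp (- m)) * real 0)"
    by (subst (asm) sums_Suc_iff) simp
  then have s: "(\<lambda>n. (m ^ n / fact n * exp (- m)) * real n) sums m"
    using exp_minus_inverse[of m] by (simp add: mult.left_commute[of _ m])
  have "ennreal (pmf (poisson_pmf m) n) * of_nat n = ennreal ((m ^ n / fact n * exp (- m)) * real n)" for n
    unfolding pmf_poisson[OF m] ennreal_of_nat_eq_real_of_nat using m by (intro ennreal_mult[symmetric]) auto
  then have "(\<integral>\<^sup>+k. of_nat k \<partial>poisson_pmf m) = (\<Sum>n. ennreal ((m ^ n / fact n * exp (- m)) * real n))"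
    by (simp only: nn_integral_measure_pmf nn_integral_count_space_nat)
  also have "\<dots> = ennreal m"
    using m s by (intro suminf_ennreal_eq) auto
  finally show ?thesis .
qed

lemma nn_integral_batch_arrivals:
  assumes q: "valid_input q" and t: "0 \<le> t"
  shows "(\<integral>\<^sup>+a. ennreal (real a) \<partial>batch_arrivals q t) =
    ennreal (arr_rate q) * (\<integral>\<^sup>+b. ennreal (real b) \<partial>batch_law q) * ennreal t"
proof (cases "t = 0")
  case True
  then show ?thesis by (simp add: batch_arrivals_def)
next
  case False
  have r: "0 < arr_rate q" using q by (simp add: valid_input_def)
  with False t have m: "0 < arr_rate q * t" by simp
  have "(\<integral>\<^sup>+a. ennreal (real a) \<partial>batch_arrivals q t) =
      (\<integral>\<^sup>+k. of_nat k \<partial>poisson_pmf (arr_rate q * t)) * (\<integral>\<^sup>+b. ennreal (real b) \<partial>batch_law q)"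
    using m by (simp add: batch_arrivals_def nn_integral_sum_list_replicate_pmf nn_integral_multc)
  also have "(\<integral>\<^sup>+k. of_nat k \<partial>poisson_pmf (arr_rate q * t)) = ennreal (arr_rate q) * ennreal t"
    using r t unfolding nn_integral_poisson_pmf[OF m] by (simp add: ennreal_mult)
  also have "ennreal (arr_rate q) * ennreal t * (\<integral>\<^sup>+b. ennreal (real b) \<partial>batch_law q) =
      ennreal (arr_rate q) * (\<integral>\<^sup>+b. ennreal (real b) \<partial>batch_law q) * ennreal t"
    by (simp only: ac_simps)
  finally show ?thesis .
qed

definition batch_mean :: "'a arrival_input_scheme \<Rightarrow> real" where
  "batch_mean q = measure_pmf.expectation (batch_law q) real"

definition service_mean :: "(real \<times> 2) measure \<Rightarrow> real" where
  "service_mean S = (\<integral>\<omega>. fst \<omega> \<partial>S)"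

lemma finite_batch_mean:
  assumes "finite_batch_second_moment q"
  shows "integrable (measure_pmf (batch_law q)) real"
proof (rule Bochner_Integration.integrable_bound)
  show "integrable (measure_pmf (batch_law q)) (\<lambda>b. (real b)\<^sup>2)"
    using assms by (simp add: finite_batch_second_moment_def)
  have "real b \<le> (real b)\<^sup>2" for b by (cases b) (auto simp: power2_eq_square)
  then show "AE b in measure_pmf (batch_law q). norm (real b) \<le> norm ((real b)\<^sup>2)" by simp
qed simp

lemma batch_mean_ge_1:
  assumes "valid_input q" "integrable (measure_pmf (batch_law q)) real"
  shows "1 \<le> batch_mean q"
  unfolding batch_mean_def
  by (rule measure_pmf.integral_ge_const[OF assms(2)])
     (use assms(1) in \<open>auto simp: AE_measure_pmf_iff valid_input_def\<close>)

lemma nn_integral_arrivals_during_mean: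
  assumes q: "valid_input q" and B: "integrable (measure_pmf (batch_law q)) real" and S: "valid_service S"
  shows "(\<integral>\<^sup>+(a, j). ennreal (real a) \<partial>arrivals_during q S) =
    ennreal (arr_rate q * batch_mean q) * (\<integral>\<^sup>+\<omega>. ennreal (fst \<omega>) \<partial>S)"
proof -
  have [measurable_cong]: "sets S = sets (borel \<Otimes>\<^sub>M count_space UNIV)"
    using S by (simp add: valid_service_def)
  have ae: "AE \<omega> in S. 0 \<le> fst \<omega>" using S by (simp add: valid_service_def)
  have b: "(\<integral>\<^sup>+b. ennreal (real b) \<partial>batch_law q) = ennreal (batch_mean q)"
    unfolding batch_mean_def by (rule nn_integral_eq_integral[OF B]) simp
  have "(\<integral>\<^sup>+(a, j). ennreal (real a) \<partial>arrivals_during q S) =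
      (\<integral>\<^sup>+\<omega>. (\<integral>\<^sup>+a. ennreal (real a) \<partial>batch_arrivals q (fst \<omega>)) \<partial>S)"
    by (simp add: nn_integral_arrivals_during[OF S])
  also have "\<dots> = (\<integral>\<^sup>+\<omega>. ennreal (arr_rate q * batch_mean q) * ennreal (fst \<omega>) \<partial>S)"
    using q batch_mean_ge_1[OF q B]
    by (intro nn_integral_cong_AE, use ae in eventually_elim)
       (simp add: nn_integral_batch_arrivals[OF q] b ennreal_mult valid_input_def)
  also have "\<dots> = ennreal (arr_rate q * batch_mean q) * (\<integral>\<^sup>+\<omega>. ennreal (fst \<omega>) \<partial>S)"
    by (rule nn_integral_cmult) simp
  finally show ?thesis .
qed

text \<open>The factor \<open>lambda * E[B]\<close> is positive and finite, so finiteness of the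
  mean passes both ways: from arrivals to service time for ordinary services, and from service time
  to arrivals for first services.\<close>

lemma arrivals_during_mean:
  assumes q: "valid_input q" and B: "integrable (measure_pmf (batch_law q)) real" and S: "valid_service S"
  shows "integrable (measure_pmf (arrivals_during q S)) (\<lambda>(a, j). real a) \<longleftrightarrow> integrable S fst"
    and "measure_pmf.expectation (arrivals_during q S) (\<lambda>(a, j). real a) =
      arr_rate q * batch_mean q * service_mean S"
proof -
  have [measurable_cong]: "sets S = sets (borel \<Otimes>\<^sub>M count_space UNIV)"
    using S by (simp add: valid_service_def)
  have ae: "AE \<omega> in S. 0 \<le> fst \<omega>" using S by (simp add: valid_service_def)
  have pos: "0 < arr_rate q * batch_mean q"
    using q batch_mean_ge_1[OF q B] by (simp add: valid_input_def)
  note nn = nn_integral_arrivals_during_mean[OF q B S]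
  have ae': "(\<integral>\<^sup>+\<omega>. ennreal (norm (fst \<omega>)) \<partial>S) = (\<integral>\<^sup>+\<omega>. ennreal (fst \<omega>) \<partial>S)"
    by (intro nn_integral_cong_AE, use ae in eventually_elim) simp
  show "integrable (measure_pmf (arrivals_during q S)) (\<lambda>(a, j). real a) \<longleftrightarrow> integrable S fst"
    unfolding integrable_iff_bounded ae' using nn pos
    by (auto simp: case_prod_unfold ennreal_mult_less_top)
  have "measure_pmf.expectation (arrivals_during q S) (\<lambda>(a, j). real a) =
      enn2real (\<integral>\<^sup>+(a, j). ennreal (real a) \<partial>arrivals_during q S)"
    by (subst integral_eq_nn_integral) (auto simp: case_prod_unfold)
  also have "\<dots> = arr_rate q * batch_mean q * enn2real (\<integral>\<^sup>+\<omega>. ennreal (fst \<omega>) \<partial>S)"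
    using pos by (simp add: nn enn2real_mult)
  also have "enn2real (\<integral>\<^sup>+\<omega>. ennreal (fst \<omega>) \<partial>S) = service_mean S"
    unfolding service_mean_def using ae by (subst integral_eq_nn_integral) auto
  finally show "measure_pmf.expectation (arrivals_during q S) (\<lambda>(a, j). real a) =
      arr_rate q * batch_mean q * service_mean S" .
qed

text \<open>\<open>M\<close> batches of one common size \<open>b >= 1\<close> contain at least
  \<open>M\<close> customers, and a Poisson number of batches equals \<open>M\<close> with positive
  probability.\<close>

lemma batch_arrivals_unbounded:
  assumes q: "valid_input q" and t: "0 < t"
  shows "\<exists>a\<ge>M. a \<in> set_pmf (batch_arrivals q t)"
proof -
  have m: "0 < arr_rate q * t" using q t by (simp add: valid_input_def)
  obtain b where b: "b \<in> set_pmf (batch_law q)" using set_pmf_not_empty by fast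
  then have "1 \<le> b" using q by (auto simp: valid_input_def)
  have "replicate M b \<in> set_pmf (replicate_pmf M (batch_law q))"
    using b by (auto simp: set_replicate_pmf)
  then have "M * b \<in> set_pmf (batch_arrivals q t)"
    unfolding batch_arrivals_def using m
    by (auto simp: sum_list_replicate intro!: exI[of _ M] image_eqI[of _ _ "replicate M b"])
  then show ?thesis using \<open>1 \<le> b\<close> by (intro exI[of _ "M * b"]) simp
qed

text \<open>A bound on the count would make the conditional probability of at least \<open>M\<close>
  arrivals vanish for almost every service time. Counts over a positive time are unbounded, so the
  service time would be 0 almost surely, which \<open>valid_service\<close> excludes.\<close>

lemma arrivals_during_unbounded:
  assumes q: "valid_input q" and S: "valid_service S"
  shows "\<exists>a\<ge>M. \<exists>j. (a, j) \<in> set_pmf (arrivals_during q S)"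
proof (rule ccontr)
  assume *: "\<not> ?thesis"
  have [measurable_cong]: "sets S = sets (borel \<Otimes>\<^sub>M count_space UNIV)"
    using S by (simp add: valid_service_def)
  have ms: "(\<lambda>\<omega>. \<integral>\<^sup>+a. (indicator {M..} a :: ennreal) \<partial>batch_arrivals q (fst \<omega>)) \<in> borel_measurable S"
    by (simp only: nn_integral_measure_pmf nn_integral_count_space_nat) measurable
  have "(\<integral>\<^sup>+\<omega>. (\<integral>\<^sup>+a. indicator {M..} a \<partial>batch_arrivals q (fst \<omega>)) \<partial>S) =
      (\<integral>\<^sup>+x. indicator {M..} (fst x) \<partial>arrivals_during q S)"
    by (simp add: nn_integral_arrivals_during[OF S])
  also have "\<dots> = (\<integral>\<^sup>+x. 0 \<partial>arrivals_during q S)"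
    using * by (intro nn_integral_cong_AE) (auto simp: AE_measure_pmf_iff indicator_def)
  finally have "AE \<omega> in S. (\<integral>\<^sup>+a. indicator {M..} a \<partial>batch_arrivals q (fst \<omega>)) = 0"
    using nn_integral_0_iff_AE[OF ms] by simp
  moreover have "AE \<omega> in S. 0 \<le> fst \<omega>" using S by (simp add: valid_service_def)
  ultimately have "AE \<omega> in S. fst \<omega> = 0"
  proof eventually_elim
    case (elim \<omega>)
    show "fst \<omega> = 0"
    proof (rule ccontr)
      assume "fst \<omega> \<noteq> 0"
      with elim have "0 < fst \<omega>" by simp
      from batch_arrivals_unbounded[OF q this, of M]
      obtain a where "M \<le> a" "a \<in> set_pmf (batch_arrivals q (fst \<omega>))" by blast
      moreover have "emeasure (measure_pmf (batch_arrivals q (fst \<omega>))) {M..} = 0" using elim by simp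
      ultimately show False by (auto simp: measure_pmf.emeasure_eq_measure measure_pmf_zero_iff)
    qed
  qed
  then show False using S by (simp add: valid_service_def)
qed

subsection \<open>Service transforms\<close>

lemma service_lst_antimono:
  assumes S: "valid_service S" and "0 \<le> s" "s \<le> t"
  shows "service_lst S j t \<le> service_lst S j s"
proof -
  interpret prob_space S using S by (simp add: valid_service_def)
  have [measurable_cong]: "sets S = sets (borel \<Otimes>\<^sub>M count_space UNIV)"
    using S by (simp add: valid_service_def)
  have ae: "AE \<omega> in S. 0 \<le> fst \<omega>" using S by (simp add: valid_service_def)
  have int: "integrable S (\<lambda>\<omega>. exp (- r * fst \<omega>) * indicator {j} (snd \<omega>))" if "0 \<le> r" for r
    by (intro integrable_const_bound[where B = 1], use ae in eventually_elim)
       (use that in \<open>auto simp: indicator_def mult_nonneg_nonneg\<close>)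
  show ?thesis
    unfolding service_lst_def
    by (intro integral_mono_AE int, use assms in simp, use assms in simp, use ae in eventually_elim)
       (use assms in \<open>auto simp: indicator_def intro: mult_right_mono\<close>)
qed

text \<open>\<open>max 0 s\<close> extends the transform by a constant to negative arguments, where
  the integral may diverge; continuity is then two-sided at every \<open>s\<close>.\<close>

lemma isCont_service_lst:
  assumes S: "valid_service S"
  shows "isCont (\<lambda>s. service_lst S j (max 0 s)) s"
proof (rule continuous_at_sequentiallyI)
  interpret prob_space S using S by (simp add: valid_service_def)
  have [measurable_cong]: "sets S = sets (borel \<Otimes>\<^sub>M count_space UNIV)"
    using S by (simp add: valid_service_def)
  have ae: "AE \<omega> in S. 0 \<le> fst \<omega>" using S by (simp add: valid_service_def)
  fix u :: "nat \<Rightarrow> real" assume u: "u \<longlonglongrightarrow> s"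
  show "(\<lambda>n. service_lst S j (max 0 (u n))) \<longlonglongrightarrow> service_lst S j (max 0 s)"
    unfolding service_lst_def
  proof (rule integral_dominated_convergence[where w = "\<lambda>_. 1"])
    show "AE \<omega> in S. (\<lambda>n. exp (- max 0 (u n) * fst \<omega>) * indicator {j} (snd \<omega>))
        \<longlonglongrightarrow> exp (- max 0 s * fst \<omega>) * indicator {j} (snd \<omega>)"
      by (intro AE_I2 tendsto_intros u)
    show "AE \<omega> in S. norm (exp (- max 0 (u n) * fst \<omega>) * indicator {j} (snd \<omega>)) \<le> 1" for n
      using ae by eventually_elim (auto simp: indicator_def)
  qed auto
qed

lemma service_lst_sum:
  assumes S: "valid_service S" and s: "0 \<le> s"
  shows "service_lst S 1 s + service_lst S 2 s = (\<integral>\<omega>. exp (- s * fst \<omega>) \<partial>S)"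
    and "integrable S (\<lambda>\<omega>. exp (- s * fst \<omega>))"
proof -
  interpret prob_space S using S by (simp add: valid_service_def)
  have [measurable_cong]: "sets S = sets (borel \<Otimes>\<^sub>M count_space UNIV)"
    using S by (simp add: valid_service_def)
  have ae: "AE \<omega> in S. 0 \<le> fst \<omega>" using S by (simp add: valid_service_def)
  have int: "integrable S (\<lambda>\<omega>. exp (- s * fst \<omega>) * indicator {j} (snd \<omega>))" for j
    by (intro integrable_const_bound[where B = 1], use ae in eventually_elim)
       (use s in \<open>auto simp: indicator_def mult_nonneg_nonneg\<close>)
  have eq: "(\<lambda>\<omega> :: real \<times> 2. exp (- s * fst \<omega>)) =
      (\<lambda>\<omega>. exp (- s * fst \<omega>) * indicator {1} (snd \<omega>) + exp (- s * fst \<omega>) * indicator {2} (snd \<omega>))"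
    using exhaust_2 by (auto simp: fun_eq_iff indicator_def)
  show "service_lst S 1 s + service_lst S 2 s = (\<integral>\<omega>. exp (- s * fst \<omega>) \<partial>S)"
    by (subst eq, subst Bochner_Integration.integral_add[OF int int]) (simp add: service_lst_def)
  show "integrable S (\<lambda>\<omega>. exp (- s * fst \<omega>))"
    by (subst eq) (intro Bochner_Integration.integrable_add int)
qed

lemma service_mean_pos:
  assumes S: "valid_service S" and int: "integrable S fst"
  shows "0 < service_mean S"
proof -
  have ae: "AE \<omega> in S. 0 \<le> fst \<omega>" using S by (simp add: valid_service_def)
  have "0 \<le> service_mean S" unfolding service_mean_def by (rule integral_nonneg_AE[OF ae])
  moreover have "service_mean S \<noteq> 0"
    unfolding service_mean_def integral_nonneg_eq_0_iff_AE[OF int ae] using S by (simp add: valid_service_def)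
  ultimately show ?thesis by simp
qed

text \<open>By \<open>1 - exp (- x) <= x\<close>, difference quotients of the transform at 0 stay
  below the mean; by \<open>service_lst_approx\<close> they come arbitrarily close to it.
  Convergence of transforms therefore bounds means from below.\<close>

lemma service_lst_lower:
  assumes S: "valid_service S" and int: "integrable S fst" and s: "0 < s"
  shows "(1 - (service_lst S 1 s + service_lst S 2 s)) / s \<le> service_mean S"
proof -
  interpret prob_space S using S by (simp add: valid_service_def)
  have "(\<integral>\<omega>. 1 - s * fst \<omega> \<partial>S) \<le> (\<integral>\<omega>. exp (- s * fst \<omega>) \<partial>S)"
    by (intro integral_mono service_lst_sum(2)[OF S])
       (use s int exp_ge_add_one_self[of "- s * fst _"] in \<open>auto simp: algebra_simps\<close>)
  then have "1 - s * service_mean S \<le> service_lst S 1 s + service_lst S 2 s"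
    using s int by (simp add: service_lst_sum(1)[OF S] service_mean_def prob_space)
  then show ?thesis using s by (simp add: field_simps)
qed

lemma service_lst_approx:
  assumes S: "valid_service S" and int: "integrable S fst" and c: "c < service_mean S"
  shows "\<exists>s>0. c < (1 - (service_lst S 1 s + service_lst S 2 s)) / s"
proof -
  interpret prob_space S using S by (simp add: valid_service_def)
  have [measurable_cong]: "sets S = sets (borel \<Otimes>\<^sub>M count_space UNIV)"
    using S by (simp add: valid_service_def)
  have ae: "AE \<omega> in S. 0 \<le> fst \<omega>" using S by (simp add: valid_service_def)
  define t where "t k = inverse (real (Suc k))" for k
  have t: "0 < t k" for k by (simp add: t_def)
  have tl: "t \<longlonglongrightarrow> 0" unfolding t_def by (rule LIMSEQ_inverse_real_of_nat)
  have "(\<lambda>k. \<integral>\<omega>. (1 - exp (- t k * fst \<omega>)) / t k \<partial>S) \<longlonglongrightarrow> (\<integral>\<omega>. fst \<omega> \<partial>S)"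
  proof (rule integral_dominated_convergence[where w = fst])
    show "AE \<omega> in S. (\<lambda>k. (1 - exp (- t k * fst \<omega>)) / t k) \<longlonglongrightarrow> fst \<omega>"
    proof (rule AE_I2)
      fix \<omega> :: "real \<times> 2"
      have "DERIV (\<lambda>h. exp (- h * fst \<omega>)) 0 :> - fst \<omega>" by (auto intro!: derivative_eq_intros)
      then have "((\<lambda>h. (exp (- h * fst \<omega>) - 1) / h) \<longlongrightarrow> - fst \<omega>) (at 0)" by (auto dest: DERIV_D)
      moreover have "filterlim t (at 0) sequentially"
        using tl t by (simp add: filterlim_at less_imp_neq[symmetric])
      ultimately have "(\<lambda>k. (exp (- t k * fst \<omega>) - 1) / t k) \<longlonglongrightarrow> - fst \<omega>" by (rule filterlim_compose)
      from tendsto_minus[OF this] show "(\<lambda>k. (1 - exp (- t k * fst \<omega>)) / t k) \<longlonglongrightarrow> fst \<omega>"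
        by (simp add: minus_divide_left)
    qed
    show "AE \<omega> in S. norm ((1 - exp (- t k * fst \<omega>)) / t k) \<le> fst \<omega>" for k
      using ae
    proof eventually_elim
      case (elim \<omega>)
      have "1 - t k * fst \<omega> \<le> exp (- t k * fst \<omega>)" using exp_ge_add_one_self[of "- t k * fst \<omega>"] by simp
      moreover have "exp (- t k * fst \<omega>) \<le> 1" using elim t[of k] by simp
      ultimately show ?case using t[of k] by (simp add: field_simps)
    qed
  qed (use int in auto)
  then have "eventually (\<lambda>k. c < (\<integral>\<omega>. (1 - exp (- t k * fst \<omega>)) / t k \<partial>S)) sequentially"
    using c unfolding service_mean_def by (rule order_tendstoD)
  then obtain k where "c < (\<integral>\<omega>. (1 - exp (- t k * fst \<omega>)) / t k \<partial>S)"
    unfolding eventually_sequentially by blast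
  also have "\<dots> = (1 - (service_lst S 1 (t k) + service_lst S 2 (t k))) / t k"
    using service_lst_sum(2)[OF S, of "t k"] t[of k]
    by (simp add: service_lst_sum(1)[OF S] less_imp_le prob_space)
  finally show ?thesis using t by blast
qed

section \<open>The batch mean as a supremum of difference quotients at 1\<close>

lemma batch_gf_1: "batch_gf q 1 = 1"
  by (simp add: batch_gf_def)

lemma batch_gf_less_1:
  assumes q: "valid_input q" and z: "0 < z" "z < 1"
  shows "batch_gf q z < 1"
proof -
  have "batch_gf q z \<le> z"
    unfolding batch_gf_def
  proof (rule measure_pmf.integral_le_const)
    show "integrable (measure_pmf (batch_law q)) (\<lambda>b. z ^ b)"
      using z by (intro measure_pmf.integrable_const_bound[where B = 1]) (auto simp: power_le_one)
    show "AE b in measure_pmf (batch_law q). z ^ b \<le> z"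
      using q z power_decreasing[of 1 _ z] by (auto simp: AE_measure_pmf_iff valid_input_def)
  qed
  with z show ?thesis by simp
qed

lemma integrable_geo:
  assumes "integrable (measure_pmf p) real" "0 \<le> z" "z \<le> 1"
  shows "integrable (measure_pmf p) (\<lambda>b. geo b z)"
  by (rule Bochner_Integration.integrable_bound[OF assms(1)])
     (use assms(2,3) in \<open>auto intro!: AE_I2 simp: geo_nonneg geo_le\<close>)

lemma batch_gf_geo:
  assumes B: "integrable (measure_pmf (batch_law q)) real" and z: "0 < z" "z < 1"
  shows "(1 - batch_gf q z) / (1 - z) = measure_pmf.expectation (batch_law q) (\<lambda>b. geo b z)"
proof -
  have "batch_gf q z = measure_pmf.expectation (batch_law q) (\<lambda>b. 1 - (1 - z) * geo b z)"
    unfolding batch_gf_def by (rule Bochner_Integration.integral_cong) (auto simp: geo_eq)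
  also have "\<dots> = 1 - (1 - z) * measure_pmf.expectation (batch_law q) (\<lambda>b. geo b z)"
    using integrable_geo[OF B, of z] z by simp
  finally show ?thesis using z by simp
qed

lemma batch_gf_lower:
  assumes B: "integrable (measure_pmf (batch_law q)) real" and z: "0 < z" "z < 1"
  shows "(1 - batch_gf q z) / (1 - z) \<le> batch_mean q"
  unfolding batch_gf_geo[OF B z] batch_mean_def
  by (intro integral_mono integrable_geo B) (use z in \<open>auto intro: geo_le\<close>)

lemma batch_gf_approx:
  assumes B: "integrable (measure_pmf (batch_law q)) real" and c: "c < batch_mean q"
  shows "\<exists>z\<in>{0<..<1}. c < (1 - batch_gf q z) / (1 - z)"
proof -
  define t where "t k = 1 - inverse (real (Suc (Suc k)))" for k
  have t: "0 < t k" "t k < 1" for k by (auto simp: t_def field_simps)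
  have tl: "t \<longlonglongrightarrow> 1" unfolding t_def
    using tendsto_diff[OF tendsto_const[of 1] LIMSEQ_Suc[OF LIMSEQ_inverse_real_of_nat]] by simp
  have "(\<lambda>k. measure_pmf.expectation (batch_law q) (\<lambda>b. geo b (t k))) \<longlonglongrightarrow>
      measure_pmf.expectation (batch_law q) (\<lambda>b. geo b 1)"
    by (rule expectation_tendsto_at_moving_point[where \<phi> = "\<lambda>z b. geo b z" and z = t])
       (use B t tl in \<open>auto simp: geo_nonneg geo_mono isCont_geo geo_1\<close>)
  then have "eventually (\<lambda>k. c < measure_pmf.expectation (batch_law q) (\<lambda>b. geo b (t k))) sequentially"
    using c by (intro order_tendstoD) (auto simp: geo_1 batch_mean_def)
  then obtain k where "c < measure_pmf.expectation (batch_law q) (\<lambda>b. geo b (t k))"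
    unfolding eventually_sequentially by blast
  then show ?thesis
    using t[of k] batch_gf_geo[OF B t, of k] by (intro bexI[of _ "t k"]) auto
qed

text \<open>
  The mean number of arrivals factorises, and each factor is lower semicontinuous under weak
  convergence; hence convergence of the product forces convergence of both factors.
\<close>

lemma mean_factors_tendsto:
  fixes Q :: "nat \<Rightarrow> 'a arrival_input_scheme"
  assumes q: "\<And>n. valid_input (Q n)" "valid_input Qb"
    and B: "\<And>n. integrable (measure_pmf (batch_law (Q n))) real" "integrable (measure_pmf (batch_law Qb)) real"
    and inp: "input_tendsto Q Qb"
    and S: "\<And>n. valid_service (S n)" "valid_service Sb"
    and G: "\<And>n. integrable (S n) fst" "integrable Sb fst"
    and lst: "\<And>j s. 0 \<le> s \<Longrightarrow> (\<lambda>n. service_lst (S n) j s) \<longlonglongrightarrow> service_lst Sb j s"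
    and mean: "(\<lambda>n. arr_rate (Q n) * batch_mean (Q n) * service_mean (S n)) \<longlonglongrightarrow>
      arr_rate Qb * batch_mean Qb * service_mean Sb"
  shows "(\<lambda>n. batch_mean (Q n)) \<longlonglongrightarrow> batch_mean Qb"
    and "(\<lambda>n. service_mean (S n)) \<longlonglongrightarrow> service_mean Sb"
proof -
  have r: "0 < arr_rate (Q n)" "0 < arr_rate Qb" for n using q by (auto simp: valid_input_def)
  have rl: "(\<lambda>n. arr_rate (Q n)) \<longlonglongrightarrow> arr_rate Qb" using inp by (simp add: input_tendsto_def)
  have "(\<lambda>n. arr_rate (Q n) * batch_mean (Q n) * service_mean (S n) / arr_rate (Q n)) \<longlonglongrightarrow>
      arr_rate Qb * batch_mean Qb * service_mean Sb / arr_rate Qb"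
    by (intro tendsto_intros mean rl) (use r in auto)
  then have prod: "(\<lambda>n. batch_mean (Q n) * service_mean (S n)) \<longlonglongrightarrow> batch_mean Qb * service_mean Sb"
    using r by (simp add: mult.assoc less_imp_neq[symmetric])
  have b0: "0 < batch_mean Qb" using batch_mean_ge_1[OF q(2) B(2)] by simp
  have s0: "0 < service_mean Sb" by (rule service_mean_pos[OF S(2) G(2)])
  have bl: "eventually (\<lambda>n. c < batch_mean (Q n)) sequentially" if "c < batch_mean Qb" for c
  proof (rule eventually_gt_of_lower_approx[where T = "{0<..<1}"])
    fix t :: real assume t: "t \<in> {0<..<1}"
    show "(\<lambda>n. (1 - batch_gf (Q n) t) / (1 - t)) \<longlonglongrightarrow> (1 - batch_gf Qb t) / (1 - t)"
      using t inp by (intro tendsto_intros) (auto simp: input_tendsto_def)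
    show "eventually (\<lambda>n. (1 - batch_gf (Q n) t) / (1 - t) \<le> batch_mean (Q n)) sequentially"
      using t by (intro always_eventually allI batch_gf_lower B) auto
  qed (use batch_gf_approx[OF B(2)] that in auto)
  have sl: "eventually (\<lambda>n. c < service_mean (S n)) sequentially" if "c < service_mean Sb" for c
  proof (rule eventually_gt_of_lower_approx[where T = "{0<..}"])
    fix t :: real assume t: "t \<in> {0<..}"
    show "(\<lambda>n. (1 - (service_lst (S n) 1 t + service_lst (S n) 2 t)) / t) \<longlonglongrightarrow>
        (1 - (service_lst Sb 1 t + service_lst Sb 2 t)) / t"
      using t by (intro tendsto_intros lst) auto
    show "eventually (\<lambda>n. (1 - (service_lst (S n) 1 t + service_lst (S n) 2 t)) / t \<le> service_mean (S n)) sequentially"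
      using t by (intro always_eventually allI service_lst_lower S G) auto
  qed (use service_lst_approx[OF S(2) G(2)] that in auto)
  show "(\<lambda>n. batch_mean (Q n)) \<longlonglongrightarrow> batch_mean Qb"
    by (rule tendsto_factor[OF prod b0 s0 bl sl])
  show "(\<lambda>n. service_mean (S n)) \<longlonglongrightarrow> service_mean Sb"
    by (rule tendsto_factor[OF _ s0 b0 sl bl]) (use prod in \<open>simp add: mult.commute\<close>)
qed

lemma part_mean_power_arrivals:
  assumes "valid_input q" "valid_service S" "0 \<le> z" "z \<le> 1"
  shows "part_mean (arrivals_during q S) (\<lambda>a. z ^ a) j = service_lst S j (arr_rate q * (1 - batch_gf q z))"
  unfolding part_mean_def by (rule arrivals_during_gf[OF assms])

text \<open>The transform is evaluated at \<open>lambda (1 - B(z))\<close>, which changes with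
  \<open>n\<close>; antitonicity of the transforms and continuity of the limit absorb this, provided
  that the limiting argument is positive. At \<open>z = 1\<close> the argument is 0 for every
  \<open>n\<close>, hence the separate case.\<close>

lemma arrivals_gf_tendsto:
  fixes Q :: "nat \<Rightarrow> 'a arrival_input_scheme"
  assumes q: "\<And>n. valid_input (Q n)" "valid_input Qb" and inp: "input_tendsto Q Qb"
    and S: "\<And>n. valid_service (S n)" "valid_service Sb"
    and lst: "\<And>s. 0 \<le> s \<Longrightarrow> (\<lambda>n. service_lst (S n) j s) \<longlonglongrightarrow> service_lst Sb j s"
    and z: "0 < z" "z \<le> 1"
  shows "(\<lambda>n. part_mean (arrivals_during (Q n) (S n)) (\<lambda>a. z ^ a) j) \<longlonglongrightarrow>
    part_mean (arrivals_during Qb Sb) (\<lambda>a. z ^ a) j"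
proof -
  have eq: "part_mean (arrivals_during p T) (\<lambda>a. z ^ a) j = service_lst T j (max 0 (arr_rate p * (1 - batch_gf p z)))"
    if "valid_input p" "valid_service T" for p :: "'a arrival_input_scheme" and T
    using part_mean_power_arrivals[OF that, of z j] batch_gf_bounds[of z p] that(1) z
    by (simp add: valid_input_def max_absorb2)
  show ?thesis
  proof (cases "z = 1")
    case True
    then show ?thesis
      using lst[of 0] unfolding eq[OF q(1) S(1)] eq[OF q(2) S(2)] by (simp add: batch_gf_1)
  next
    case False
    then have z': "z < 1" using z by simp
    have s: "0 < arr_rate Qb * (1 - batch_gf Qb z)"
      using q(2) batch_gf_less_1[OF q(2) z(1) z'] by (simp add: valid_input_def)
    have sl: "(\<lambda>n. arr_rate (Q n) * (1 - batch_gf (Q n) z)) \<longlonglongrightarrow> arr_rate Qb * (1 - batch_gf Qb z)"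
      using inp z by (intro tendsto_intros) (auto simp: input_tendsto_def)
    have "(\<lambda>n. (\<lambda>s. service_lst (S n) j (max 0 s)) (arr_rate (Q n) * (1 - batch_gf (Q n) z))) \<longlonglongrightarrow>
        (\<lambda>s. service_lst Sb j (max 0 s)) (arr_rate Qb * (1 - batch_gf Qb z))"
      by (rule antimono_tendsto_at_moving_point[where f = "\<lambda>n s. service_lst (S n) j (max 0 s)"
            and g = "\<lambda>s. service_lst Sb j (max 0 s)", OF _ _ isCont_service_lst[OF S(2)] s sl])
         (auto intro: lst service_lst_antimono[OF S(1)])
    then show ?thesis by (simp only: eq[OF q(1) S(1)] eq[OF q(2) S(2)])
  qed
qed

subsection \<open>The semi-Markov queue\<close>

definition service_arrivals :: "smqueue \<Rightarrow> 2 \<Rightarrow> (nat \<times> 2) pmf" where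
  "service_arrivals q i = arrivals_during q (service q i)"

definition after_idle :: "smqueue \<Rightarrow> 2 \<Rightarrow> (nat \<times> 2) pmf" where
  "after_idle q i = map_pmf (\<lambda>((a, j), b). (a + b - 1, j))
     (pair_pmf (arrivals_during q (first_service q i)) (batch_law q))"

lemma queue_step_eq: "queue_step q = level_step (service_arrivals q) (after_idle q)"
  by (simp add: queue_step_def level_step_def service_arrivals_def after_idle_def fun_eq_iff)

lemma expectation_pair_fst:
  fixes f :: "'a \<Rightarrow> real"
  shows "measure_pmf.expectation (pair_pmf p q) (\<lambda>x. f (fst x)) = measure_pmf.expectation p f"
    and "integrable (measure_pmf (pair_pmf p q)) (\<lambda>x. f (fst x)) \<longleftrightarrow> integrable (measure_pmf p) f"
  by (metis integral_map_pmf map_fst_pair_pmf, metis integrable_map_pmf_eq map_fst_pair_pmf)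

lemma expectation_pair_snd:
  fixes f :: "'b \<Rightarrow> real"
  shows "measure_pmf.expectation (pair_pmf p q) (\<lambda>x. f (snd x)) = measure_pmf.expectation q f"
    and "integrable (measure_pmf (pair_pmf p q)) (\<lambda>x. f (snd x)) \<longleftrightarrow> integrable (measure_pmf q) f"
  by (metis integral_map_pmf map_snd_pair_pmf, metis integrable_map_pmf_eq map_snd_pair_pmf)

lemma expectation_pair_mult:
  fixes f :: "'a \<Rightarrow> real" and g :: "'b \<Rightarrow> real"
  assumes f: "\<And>x. 0 \<le> f x" and g: "\<And>y. 0 \<le> g y"
  shows "measure_pmf.expectation (pair_pmf p q) (\<lambda>x. f (fst x) * g (snd x)) =
    measure_pmf.expectation p f * measure_pmf.expectation q g"
  by (simp add: integral_eq_nn_integral f g ennreal_mult nn_integral_pair_pmf' nn_integral_cmult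
      nn_integral_multc enn2real_mult)

lemma after_idle_ae:
  assumes "valid_input q"
  shows "AE x in measure_pmf (pair_pmf p (batch_law q)). 1 \<le> snd x"
  using assms by (auto simp: AE_measure_pmf_iff valid_input_def)

lemma after_idle_mean:
  assumes q: "valid_input q" and B: "integrable (measure_pmf (batch_law q)) real"
    and A: "integrable (measure_pmf (arrivals_during q (first_service q i))) (\<lambda>(a, j). real a)"
  shows "integrable (measure_pmf (after_idle q i)) (\<lambda>(x, j). real x)"
    and "measure_pmf.expectation (after_idle q i) (\<lambda>(x, j). real x) =
      measure_pmf.expectation (arrivals_during q (first_service q i)) (\<lambda>(a, j). real a) + batch_mean q - 1"
proof -
  let ?p = "pair_pmf (arrivals_during q (first_service q i)) (batch_law q)"
  \<comment> \<open>Subtraction on naturals is exact here since batches are almost surely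
    nonempty.\<close>
  have ae: "AE x in measure_pmf ?p. real (fst (fst x) + snd x - 1) = real (fst (fst x)) + real (snd x) - 1"
    using after_idle_ae[OF q] by eventually_elim (simp add: of_nat_diff)
  have i1: "integrable (measure_pmf ?p) (\<lambda>x. real (fst (fst x)))"
    using A by (simp add: case_prod_unfold expectation_pair_fst(2)[of _ _ "\<lambda>y. real (fst y)"])
  have i2: "integrable (measure_pmf ?p) (\<lambda>x. real (snd x))"
    using B by (simp add: expectation_pair_snd(2))
  have "integrable (measure_pmf ?p) (\<lambda>x. real (fst (fst x) + snd x - 1)) \<longleftrightarrow>
      integrable (measure_pmf ?p) (\<lambda>x. real (fst (fst x)) + real (snd x) - 1)"
    by (rule integrable_cong_AE[OF _ _ ae]) auto
  then show "integrable (measure_pmf (after_idle q i)) (\<lambda>(x, j). real x)"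
    using i1 i2 by (simp add: after_idle_def case_prod_unfold)
  have "measure_pmf.expectation (after_idle q i) (\<lambda>(x, j). real x) =
      measure_pmf.expectation ?p (\<lambda>x. real (fst (fst x) + snd x - 1))"
    by (simp add: after_idle_def case_prod_unfold)
  also have "\<dots> = measure_pmf.expectation ?p (\<lambda>x. real (fst (fst x)) + real (snd x) - 1)"
    by (rule integral_cong_AE[OF _ _ ae]) auto
  also have "\<dots> = measure_pmf.expectation ?p (\<lambda>x. real (fst (fst x))) + measure_pmf.expectation ?p (\<lambda>x. real (snd x)) - 1"
    using i1 i2 by simp
  finally show "measure_pmf.expectation (after_idle q i) (\<lambda>(x, j). real x) =
      measure_pmf.expectation (arrivals_during q (first_service q i)) (\<lambda>(a, j). real a) + batch_mean q - 1"
    by (simp add: expectation_pair_fst(1)[of _ _ "\<lambda>y. real (fst y)"] expectation_pair_snd(1) batch_mean_def case_prod_unfold)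
qed

lemma after_idle_gf:
  assumes q: "valid_input q" and S: "valid_service (first_service q i)" and z: "0 < z" "z \<le> 1"
  shows "measure_pmf.expectation (after_idle q i) (\<lambda>(x, j). z ^ x) =
    (part_mean (arrivals_during q (first_service q i)) (\<lambda>a. z ^ a) 1 +
     part_mean (arrivals_during q (first_service q i)) (\<lambda>a. z ^ a) 2) * batch_gf q z / z"
proof -
  let ?p = "pair_pmf (arrivals_during q (first_service q i)) (batch_law q)"
  have ae: "AE x in measure_pmf ?p. z ^ (fst (fst x) + snd x - 1) = z ^ fst (fst x) * z ^ snd x / z"
    using after_idle_ae[OF q]
  proof eventually_elim
    case (elim x)
    then obtain m where "snd x = Suc m" by (cases "snd x") auto
    then show ?case using z by (simp add: power_add)
  qed
  have "measure_pmf.expectation (after_idle q i) (\<lambda>(x, j). z ^ x) =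
      measure_pmf.expectation ?p (\<lambda>x. z ^ (fst (fst x) + snd x - 1))"
    by (simp add: after_idle_def case_prod_unfold)
  also have "\<dots> = measure_pmf.expectation ?p (\<lambda>x. z ^ fst (fst x) * z ^ snd x / z)"
    by (rule integral_cong_AE[OF _ _ ae]) auto
  also have "\<dots> = measure_pmf.expectation (arrivals_during q (first_service q i)) (\<lambda>x. z ^ fst x) * batch_gf q z / z"
    using z expectation_pair_mult[of "\<lambda>x. z ^ fst x" "\<lambda>b. z ^ b"] by (simp add: batch_gf_def)
  finally show ?thesis
    using part_mean_add[OF integrable_power_part[of z "arrivals_during q (first_service q i)"]] z
    by (simp add: case_prod_unfold)
qed

lemma after_idle_unbounded:
  assumes q: "valid_input q" and S: "valid_service (first_service q i)"
  shows "\<exists>x\<ge>M. x \<in> set_pmf (map_pmf fst (after_idle q i))"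
proof -
  obtain a j where a: "M \<le> a" "(a, j) \<in> set_pmf (arrivals_during q (first_service q i))"
    using arrivals_during_unbounded[OF q S] by blast
  obtain b where b: "b \<in> set_pmf (batch_law q)" using set_pmf_not_empty by fast
  then have "1 \<le> b" using q by (auto simp: valid_input_def)
  moreover have "a + b - 1 \<in> set_pmf (map_pmf fst (after_idle q i))"
    using a(2) b by (force simp: after_idle_def image_image)
  ultimately show ?thesis using a(1) by (intro exI[of _ "a + b - 1"]) auto
qed

text \<open>A path from \<open>i\<close> that never makes the step to \<open>j\<close> stays at
  \<open>i\<close>, as there is no third state to pass through.\<close>

lemma irreducible_chain_two:
  assumes "irreducible_chain (P :: 2 \<Rightarrow> 2 \<Rightarrow> real)" and "i \<noteq> j"
  shows "0 < P i j"
proof (rule ccontr)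
  assume np: "\<not> 0 < P i j"
  have "(i, j) \<in> {(i, j). P i j > 0}\<^sup>*" using assms(1) by (simp add: irreducible_chain_def)
  then have "j = i"
  proof (induction rule: rtrancl_induct)
    case (step k l)
    then have "l \<noteq> j" using np by auto
    then show ?case using exhaust_2[of i] exhaust_2[of j] exhaust_2[of l] assms(2) by auto
  qed simp
  with assms(2) show False by simp
qed

lemma service_arrivals_moments:
  "arr_mean (service_arrivals q) i j = alpha q i j"
  "arr_second (service_arrivals q) i j = alpha_hat q i j"
  by (simp_all add: arr_mean_def arr_second_def service_arrivals_def alpha_def alpha_hat_def part_mean_def)

lemma tr_service_arrivals:
  assumes "valid_smqueue q"
  shows "type_prob (service_arrivals q) i j = type_trans q i j"
  using part_mean_power_arrivals[of q "service q i" 1 j] assms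
  by (simp add: type_prob_def service_arrivals_def type_trans_def valid_smqueue_def batch_gf_1)

lemma slack_service_arrivals:
  assumes "valid_smqueue q"
  shows "type_weight (service_arrivals q) i = type_stat q i" "slack (service_arrivals q) = 1 - rho q"
  by (simp_all add: slack_def type_weight_def type_stat_def rho_def alpha_row_def
      tr_service_arrivals[OF assms] service_arrivals_moments)

lemma type_trans_pos:
  assumes "valid_smqueue q"
  shows "0 < type_trans q 1 2" "0 < type_trans q 2 1"
  using assms by (auto simp: valid_smqueue_def intro!: irreducible_chain_two)

text \<open>At \<open>rho = 1\<close> the slack vanishes and \<open>cor1\<close> at type 2 is
  \<open>(1 - alpha_2) / P_21\<close>. Taking the weight \<open>P_21 / (P_12 + P_21)\<close> of type
  1 out of the stationary average turns this into the prefactor of \<open>dependence_term\<close>,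
  and the ratio of the two weights into \<open>P_12 / P_21\<close>. The first-moment terms add up to
  \<open>rho / 2 = 1 / 2\<close>.\<close>

lemma kap_service_arrivals:
  assumes q: "valid_smqueue q" and rho: "rho q = 1"
  shows "limit_coeff (service_arrivals q) = (alpha_hat_total q - 1) / 2 + dependence_term q"
proof -
  define p r where "p = type_trans q 1 2" and "r = type_trans q 2 1"
  have pos: "0 < p" "0 < r" using type_trans_pos[OF q] by (auto simp: p_def r_def)
  define c where "c = (1 - alpha_row q 2) / r"
  have c: "cor1 (service_arrivals q) 1 = 0" "cor1 (service_arrivals q) 2 = c"
    using rho by (simp_all add: cor1_def c_def r_def tr_service_arrivals[OF q] slack_service_arrivals[OF q]
        service_arrivals_moments alpha_row_def)
  have st: "type_stat q 1 = r / (p + r)" "type_stat q 2 = p / (p + r)"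
    by (simp_all add: type_stat_def p_def r_def)
  have "dependence_term q = c * (r / (p + r)) * (p / r * (1 - alpha q 2 2) - alpha q 1 2)"
    using pos by (simp add: dependence_term_def c_def p_def[symmetric] r_def[symmetric])
  also have "\<dots> = c * (p / (p + r) * (1 - alpha q 2 2) - r / (p + r) * alpha q 1 2)"
    using pos by (simp add: right_diff_distrib)
  finally have dep: "dependence_term q = c * (type_stat q 2 * (1 - alpha q 2 2) - type_stat q 1 * alpha q 1 2)"
    by (simp only: st)
  have "limit_coeff (service_arrivals q) =
      type_stat q 1 * (- (alpha q 1 2 * c) + (alpha_hat_row q 1 - alpha_row q 1) / 2) +
      type_stat q 2 * (c - alpha q 2 2 * c + (alpha_hat_row q 2 - alpha_row q 2) / 2)"
    by (simp add: limit_coeff_def rate2_def slack_service_arrivals[OF q] c service_arrivals_moments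
        alpha_row_def alpha_hat_row_def diff_diff_eq)
  also have "\<dots> = (alpha_hat_total q - rho q) / 2 + dependence_term q"
    unfolding dep alpha_hat_total_def rho_def by (simp add: field_simps)
  finally show ?thesis using rho by simp
qed

lemma arrival_laws_service_arrivals:
  assumes q: "valid_smqueue q" and fin: "\<And>i j. finite_alpha_hat q i j"
  shows "arrival_laws (service_arrivals q)"
proof
  fix i :: 2
  have "(\<lambda>(a, j :: 2). (real a)\<^sup>2) = (\<lambda>x. (case x of (a, j') \<Rightarrow> (real a)\<^sup>2 * indicator {1} j') +
      (case x of (a, j') \<Rightarrow> (real a)\<^sup>2 * indicator {2} j'))"
    using exhaust_2 by (auto simp: fun_eq_iff indicator_def)
  then show "integrable (measure_pmf (service_arrivals q i)) (\<lambda>(a, j). (real a)\<^sup>2)"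
    using fin[of i 1] fin[of i 2] unfolding finite_alpha_hat_def service_arrivals_def
    by (simp only: Bochner_Integration.integrable_add)
qed (use type_trans_pos[OF q] in \<open>simp_all add: tr_service_arrivals[OF q]\<close>)

lemma alpha_row_eq:
  assumes q: "valid_smqueue q" and fin: "\<And>i j. finite_alpha_hat q i j"
    and B: "finite_batch_second_moment q"
  shows "integrable (service q i) fst"
    and "alpha_row q i = arr_rate q * batch_mean q * service_mean (service q i)"
proof -
  interpret arrival_laws "service_arrivals q" by (rule arrival_laws_service_arrivals[OF q fin])
  have v: "valid_input q" "valid_service (service q i)" using q by (auto simp: valid_smqueue_def)
  note m = arrivals_during_mean[OF v(1) finite_batch_mean[OF B] v(2)]
  note int = int1[of i, unfolded service_arrivals_def]
  show "integrable (service q i) fst" using int m(1) by simp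
  have "alpha_row q i = measure_pmf.expectation (arrivals_during q (service q i)) (\<lambda>(a, j). real a)"
    unfolding alpha_row_def alpha_def by (rule part_mean_add[OF int, unfolded part_mean_def])
  then show "alpha_row q i = arr_rate q * batch_mean q * service_mean (service q i)"
    by (simp only: m(2))
qed

lemma smqueue_heavy_traffic_limit:
  fixes Q :: "nat \<Rightarrow> smqueue" and Qb :: smqueue and \<mu> :: "nat \<Rightarrow> (nat \<times> 2) pmf"
  assumes q: "\<And>n. valid_smqueue (Q n)" and qb: "valid_smqueue Qb"
    and B: "\<And>n. finite_batch_second_moment (Q n)" "finite_batch_second_moment Qb"
    and fin: "\<And>n i j. finite_alpha_hat (Q n) i j" and finb: "\<And>i j. finite_alpha_hat Qb i j"
    and ht: "heavy_traffic Q Qb"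
    and st: "\<And>n. stationary_pmf (queue_step (Q n)) (\<mu> n)"
    and pos: "(alpha_hat_total Qb - 1) / 2 + dependence_term Qb > 0"
    and s: "0 \<le> s"
  shows "(\<lambda>n. measure_pmf.expectation (\<mu> n) (\<lambda>(x, j). exp (- s * (1 - rho (Q n)) * real x)))
    \<longlonglongrightarrow> 1 / (1 + s * ((alpha_hat_total Qb - 1) / 2 + dependence_term Qb))"
proof -
  have v: "valid_input (Q n)" "valid_service (service (Q n) i)" "valid_service (first_service (Q n) i)" for n i
    using q by (auto simp: valid_smqueue_def)
  have vb: "valid_input Qb" "valid_service (service Qb i)" "valid_service (first_service Qb i)" for i
    using qb by (auto simp: valid_smqueue_def)
  have inp: "input_tendsto Q Qb"
    and lst: "\<And>i j s. 0 \<le> s \<Longrightarrow> (\<lambda>n. service_lst (service (Q n) i) j s) \<longlonglongrightarrow> service_lst (service Qb i) j s"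
    and flst: "\<And>i j s. 0 \<le> s \<Longrightarrow> (\<lambda>n. service_lst (first_service (Q n) i) j s) \<longlonglongrightarrow> service_lst (first_service Qb i) j s"
    and al: "\<And>i j. (\<lambda>n. alpha (Q n) i j) \<longlonglongrightarrow> alpha Qb i j"
    and alh: "\<And>i j. (\<lambda>n. alpha_hat (Q n) i j) \<longlonglongrightarrow> alpha_hat Qb i j"
    and fi: "\<And>n i. integrable (first_service (Q n) i) fst" "\<And>i. integrable (first_service Qb i) fst"
    and fm: "\<And>i. (\<lambda>n. service_mean (first_service (Q n) i)) \<longlonglongrightarrow> service_mean (first_service Qb i)"
    and rho: "\<And>n. rho (Q n) < 1" "(\<lambda>n. rho (Q n)) \<longlonglongrightarrow> 1"
    using ht by (auto simp: heavy_traffic_def smqueue_tendsto_def service_mean_def)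
  have B': "integrable (measure_pmf (batch_law (Q n))) real" "integrable (measure_pmf (batch_law Qb)) real" for n
    using B by (auto intro: finite_batch_mean)
  have rl: "(\<lambda>n. arr_rate (Q n)) \<longlonglongrightarrow> arr_rate Qb" using inp by (simp add: input_tendsto_def)
  have tt: "(\<lambda>n. type_trans (Q n) i j) \<longlonglongrightarrow> type_trans Qb i j" for i j
    unfolding type_trans_def by (rule lst) simp
  have ts: "(\<lambda>n. type_stat (Q n) i) \<longlonglongrightarrow> type_stat Qb i" for i
    unfolding type_stat_def using type_trans_pos[OF qb]
    by (cases "i = 1") (auto intro!: tendsto_intros tt)
  have "(\<lambda>n. rho (Q n)) \<longlonglongrightarrow> rho Qb"
    unfolding rho_def alpha_row_def by (intro tendsto_intros ts al)
  \<comment> \<open>The limit model is critical: \<open>rho\<close> depends continuously on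
    transition probabilities and first moments, all of which converge.\<close>
  with rho(2) have rhob: "rho Qb = 1" by (blast intro: LIMSEQ_unique)
  \<comment> \<open>The mean of the opening batch enters the exit from level 0. Its convergence is
    extracted from \<open>alpha_1\<close>, the product of arrival rate, mean batch size and mean
    service time; type 1 is an arbitrary choice.\<close>
  have bm: "(\<lambda>n. batch_mean (Q n)) \<longlonglongrightarrow> batch_mean Qb"
  proof (rule mean_factors_tendsto(1)[OF v(1) vb(1) B' inp v(2)[of _ 1] vb(2)[of 1]])
    show "integrable (service (Q n) 1) fst" for n by (rule alpha_row_eq(1)[OF q fin B(1)])
    show "integrable (service Qb 1) fst" by (rule alpha_row_eq(1)[OF qb finb B(2)])
    have "(\<lambda>n. alpha_row (Q n) 1) \<longlonglongrightarrow> alpha_row Qb 1"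
      unfolding alpha_row_def by (intro tendsto_intros al)
    then show "(\<lambda>n. arr_rate (Q n) * batch_mean (Q n) * service_mean (service (Q n) 1)) \<longlonglongrightarrow>
        arr_rate Qb * batch_mean Qb * service_mean (service Qb 1)"
      by (simp only: alpha_row_eq(2)[OF q fin B(1)] alpha_row_eq(2)[OF qb finb B(2)])
  qed (rule lst)
  have fa: "integrable (measure_pmf (arrivals_during (Q n) (first_service (Q n) i))) (\<lambda>(a, j). real a)" for n i
    using arrivals_during_mean(1)[OF v(1) B'(1) v(3)] fi(1) by blast
  have fab: "integrable (measure_pmf (arrivals_during Qb (first_service Qb i))) (\<lambda>(a, j). real a)" for i
    using arrivals_during_mean(1)[OF vb(1) B'(2) vb(3)] fi(2) by blast
  have laws: "arrival_laws (service_arrivals (Q n))" for n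
    by (rule arrival_laws_service_arrivals[OF q fin])
  have chain: "level_chain (service_arrivals (Q n)) (after_idle (Q n)) (\<mu> n)" for n
  proof -
    interpret arrival_laws "service_arrivals (Q n)" by (rule laws)
    show ?thesis
      by unfold_locales (use after_idle_mean(1)[OF v(1) B'(1) fa] st[of n] in \<open>simp_all add: queue_step_eq\<close>)
  qed
  have "(\<lambda>n. measure_pmf.expectation (\<mu> n) (\<lambda>(x, j). exp (- s * slack (service_arrivals (Q n)) * real x)))
    \<longlonglongrightarrow> 1 / (1 + s * limit_coeff (service_arrivals Qb))"
  proof (rule heavy_traffic_limit[OF chain arrival_laws_service_arrivals[OF qb finb]])
    show "integrable (measure_pmf (after_idle Qb i)) (\<lambda>(x, j). real x)" for i
      by (rule after_idle_mean(1)[OF vb(1) B'(2) fab])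
    show "(\<lambda>n. part_mean (service_arrivals (Q n) i) (\<lambda>a. z ^ a) j) \<longlonglongrightarrow> part_mean (service_arrivals Qb i) (\<lambda>a. z ^ a) j"
      if "0 < z" "z \<le> 1" for z i j
      unfolding service_arrivals_def by (rule arrivals_gf_tendsto[OF v(1) vb(1) inp v(2) vb(2) lst that])
    show "(\<lambda>n. measure_pmf.expectation (after_idle (Q n) i) (\<lambda>(x, j). z ^ x)) \<longlonglongrightarrow>
        measure_pmf.expectation (after_idle Qb i) (\<lambda>(x, j). z ^ x)" if z: "0 < z" "z < 1" for z :: real and i
      unfolding after_idle_gf[OF v(1) v(3) z(1) less_imp_le[OF z(2)]] after_idle_gf[OF vb(1) vb(3) z(1) less_imp_le[OF z(2)]]
      using inp z by (intro tendsto_intros arrivals_gf_tendsto[OF v(1) vb(1) inp v(3) vb(3) flst])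
        (auto simp: input_tendsto_def)
    show "(\<lambda>n. measure_pmf.expectation (after_idle (Q n) i) (\<lambda>(x, j). real x)) \<longlonglongrightarrow>
        measure_pmf.expectation (after_idle Qb i) (\<lambda>(x, j). real x)" for i
      unfolding after_idle_mean(2)[OF v(1) B'(1) fa] after_idle_mean(2)[OF vb(1) B'(2) fab]
        arrivals_during_mean(2)[OF v(1) B'(1) v(3)] arrivals_during_mean(2)[OF vb(1) B'(2) vb(3)]
      by (intro tendsto_intros rl bm fm)
    show "\<exists>x\<ge>M. x \<in> set_pmf (map_pmf fst (after_idle Qb i))" for M i
      by (rule after_idle_unbounded[OF vb(1) vb(3)])
    show "(\<lambda>n. slack (service_arrivals (Q n))) \<longlonglongrightarrow> 0"
      unfolding slack_service_arrivals[OF q] using tendsto_diff[OF tendsto_const[of 1] rho(2)] by simp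
  qed (use al alh rho(1) pos s in \<open>simp_all add: service_arrivals_moments slack_service_arrivals[OF q]
      kap_service_arrivals[OF qb rhob]\<close>)
  then show ?thesis by (simp only: slack_service_arrivals[OF q] kap_service_arrivals[OF qb rhob])
qed

subsection \<open>The queue without dependencies\<close>

text \<open>A queue with independent services is a semi-Markov one with irrelevant, uniformly drawn types.\<close>

definition typed_service :: "real measure \<Rightarrow> (real \<times> 2) measure" where
  "typed_service S = S \<Otimes>\<^sub>M measure_pmf (pmf_of_set UNIV)"

definition typed_queue :: "mxg1 \<Rightarrow> smqueue" where
  "typed_queue q = \<lparr>arr_rate = arr_rate q, batch_law = batch_law q,
     service = (\<lambda>_. typed_service (service_law q)), first_service = (\<lambda>_. typed_service (service_law q))\<rparr>"

lemma typed_queue_simps [simp]: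
  "arr_rate (typed_queue q) = arr_rate q" "batch_law (typed_queue q) = batch_law q"
  "service (typed_queue q) i = typed_service (service_law q)"
  "first_service (typed_queue q) i = typed_service (service_law q)"
  "batch_gf (typed_queue q) z = batch_gf q z"
  "batch_arrivals (typed_queue q) t = batch_arrivals q t"
  "valid_input (typed_queue q) = valid_input q"
  "finite_batch_second_moment (typed_queue q) = finite_batch_second_moment q"
  by (simp_all add: typed_queue_def batch_gf_def batch_arrivals_def valid_input_def finite_batch_second_moment_def)

lemma sets_typed_service:
  assumes "sets S = sets borel"
  shows "sets (typed_service S) = sets (borel \<Otimes>\<^sub>M count_space UNIV)"
  unfolding typed_service_def by (rule sets_pair_measure_cong) (use assms in auto)

lemma pmf_uniform_type: "pmf (pmf_of_set UNIV) (j :: 2) = 1 / 2"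
  by simp

lemma integral_typed_service:
  fixes f :: "real \<Rightarrow> real"
  assumes "prob_space S" "sets S = sets borel" and f [measurable]: "f \<in> borel_measurable borel" and nonneg: "\<And>x. 0 \<le> f x"
  shows "(\<integral>\<omega>. f (fst \<omega>) * indicator {j} (snd \<omega>) \<partial>typed_service S) = (\<integral>x. f x \<partial>S) / 2"
proof -
  have [measurable_cong]: "sets S = sets borel" "sets (typed_service S) = sets (borel \<Otimes>\<^sub>M count_space UNIV)"
    using assms sets_typed_service by auto
  have "(\<integral>\<^sup>+\<omega>. ennreal (f (fst \<omega>) * indicator {j} (snd \<omega>)) \<partial>typed_service S) =
      (\<integral>\<^sup>+x. (\<integral>\<^sup>+k. ennreal (f x * indicator {j} k) \<partial>measure_pmf (pmf_of_set UNIV)) \<partial>S)"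
    unfolding typed_service_def
    by (subst measure_pmf.nn_integral_fst[symmetric]) auto
  also have "\<dots> = (\<integral>\<^sup>+x. ennreal (f x) * ennreal (1 / 2) \<partial>S)"
    by (intro nn_integral_cong)
       (simp add: ennreal_mult nonneg nn_integral_cmult ennreal_indicator emeasure_pmf_single pmf_uniform_type)
  also have "\<dots> = (\<integral>\<^sup>+x. ennreal (f x) \<partial>S) * ennreal (1 / 2)"
    by (rule nn_integral_multc) simp
  finally have eq: "(\<integral>\<^sup>+\<omega>. ennreal (f (fst \<omega>) * indicator {j} (snd \<omega>)) \<partial>typed_service S) =
      (\<integral>\<^sup>+x. ennreal (f x) \<partial>S) * ennreal (1 / 2)" .
  have "(\<integral>\<omega>. f (fst \<omega>) * indicator {j} (snd \<omega>) \<partial>typed_service S) =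
      enn2real (\<integral>\<^sup>+\<omega>. ennreal (f (fst \<omega>) * indicator {j} (snd \<omega>)) \<partial>typed_service S)"
    by (rule integral_eq_nn_integral) (use nonneg in auto)
  also have "\<dots> = enn2real (\<integral>\<^sup>+x. ennreal (f x) \<partial>S) * enn2real (ennreal (1 / 2))"
    by (simp only: eq enn2real_mult)
  also have "enn2real (\<integral>\<^sup>+x. ennreal (f x) \<partial>S) = (\<integral>x. f x \<partial>S)"
    by (rule integral_eq_nn_integral[symmetric]) (use nonneg in auto)
  also have "enn2real (ennreal (1 / 2)) = 1 / 2" by (rule enn2real_ennreal) simp
  finally show ?thesis by simp
qed

lemma AE_typed_service:
  assumes "prob_space S" "sets S = sets borel" "Measurable.pred borel P"
  shows "(AE \<omega> in typed_service S. P (fst \<omega>)) \<longleftrightarrow> (AE x in S. P x)"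
proof -
  interpret S: prob_space S by (rule assms(1))
  interpret pair_sigma_finite S "measure_pmf (pmf_of_set (UNIV :: 2 set))" ..
  have [measurable_cong]: "sets S = sets borel" by (rule assms(2))
  have [measurable]: "Measurable.pred borel P" by (rule assms(3))
  have "(AE x in S. P x) \<longleftrightarrow> (AE x in S. AE k in measure_pmf (pmf_of_set (UNIV :: 2 set)). P (fst (x, k)))"
    by simp
  also have "\<dots> \<longleftrightarrow> (AE \<omega> in typed_service S. P (fst \<omega>))"
    unfolding typed_service_def using AE_pair_iff[of "\<lambda>x k. P x"] by simp
  finally show ?thesis by simp
qed

lemma valid_typed_service:
  assumes "valid_mxg1 q"
  shows "valid_service (typed_service (service_law q))"
proof -
  interpret S: prob_space "service_law q" using assms by (simp add: valid_mxg1_def)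
  interpret pair_prob_space "service_law q" "measure_pmf (pmf_of_set (UNIV :: 2 set))" ..
  have "prob_space (typed_service (service_law q))" unfolding typed_service_def by (rule P.prob_space_axioms)
  then show ?thesis
    using assms by (simp add: valid_service_def valid_mxg1_def sets_typed_service
      AE_typed_service[of "service_law q" "\<lambda>x. 0 \<le> x"] AE_typed_service[of "service_law q" "\<lambda>x. x = 0"])
qed

lemma service_lst_typed:
  assumes "valid_mxg1 q"
  shows "service_lst (typed_service (service_law q)) j s = (\<integral>g. exp (- s * g) \<partial>service_law q) / 2"
  unfolding service_lst_def
  by (rule integral_typed_service) (use assms in \<open>auto simp: valid_mxg1_def\<close>)

lemma arrivals_during_typed:
  assumes "valid_mxg1 q"
  shows "arrivals_during (typed_queue q) (typed_service (service_law q)) =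
    pair_pmf (mxg1_arrivals q) (pmf_of_set UNIV)"
proof (rule pmf_eqI)
  fix x :: "nat \<times> 2"
  obtain a j where x: "x = (a, j)" by (cases x)
  show "pmf (arrivals_during (typed_queue q) (typed_service (service_law q))) x =
      pmf (pair_pmf (mxg1_arrivals q) (pmf_of_set UNIV)) x"
    unfolding x pmf_arrivals_during[OF valid_typed_service[OF assms]] pmf_pair pmf_mxg1_arrivals[OF assms] pmf_uniform_type
    using integral_typed_service[of "service_law q" "\<lambda>t. pmf (batch_arrivals q t) a" j] assms
    by (simp add: valid_mxg1_def)
qed

lemma part_mean_typed:
  assumes "\<And>a. 0 \<le> g a"
  shows "part_mean (pair_pmf p (pmf_of_set UNIV)) g j = measure_pmf.expectation p g / 2"
  unfolding part_mean_def case_prod_unfold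
  by (subst expectation_pair_mult) (simp_all add: assms measure_pmf_single pmf_uniform_type)

lemma valid_typed_queue:
  assumes "valid_mxg1 q"
  shows "valid_smqueue (typed_queue q)"
proof -
  interpret prob_space "service_law q" using assms by (simp add: valid_mxg1_def)
  have "0 < type_trans (typed_queue q) i j" for i j
    unfolding type_trans_def by (simp add: service_lst_typed[OF assms] prob_space)
  then have "irreducible_chain (type_trans (typed_queue q))"
    unfolding irreducible_chain_def by (intro allI r_into_rtrancl) simp
  then show ?thesis
    using assms by (simp add: valid_smqueue_def valid_typed_service valid_mxg1_def)
qed

lemma typed_queue_moments:
  assumes "valid_mxg1 q"
  shows "alpha (typed_queue q) i j = mxg1_rho q / 2" "alpha_hat (typed_queue q) i j = mxg1_second_moment q / 2"
    "type_trans (typed_queue q) i j = 1 / 2" "type_stat (typed_queue q) i = 1 / 2"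
    "alpha_row (typed_queue q) i = mxg1_rho q" "rho (typed_queue q) = mxg1_rho q"
    "alpha_hat_total (typed_queue q) = mxg1_second_moment q"
proof -
  interpret prob_space "service_law q" using assms by (simp add: valid_mxg1_def)
  show a: "alpha (typed_queue q) i j = mxg1_rho q / 2" for i j
    using part_mean_typed[of real "mxg1_arrivals q" j]
    by (simp add: alpha_def arrivals_during_typed[OF assms] part_mean_def mxg1_rho_def)
  show h: "alpha_hat (typed_queue q) i j = mxg1_second_moment q / 2" for i j
    using part_mean_typed[of "\<lambda>a. (real a)\<^sup>2" "mxg1_arrivals q" j]
    by (simp add: alpha_hat_def arrivals_during_typed[OF assms] part_mean_def mxg1_second_moment_def)
  show t: "type_trans (typed_queue q) i j = 1 / 2" for i j
    unfolding type_trans_def by (simp add: service_lst_typed[OF assms] prob_space)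
  show s: "type_stat (typed_queue q) i = 1 / 2" for i by (simp add: type_stat_def t)
  show r: "alpha_row (typed_queue q) i = mxg1_rho q" for i by (simp add: alpha_row_def a)
  show "rho (typed_queue q) = mxg1_rho q" by (simp add: rho_def r s)
  show "alpha_hat_total (typed_queue q) = mxg1_second_moment q"
    by (simp add: alpha_hat_total_def alpha_hat_row_def h s)
qed

text \<open>The type is redrawn uniformly and independently at each step, so the product of a
  stationary queue-length law with the uniform law is reproduced by one step.\<close>

lemma typed_queue_stationary:
  assumes q: "valid_mxg1 q" and st: "stationary_pmf (mxg1_step q) \<nu>"
  shows "stationary_pmf (queue_step (typed_queue q)) (pair_pmf \<nu> (pmf_of_set UNIV))"
proof -
  have step: "queue_step (typed_queue q) (x, i) = pair_pmf (mxg1_step q x) (pmf_of_set UNIV)" for x i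
    by (simp add: queue_step_def mxg1_step_def arrivals_during_typed[OF q] pair_pmf_def map_pmf_def
        bind_assoc_pmf bind_return_pmf bind_commute_pmf[of "pmf_of_set UNIV" "batch_law q"] split: prod.splits)
  have "bind_pmf (pair_pmf \<nu> (pmf_of_set UNIV)) (queue_step (typed_queue q)) =
      bind_pmf \<nu> (\<lambda>x. pair_pmf (mxg1_step q x) (pmf_of_set UNIV))"
    by (simp add: pair_pmf_def[of \<nu>] bind_assoc_pmf bind_return_pmf step)
  also have "\<dots> = pair_pmf (bind_pmf \<nu> (mxg1_step q)) (pmf_of_set UNIV)"
    by (simp add: pair_pmf_def bind_assoc_pmf)
  finally show ?thesis using st by (simp add: stationary_pmf_def)
qed

lemma finite_alpha_hat_typed:
  assumes "valid_mxg1 q" "mxg1_finite_moments q"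
  shows "finite_alpha_hat (typed_queue q) i j"
proof -
  have "integrable (measure_pmf (pair_pmf (mxg1_arrivals q) (pmf_of_set (UNIV :: 2 set)))) (\<lambda>x. (real (fst x))\<^sup>2)"
    using assms(2) by (simp add: mxg1_finite_moments_def expectation_pair_fst(2)[of _ _ "\<lambda>a. (real a)\<^sup>2"])
  then show ?thesis
    unfolding finite_alpha_hat_def typed_queue_simps arrivals_during_typed[OF assms(1)]
    by (intro integrable_part) (simp add: case_prod_unfold)
qed

text \<open>Second moments give uniform integrability in explicit form: for every \<open>z\<close>
  in the open unit interval the mean lies between the difference quotient \<open>G\<close> of the
  generating function and \<open>G\<close> plus \<open>(1 - z)\<close> times the second moment.
  Letting \<open>n\<close> grow at fixed \<open>z\<close> and then \<open>z\<close> tend to 1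
  identifies the mean of the limit law.\<close>

lemma mean_limit_of_second_moments:
  fixes p :: "nat \<Rightarrow> nat pmf"
  assumes int: "\<And>n. integrable (measure_pmf (p n)) (\<lambda>a. (real a)\<^sup>2)" "integrable (measure_pmf pb) (\<lambda>a. (real a)\<^sup>2)"
    and gf: "\<And>z :: real. 0 < z \<Longrightarrow> z < 1 \<Longrightarrow>
      (\<lambda>n. measure_pmf.expectation (p n) (\<lambda>a. z ^ a)) \<longlonglongrightarrow> measure_pmf.expectation pb (\<lambda>a. z ^ a)"
    and sm: "(\<lambda>n. measure_pmf.expectation (p n) (\<lambda>a. (real a)\<^sup>2)) \<longlonglongrightarrow> measure_pmf.expectation pb (\<lambda>a. (real a)\<^sup>2)"
    and mean: "(\<lambda>n. measure_pmf.expectation (p n) real) \<longlonglongrightarrow> L"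
  shows "measure_pmf.expectation pb real = L"
proof -
  define G where "G q z = (1 - measure_pmf.expectation q (\<lambda>a. z ^ a)) / (1 - z)" for q :: "nat pmf" and z :: real
  define m where "m = measure_pmf.expectation pb (\<lambda>a. (real a)\<^sup>2)"
  have m0: "0 \<le> m" unfolding m_def by simp
  have sandwich: "G q z \<le> measure_pmf.expectation q real"
    "measure_pmf.expectation q real \<le> G q z + (1 - z) * measure_pmf.expectation q (\<lambda>a. (real a)\<^sup>2)"
    if z: "0 < z" "z < 1" and i2: "integrable (measure_pmf q) (\<lambda>a. (real a)\<^sup>2)" for q and z :: real
  proof -
    have "real a \<le> (real a)\<^sup>2" for a by (cases a) (auto simp: power2_eq_square)
    then have i1: "integrable (measure_pmf q) real"
      by (intro Bochner_Integration.integrable_bound[OF i2]) auto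
    have ig: "integrable (measure_pmf q) (\<lambda>a. geo a z)" by (rule integrable_geo[OF i1]) (use z in auto)
    have "measure_pmf.expectation q (\<lambda>a. z ^ a) = measure_pmf.expectation q (\<lambda>a. 1 - (1 - z) * geo a z)"
      by (rule Bochner_Integration.integral_cong) (auto simp: geo_eq)
    then have G: "G q z = measure_pmf.expectation q (\<lambda>a. geo a z)"
      using ig z by (simp add: G_def)
    show "G q z \<le> measure_pmf.expectation q real"
      unfolding G by (intro integral_mono ig i1) (use z in \<open>auto intro: geo_le\<close>)
    have "measure_pmf.expectation q real \<le> measure_pmf.expectation q (\<lambda>a. geo a z + (1 - z) * (real a)\<^sup>2)"
    proof (intro integral_mono i1 Bochner_Integration.integrable_add ig integrable_mult_right i2)
      fix a
      have "(1 - z) * geo2 a z \<le> (1 - z) * (real a)\<^sup>2"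
        using z by (intro mult_left_mono geo2_le_square) auto
      then show "real a \<le> geo a z + (1 - z) * (real a)\<^sup>2" using geo2_eq[of z a] by simp
    qed
    then show "measure_pmf.expectation q real \<le> G q z + (1 - z) * measure_pmf.expectation q (\<lambda>a. (real a)\<^sup>2)"
      using ig i2 by (simp add: G)
  qed
  have bound: "\<bar>L - measure_pmf.expectation pb real\<bar> \<le> (1 - z) * m" if z: "0 < z" "z < 1" for z
  proof -
    have Gl: "(\<lambda>n. G (p n) z) \<longlonglongrightarrow> G pb z"
      unfolding G_def using z by (intro tendsto_intros gf) auto
    have "G pb z \<le> L"
      by (rule LIMSEQ_le[OF Gl mean]) (use sandwich(1)[OF z int(1)] in auto)
    moreover have "L \<le> G pb z + (1 - z) * m"
      unfolding m_def
      by (rule LIMSEQ_le[OF mean tendsto_add[OF Gl tendsto_mult[OF tendsto_const sm]]])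
         (use sandwich(2)[OF z int(1)] in auto)
    ultimately show ?thesis using sandwich[OF z int(2)] by (simp add: m_def)
  qed
  have "\<bar>L - measure_pmf.expectation pb real\<bar> \<le> 0 + e" if e: "0 < e" for e
  proof -
    \<comment> \<open>The denominator \<open>m + 1\<close> gives \<open>(1 - z) * m <= e\<close>
      even when \<open>m = 0\<close>; the cap \<open>1 / 2\<close> keeps \<open>z\<close>
      positive.\<close>
    define z where "z = 1 - min (1 / 2) (e / (m + 1))"
    have z: "0 < z" "z < 1" using e m0 by (auto simp: z_def min_def field_simps)
    have "(1 - z) * m \<le> e / (m + 1) * m" using m0 by (intro mult_right_mono) (auto simp: z_def)
    also have "\<dots> \<le> e" using e m0 by (simp add: field_simps)
    finally show ?thesis using bound[OF z] by simp
  qed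
  then have "\<bar>L - measure_pmf.expectation pb real\<bar> \<le> 0" by (rule field_le_epsilon)
  then show ?thesis by simp
qed

text \<open>\<open>mxg1_heavy_traffic\<close> speaks of input laws, transforms, second moments and
  \<open>rho\<close> along the sequence. Criticality of the limit model follows from the second
  moments; convergence of the mean service time, which \<open>heavy_traffic\<close> demands of first
  services, comes from the factorisation of \<open>rho\<close>.\<close>

lemma typed_heavy_traffic:
  fixes R :: "nat \<Rightarrow> mxg1" and Rb :: mxg1
  assumes v: "\<And>n. valid_mxg1 (R n)" "valid_mxg1 Rb"
    and fin: "\<And>n. mxg1_finite_moments (R n)" "mxg1_finite_moments Rb"
    and ht: "mxg1_heavy_traffic R Rb"
  shows "heavy_traffic (\<lambda>n. typed_queue (R n)) (typed_queue Rb)" and "mxg1_rho Rb = 1"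
proof -
  have inp: "input_tendsto (\<lambda>n. typed_queue (R n)) (typed_queue Rb)"
    using ht by (simp add: mxg1_heavy_traffic_def input_tendsto_def)
  have lst: "(\<lambda>n. service_lst (typed_service (service_law (R n))) j s) \<longlonglongrightarrow>
      service_lst (typed_service (service_law Rb)) j s" if "0 \<le> s" for j s
    using ht that unfolding service_lst_typed[OF v(1)] service_lst_typed[OF v(2)] mxg1_heavy_traffic_def
    by (intro tendsto_intros) auto
  have sm: "(\<lambda>n. mxg1_second_moment (R n)) \<longlonglongrightarrow> mxg1_second_moment Rb"
    and rho: "\<And>n. mxg1_rho (R n) < 1" "(\<lambda>n. mxg1_rho (R n)) \<longlonglongrightarrow> 1"
    using ht by (auto simp: mxg1_heavy_traffic_def)
  have vi: "valid_input (typed_queue (R n))" "valid_input (typed_queue Rb)" for n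
    using v by (simp_all add: valid_mxg1_def)
  have gf: "(\<lambda>n. measure_pmf.expectation (mxg1_arrivals (R n)) (\<lambda>a. z ^ a)) \<longlonglongrightarrow>
      measure_pmf.expectation (mxg1_arrivals Rb) (\<lambda>a. z ^ a)" if z: "0 < z" "z < 1" for z :: real
  proof -
    have "(\<lambda>n. part_mean (pair_pmf (mxg1_arrivals (R n)) (pmf_of_set UNIV)) (\<lambda>a. z ^ a) 1) \<longlonglongrightarrow>
        part_mean (pair_pmf (mxg1_arrivals Rb) (pmf_of_set UNIV)) (\<lambda>a. z ^ a) 1"
      using arrivals_gf_tendsto[OF vi inp valid_typed_service[OF v(1)] valid_typed_service[OF v(2)] lst z(1) less_imp_le[OF z(2)], of 1]
      by (simp only: arrivals_during_typed[OF v(1)] arrivals_during_typed[OF v(2)])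
    from tendsto_mult[OF this tendsto_const[of 2]] show ?thesis
      using z by (simp add: part_mean_typed)
  qed
  show rhob: "mxg1_rho Rb = 1"
    unfolding mxg1_rho_def
    by (rule mean_limit_of_second_moments[where p = "\<lambda>n. mxg1_arrivals (R n)"])
       (use fin gf sm rho(2) in \<open>auto simp: mxg1_finite_moments_def mxg1_second_moment_def mxg1_rho_def\<close>)
  have vq: "valid_smqueue (typed_queue (R n))" "valid_smqueue (typed_queue Rb)" for n
    using v by (auto intro: valid_typed_queue)
  have B: "finite_batch_second_moment (typed_queue (R n))" "finite_batch_second_moment (typed_queue Rb)" for n
    using fin by (simp_all add: mxg1_finite_moments_def)
  note row = alpha_row_eq[OF vq(1) finite_alpha_hat_typed[OF v(1) fin(1)] B(1), of _ 1]
  note rowb = alpha_row_eq[OF vq(2) finite_alpha_hat_typed[OF v(2) fin(2)] B(2), of 1]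
  have sm1: "(\<lambda>n. service_mean (typed_service (service_law (R n)))) \<longlonglongrightarrow> service_mean (typed_service (service_law Rb))"
  proof (rule mean_factors_tendsto(2)[OF vi finite_batch_mean[OF B(1)] finite_batch_mean[OF B(2)] inp
        valid_typed_service[OF v(1)] valid_typed_service[OF v(2)] _ _ lst])
    show "integrable (typed_service (service_law (R n))) fst" for n using row(1) by simp
    show "integrable (typed_service (service_law Rb)) fst" using rowb(1) by simp
    have "(\<lambda>n. alpha_row (typed_queue (R n)) 1) \<longlonglongrightarrow> alpha_row (typed_queue Rb) 1"
      using rho(2) rhob by (simp add: typed_queue_moments[OF v(1)] typed_queue_moments[OF v(2)])
    then show "(\<lambda>n. arr_rate (typed_queue (R n)) * batch_mean (typed_queue (R n)) *
        service_mean (typed_service (service_law (R n)))) \<longlonglongrightarrow>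
        arr_rate (typed_queue Rb) * batch_mean (typed_queue Rb) * service_mean (typed_service (service_law Rb))"
      unfolding row(2) rowb(2) by simp
  qed
  have "(\<lambda>n. mxg1_rho (R n) / 2) \<longlonglongrightarrow> mxg1_rho Rb / 2" "(\<lambda>n. mxg1_second_moment (R n) / 2) \<longlonglongrightarrow> mxg1_second_moment Rb / 2"
    unfolding rhob by (intro tendsto_intros rho sm; simp)+
  then show "heavy_traffic (\<lambda>n. typed_queue (R n)) (typed_queue Rb)"
    unfolding heavy_traffic_def smqueue_tendsto_def
    using inp lst sm1 rho row(1) rowb(1)
    by (simp add: typed_queue_moments[OF v(1)] typed_queue_moments[OF v(2)] service_mean_def)
qed

lemma mxg1_heavy_traffic_limit:
  fixes R :: "nat \<Rightarrow> mxg1" and Rb :: mxg1 and \<nu> :: "nat \<Rightarrow> nat pmf"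
  assumes v: "\<And>n. valid_mxg1 (R n)" "valid_mxg1 Rb"
    and fin: "\<And>n. mxg1_finite_moments (R n)" "mxg1_finite_moments Rb"
    and ht: "mxg1_heavy_traffic R Rb"
    and st: "\<And>n. stationary_pmf (mxg1_step (R n)) (\<nu> n)"
    and pos: "0 < (mxg1_second_moment Rb - 1) / 2" and s: "0 \<le> s"
  shows "(\<lambda>n. measure_pmf.expectation (\<nu> n) (\<lambda>x. exp (- s * (1 - mxg1_rho (R n)) * real x)))
    \<longlonglongrightarrow> 1 / (1 + s * ((mxg1_second_moment Rb - 1) / 2))"
proof -
  note th = typed_heavy_traffic[OF v fin ht]
  \<comment> \<open>All rows have the same mean, so \<open>1 - alpha_row\<close> at type 2 equals
    \<open>1 - rho\<close>, which is 0 in the limit model.\<close>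
  have dep: "dependence_term (typed_queue Rb) = 0"
    by (simp add: dependence_term_def typed_queue_moments[OF v(2)] th(2))
  have "(\<lambda>n. measure_pmf.expectation (pair_pmf (\<nu> n) (pmf_of_set (UNIV :: 2 set)))
      (\<lambda>(x, j). exp (- s * (1 - rho (typed_queue (R n))) * real x))) \<longlonglongrightarrow>
    1 / (1 + s * ((alpha_hat_total (typed_queue Rb) - 1) / 2 + dependence_term (typed_queue Rb)))"
    by (rule smqueue_heavy_traffic_limit[OF valid_typed_queue[OF v(1)] valid_typed_queue[OF v(2)] _ _
          finite_alpha_hat_typed[OF v(1) fin(1)] finite_alpha_hat_typed[OF v(2) fin(2)] th(1)
          typed_queue_stationary[OF v(1) st] _ s])
       (use fin pos in \<open>simp_all add: mxg1_finite_moments_def dep typed_queue_moments[OF v(2)]\<close>)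
  then show ?thesis
    by (simp add: dep typed_queue_moments[OF v(1)] typed_queue_moments[OF v(2)] case_prod_unfold
        expectation_pair_fst(1)[of _ _ "\<lambda>x. exp (- (s * (1 - mxg1_rho (R _)) * real x))"])
qed

theorem mainTheorem2:
  fixes Q :: "nat \<Rightarrow> smqueue" and Qb :: smqueue and \<mu> :: "nat \<Rightarrow> (nat \<times> 2) pmf"
  assumes "\<And>n. valid_smqueue (Q n)" and "valid_smqueue Qb"
    and "\<And>n. finite_batch_second_moment (Q n)" and "finite_batch_second_moment Qb"
    and "\<And>n i j. finite_alpha_hat (Q n) i j" and "\<And>i j. finite_alpha_hat Qb i j"
    and "heavy_traffic Q Qb"
    and "\<And>n. stationary_pmf (queue_step (Q n)) (\<mu> n)"
    and "(alpha_hat_total Qb - 1) / 2 + dependence_term Qb > 0"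
  shows "(\<forall>s\<ge>0. (\<lambda>n. measure_pmf.expectation (\<mu> n) (\<lambda>(x, j). exp (- s * (1 - rho (Q n)) * real x)))
             \<longlonglongrightarrow> 1 / (1 + s * ((alpha_hat_total Qb - 1) / 2 + dependence_term Qb))) \<and>
    (dependence_term Qb = 0 \<longrightarrow>
      (\<forall>s\<ge>0. (\<lambda>n. measure_pmf.expectation (\<mu> n) (\<lambda>(x, j). exp (- s * (1 - rho (Q n)) * real x)))
             \<longlonglongrightarrow> inverse (1 + s * ((alpha_hat_total Qb - 1) / 2))) \<and>
      (\<forall>(R :: nat \<Rightarrow> mxg1) (Rb :: mxg1) (\<nu> :: nat \<Rightarrow> nat pmf).
        (\<forall>n. valid_mxg1 (R n)) \<and> valid_mxg1 Rb \<and>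
        (\<forall>n. mxg1_finite_moments (R n)) \<and> mxg1_finite_moments Rb \<and>
        mxg1_heavy_traffic R Rb \<and>
        (\<forall>n. stationary_pmf (mxg1_step (R n)) (\<nu> n)) \<and>
        mxg1_second_moment Rb = alpha_hat_total Qb \<longrightarrow>
        (\<forall>s\<ge>0. (\<lambda>n. measure_pmf.expectation (\<nu> n) (\<lambda>x. exp (- s * (1 - mxg1_rho (R n)) * real x)))
             \<longlonglongrightarrow> inverse (1 + s * ((alpha_hat_total Qb - 1) / 2)))))"
proof -
  let ?L = "(alpha_hat_total Qb - 1) / 2 + dependence_term Qb"
  have lim: "(\<lambda>n. measure_pmf.expectation (\<mu> n) (\<lambda>(x, j). exp (- s * (1 - rho (Q n)) * real x)))
      \<longlonglongrightarrow> 1 / (1 + s * ?L)" if "0 \<le> s" for s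
    by (rule smqueue_heavy_traffic_limit[OF assms that])
  have "(\<lambda>n. measure_pmf.expectation (\<mu> n) (\<lambda>(x, j). exp (- s * (1 - rho (Q n)) * real x)))
      \<longlonglongrightarrow> inverse (1 + s * ((alpha_hat_total Qb - 1) / 2))" if "dependence_term Qb = 0" "0 \<le> s" for s
    using lim[OF that(2)] that(1) by (simp add: inverse_eq_divide)
  moreover have "(\<lambda>n. measure_pmf.expectation (\<nu> n) (\<lambda>x. exp (- s * (1 - mxg1_rho (R n)) * real x)))
      \<longlonglongrightarrow> inverse (1 + s * ((alpha_hat_total Qb - 1) / 2))"
    if "dependence_term Qb = 0" "\<And>n. valid_mxg1 (R n)" "valid_mxg1 Rb"
      "\<And>n. mxg1_finite_moments (R n)" "mxg1_finite_moments Rb" "mxg1_heavy_traffic R Rb"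
      "\<And>n. stationary_pmf (mxg1_step (R n)) (\<nu> n)" "mxg1_second_moment Rb = alpha_hat_total Qb" "0 \<le> s"
    for R Rb \<nu> s
  proof -
    \<comment> \<open>With vanishing dependence term, the positivity assumed for the semi-Markov
      coefficient is exactly what the standard queue with the same second moment requires.\<close>
    have "0 < (mxg1_second_moment Rb - 1) / 2" using assms(9) that(1,8) by simp
    from mxg1_heavy_traffic_limit[OF that(2-7) this that(9)] show ?thesis
      by (simp only: that(8) inverse_eq_divide)
  qed
  ultimately show ?thesis using lim by blast
qed

end
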